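(* Let $p$ be a prime, $K$ an algebraically closed field of characteristic $p$, and $n\ge d=p^m$ with $m\geq 1$. Then the representation ring $r(KZ_n/J^d)$ of the Nakayama truncated algebra $KZ_n/J^d$ is generated (as a ring) by $[M(1,\overline 1)]$, $[M(2,\overline 0)]$ and $[M(p^l+1,\overline 0)]$, $1\le l\le m-1$.
   Context: $Z_n$ is the oriented cycle with vertices $v_{\overline 0},\dots,v_{\overline{n-1}}$ (indexed by $\mathbb Z/n\mathbb Z$) and arrows $\alpha_{\overline i}:v_{\overline i}\to v_{\overline{i+1}}$; $KZ_n$ is its path algebra, with paths composed from right to left, and $J$ is the ideal generated by all arrows. $H=KZ_n/J^d$ is a cocommutative Hopf algebra with (induced) structure $\Delta(v_h)=\sum_{g_1+g_2=h}v_{g_1}\otimes v_{g_2}$, $\Delta(\alpha_h)=\sum_{g_1+g_2=h}(\alpha_{g_1}\otimes v_{g_2}+v_{g_1}\otimes\alpha_{g_2})$, $\varepsilon(v_h)=\delta_{h,\overline 0}$, $\varepsilon(\alpha_h)=0$, $S(v_h)=v_{-h}$, $S(\alpha_h)=-\alpha_{-h-\overline 1}$. Modules are finitely generated left modules; $V\otimes W=V\otimes_KW$ with $H$ acting through $\Delta$. $P_{\overline j}=Hv_{\overline j}$ and $M(i,\overline j)=P_{\overline j}/{\rm rad}^iP_{\overline j}$ for $1\le i\le d$, $\overline j\in\mathbb Z/n\mathbb Z$; these are all the indecomposable $H$-modules up to isomorphism. The representation ring $r(H)$ is the abelian group generated by isomorphism classes of $H$-modules modulo $[V]+[W]=[V\oplus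 W]$, with multiplication $[V][W]=[V\otimes W]$ and identity $[M(1,\overline 0)]$. *)

theory Defs
  imports
    "HOL-Algebra.Algebra"
    "HOL-Computational_Algebra.Computational_Algebra"
begin

section \<open>The path algebra of the oriented cycle and its truncations\<close>

text \<open>
  The group of integers modulo \<open>n\<close> is represented by the residues \<open>i < n\<close>. A path of the cycle is
  determined by its source \<open>i < n\<close> and its length \<open>l\<close>; it ends at \<open>(i + l) mod n\<close>. An element \<open>x\<close> of
  the path algebra is given by its coefficients: \<open>x i l\<close> is the coefficient of the path \<open>(i, l)\<close>.
\<close>

type_synonym 'k path_elt = "nat \<Rightarrow> nat \<Rightarrow> 'k"

definition path :: "nat \<Rightarrow> nat \<Rightarrow> 'k::field path_elt" where
  "path i l = (\<lambda>i' l'. if i' = i \<and> l' = l then 1 else 0)"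

definition path_scale :: "'k::field \<Rightarrow> 'k path_elt \<Rightarrow> 'k path_elt" where
  "path_scale c x = (\<lambda>i l. c * x i l)"

definition path_one :: "nat \<Rightarrow> 'k::field path_elt" where
  "path_one n = (\<lambda>i l. \<Sum>j<n. path j 0 i l)"

text \<open>
  Composition is from right to left. The path \<open>(i, l)\<close> factors in exactly \<open>l + 1\<close> ways, namely as
  \<open>((i + k) mod n, l - k) (i, k)\<close> with \<open>k \<le> l\<close>, the right-hand factor being traversed first.
\<close>

definition path_mult :: "nat \<Rightarrow> 'k::field path_elt \<Rightarrow> 'k path_elt \<Rightarrow> 'k path_elt" where
  "path_mult n x y = (\<lambda>i l. \<Sum>k\<le>l. x ((i + k) mod n) (l - k) * y i k)"

definition path_algebra :: "nat \<Rightarrow> 'k::field path_elt ring" where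
  "path_algebra n =
     \<lparr>carrier = {x. finite {(i, l). x i l \<noteq> 0} \<and> (\<forall>i l. x i l \<noteq> 0 \<longrightarrow> i < n)},
      monoid.mult = path_mult n,
      monoid.one = path_one n,
      ring.zero = (\<lambda>i l. 0),
      ring.add = (\<lambda>x y i l. x i l + y i l)\<rparr>"

definition arrow_ideal :: "nat \<Rightarrow> 'k::field path_elt set" where
  "arrow_ideal n = genideal (path_algebra n) {path i 1 | i. i < n}"

primrec ideal_power :: "('a, 'b) ring_scheme \<Rightarrow> 'a set \<Rightarrow> nat \<Rightarrow> 'a set" where
  "ideal_power R I 0 = carrier R"
| "ideal_power R I (Suc k) = ideal_prod R I (ideal_power R I k)"

type_synonym 'k trunc_elt = "'k path_elt set"

definition trunc_ideal :: "nat \<Rightarrow> nat \<Rightarrow> 'k::field path_elt set" where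
  "trunc_ideal n d = ideal_power (path_algebra n) (arrow_ideal n) d"

definition trunc_algebra :: "nat \<Rightarrow> nat \<Rightarrow> 'k::field trunc_elt ring" where
  "trunc_algebra n d = path_algebra n Quot trunc_ideal n d"

definition trunc_class :: "nat \<Rightarrow> nat \<Rightarrow> 'k::field path_elt \<Rightarrow> 'k trunc_elt" where
  "trunc_class n d x = trunc_ideal n d +>\<^bsub>path_algebra n\<^esub> x"

section \<open>The comultiplication\<close>

text \<open>
  The paths form a basis of the path algebra, so the pairs of paths form a basis of its tensor
  square, whose elements are again given by their coefficients. The product of the tensor square is
  the componentwise one, \<open>(a \<otimes> b) (a' \<otimes> b') = a a' \<otimes> b b'\<close>.
\<close>

type_synonym 'k path_tensor = "nat \<times> nat \<Rightarrow> nat \<times> nat \<Rightarrow> 'k"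

definition pure_tensor :: "'k::field path_elt \<Rightarrow> 'k path_elt \<Rightarrow> 'k path_tensor" where
  "pure_tensor x y = (\<lambda>(i, k) (j, l). x i k * y j l)"

definition path_tensor_mult ::
    "nat \<Rightarrow> 'k::field path_tensor \<Rightarrow> 'k path_tensor \<Rightarrow> 'k path_tensor" where
  "path_tensor_mult n F G = (\<lambda>(i, k) (j, l).
     \<Sum>a\<le>k. \<Sum>b\<le>l. F ((i + a) mod n, k - a) ((j + b) mod n, l - b) * G (i, a) (j, b))"

definition splittings :: "nat \<Rightarrow> nat \<Rightarrow> (nat \<times> nat) set" where
  "splittings n h = {(g1, g2). g1 < n \<and> g2 < n \<and> (g1 + g2) mod n = h}"

definition comult_vertex :: "nat \<Rightarrow> nat \<Rightarrow> 'k::field path_tensor" where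
  "comult_vertex n h = (\<lambda>p q. \<Sum>(g1, g2)\<in>splittings n h. pure_tensor (path g1 0) (path g2 0) p q)"

definition comult_arrow :: "nat \<Rightarrow> nat \<Rightarrow> 'k::field path_tensor" where
  "comult_arrow n h = (\<lambda>p q. \<Sum>(g1, g2)\<in>splittings n h.
     pure_tensor (path g1 1) (path g2 0) p q + pure_tensor (path g1 0) (path g2 1) p q)"

text \<open>The comultiplication is the algebra homomorphism with these values on vertices and arrows.\<close>

primrec comult_path :: "nat \<Rightarrow> nat \<Rightarrow> nat \<Rightarrow> 'k::field path_tensor" where
  "comult_path n i 0 = comult_vertex n i"
| "comult_path n i (Suc l) =
     path_tensor_mult n (comult_arrow n ((i + l) mod n)) (comult_path n i l)"

definition comult :: "nat \<Rightarrow> 'k::field path_elt \<Rightarrow> 'k path_tensor" where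
  "comult n x = (\<lambda>p q. \<Sum>(i, l)\<in>{(i, l). x i l \<noteq> 0}. x i l * comult_path n i l p q)"

section \<open>Left modules\<close>

text \<open>
  The locale \<open>module\<close> requires a commutative ring of scalars; its module axioms proper do not depend
  on commutativity.
\<close>

definition left_module :: "('a, 'b) ring_scheme \<Rightarrow> ('a, 'v, 'c) module_scheme \<Rightarrow> bool" where
  "left_module R M \<longleftrightarrow> ring R \<and> abelian_group M \<and> module_axioms R M"

definition fg_module :: "('a, 'b) ring_scheme \<Rightarrow> ('a, 'v, 'c) module_scheme \<Rightarrow> bool" where
  "fg_module R M \<longleftrightarrow> left_module R M \<and>
     (\<exists>S. finite S \<and> S \<subseteq> carrier M \<and> (\<forall>N. submodule N R M \<and> S \<subseteq> N \<longrightarrow> N = carrier M))"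

definition module_isomorphic ::
    "('a, 'b) ring_scheme \<Rightarrow> ('a, 'v, 'c) module_scheme \<Rightarrow> ('a, 'w, 'e) module_scheme \<Rightarrow> bool" where
  "module_isomorphic R M N \<longleftrightarrow> (\<exists>f. bij_betw f (carrier M) (carrier N) \<and>
     (\<forall>x\<in>carrier M. \<forall>y\<in>carrier M. f (x \<oplus>\<^bsub>M\<^esub> y) = f x \<oplus>\<^bsub>N\<^esub> f y) \<and>
     (\<forall>r\<in>carrier R. \<forall>x\<in>carrier M. f (r \<odot>\<^bsub>M\<^esub> x) = r \<odot>\<^bsub>N\<^esub> f x))"

text \<open>
  The record type of modules extends that of rings; the fields \<open>mult\<close> and \<open>one\<close> play no role in a
  module and are left unspecified.
\<close>

definition direct_sum_module ::
    "('a, 'v, 'c) module_scheme \<Rightarrow> ('a, 'w, 'e) module_scheme \<Rightarrow> ('a, 'v \<times> 'w) module" where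
  "direct_sum_module V W =
     \<lparr>carrier = carrier V \<times> carrier W,
      monoid.mult = undefined,
      monoid.one = undefined,
      ring.zero = (\<zero>\<^bsub>V\<^esub>, \<zero>\<^bsub>W\<^esub>),
      ring.add = (\<lambda>(v, w) (v', w'). (v \<oplus>\<^bsub>V\<^esub> v', w \<oplus>\<^bsub>W\<^esub> w')),
      module.smult = (\<lambda>r (v, w). (r \<odot>\<^bsub>V\<^esub> v, r \<odot>\<^bsub>W\<^esub> w))\<rparr>"

definition quotient_module :: "('a, 'v, 'c) module_scheme \<Rightarrow> 'v set \<Rightarrow> ('a, 'v set) module" where
  "quotient_module M N =
     \<lparr>carrier = a_rcosets\<^bsub>M\<^esub> N,
      monoid.mult = undefined,
      monoid.one = undefined,
      ring.zero = N,
      ring.add = set_add M,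
      module.smult = (\<lambda>r C. \<Union>x\<in>C. N +>\<^bsub>M\<^esub> (r \<odot>\<^bsub>M\<^esub> x))\<rparr>"

text \<open>The left ideal \<open>R e\<close>, as a module.\<close>

definition principal_module :: "('a, 'b) ring_scheme \<Rightarrow> 'a \<Rightarrow> ('a, 'a) module" where
  "principal_module R e =
     \<lparr>carrier = {r \<otimes>\<^bsub>R\<^esub> e | r. r \<in> carrier R},
      monoid.mult = undefined,
      monoid.one = undefined,
      ring.zero = \<zero>\<^bsub>R\<^esub>,
      ring.add = ring.add R,
      module.smult = monoid.mult R\<rparr>"

definition maximal_submodule ::
    "'v set \<Rightarrow> ('a, 'b) ring_scheme \<Rightarrow> ('a, 'v, 'c) module_scheme \<Rightarrow> bool" where
  "maximal_submodule N R M \<longleftrightarrow> submodule N R M \<and> N \<noteq> carrier M \<and>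
     (\<forall>L. submodule L R M \<and> N \<subseteq> L \<longrightarrow> L = N \<or> L = carrier M)"

definition radical :: "('a, 'b) ring_scheme \<Rightarrow> ('a, 'v, 'c) module_scheme \<Rightarrow> 'v set" where
  "radical R M = carrier M \<inter> \<Inter>{N. maximal_submodule N R M}"

primrec radical_power ::
    "('a, 'b) ring_scheme \<Rightarrow> ('a, 'v, 'c) module_scheme \<Rightarrow> nat \<Rightarrow> 'v set" where
  "radical_power R M 0 = carrier M"
| "radical_power R M (Suc k) = radical R (M\<lparr>carrier := radical_power R M k\<rparr>)"

section \<open>The modules \<open>M(i, j)\<close> and the tensor product of modules\<close>

definition proj_module :: "nat \<Rightarrow> nat \<Rightarrow> nat \<Rightarrow> ('k::field trunc_elt, 'k trunc_elt) module" where
  "proj_module n d j = principal_module (trunc_algebra n d) (trunc_class n d (path j 0))"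

definition nak_module ::
    "nat \<Rightarrow> nat \<Rightarrow> nat \<Rightarrow> nat \<Rightarrow> ('k::field trunc_elt, 'k trunc_elt set) module" where
  "nak_module n d i j = quotient_module (proj_module n d j)
     (radical_power (trunc_algebra n d) (proj_module n d j) i)"

text \<open>
  The tensor product of \<open>V\<close> and \<open>W\<close> over \<open>K\<close> is the free abelian group on \<open>V \<times> W\<close> modulo the usual
  relations; a scalar \<open>c\<close> acts on a module through the class of \<open>c 1\<close> in the algebra.
\<close>

definition tensor_relations ::
    "nat \<Rightarrow> nat \<Rightarrow> ('k::field trunc_elt, 'v) module \<Rightarrow> ('k trunc_elt, 'w) module
      \<Rightarrow> ('v \<times> 'w \<Rightarrow>\<^sub>0 int) set" where
  "tensor_relations n d V W =
     {frag_of (v \<oplus>\<^bsub>V\<^esub> v', w) - frag_of (v, w) - frag_of (v', w) | v v' w.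
        v \<in> carrier V \<and> v' \<in> carrier V \<and> w \<in> carrier W} \<union>
     {frag_of (v, w \<oplus>\<^bsub>W\<^esub> w') - frag_of (v, w) - frag_of (v, w') | v w w'.
        v \<in> carrier V \<and> w \<in> carrier W \<and> w' \<in> carrier W} \<union>
     {frag_of (trunc_class n d (path_scale c (path_one n)) \<odot>\<^bsub>V\<^esub> v, w)
        - frag_of (v, trunc_class n d (path_scale c (path_one n)) \<odot>\<^bsub>W\<^esub> w) | c v w.
        v \<in> carrier V \<and> w \<in> carrier W}"

definition tensor_kernel ::
    "nat \<Rightarrow> nat \<Rightarrow> ('k::field trunc_elt, 'v) module \<Rightarrow> ('k trunc_elt, 'w) module
      \<Rightarrow> ('v \<times> 'w \<Rightarrow>\<^sub>0 int) set" where
  "tensor_kernel n d V W =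
     generate (free_Abelian_group (carrier V \<times> carrier W)) (tensor_relations n d V W)"

text \<open>
  If \<open>\<Delta>(x) = \<Sum> c\<^bsub>p q\<^esub> p \<otimes> q\<close>, then \<open>x\<close> acts by \<open>v \<otimes> w \<mapsto> \<Sum> (c\<^bsub>p q\<^esub> p) v \<otimes> q w\<close>.
\<close>

definition tensor_act ::
    "nat \<Rightarrow> nat \<Rightarrow> ('k::field trunc_elt, 'v) module \<Rightarrow> ('k trunc_elt, 'w) module
      \<Rightarrow> 'k path_elt \<Rightarrow> ('v \<times> 'w \<Rightarrow>\<^sub>0 int) \<Rightarrow> ('v \<times> 'w \<Rightarrow>\<^sub>0 int)" where
  "tensor_act n d V W x = frag_extend (\<lambda>(v, w).
     \<Sum>((i, k), (j, l))\<in>{(p, q). comult n x p q \<noteq> 0}.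
       frag_of (trunc_class n d (path_scale (comult n x (i, k) (j, l)) (path i k)) \<odot>\<^bsub>V\<^esub> v,
                trunc_class n d (path j l) \<odot>\<^bsub>W\<^esub> w))"

text \<open>
  An element \<open>h\<close> of the truncated algebra is a coset of elements \<open>x\<close> of the path algebra. When the
  truncation ideal is a Hopf ideal, the coset of the result depends neither on the choice of \<open>x\<close> nor
  on that of the representative \<open>z\<close>, and the union below is that single coset.
\<close>

definition tensor_module ::
    "nat \<Rightarrow> nat \<Rightarrow> ('k::field trunc_elt, 'v) module \<Rightarrow> ('k trunc_elt, 'w) module
      \<Rightarrow> ('k trunc_elt, ('v \<times> 'w \<Rightarrow>\<^sub>0 int) set) module" where
  "tensor_module n d V W =
     (let F = free_Abelian_group (carrier V \<times> carrier W); R = tensor_kernel n d V W in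
      \<lparr>carrier = rcosets\<^bsub>F\<^esub> R,
       monoid.mult = undefined,
       monoid.one = undefined,
       ring.zero = R,
       ring.add = set_mult F,
       module.smult = (\<lambda>h C. \<Union>x\<in>h. \<Union>z\<in>C. R #>\<^bsub>F\<^esub> tensor_act n d V W x z)\<rparr>)"

section \<open>The representation ring\<close>

text \<open>
  A finitely generated module over the truncated algebra is finite-dimensional over \<open>K\<close>, hence
  isomorphic to one whose elements are taken from the type of functions \<open>nat \<Rightarrow> 'k\<close>. The isomorphism
  class of a module with elements of an arbitrary type is the set of its copies in this type.
\<close>

type_synonym 'k umodule = "('k trunc_elt, nat \<Rightarrow> 'k) module"

definition iso_class ::
    "nat \<Rightarrow> nat \<Rightarrow> ('k::field trunc_elt, 'v) module \<Rightarrow> 'k umodule set" where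
  "iso_class n d M =
     {N. fg_module (trunc_algebra n d) N \<and> module_isomorphic (trunc_algebra n d) M N}"

definition iso_classes :: "nat \<Rightarrow> nat \<Rightarrow> 'k::field umodule set set" where
  "iso_classes n d = {iso_class n d V | V :: 'k umodule. fg_module (trunc_algebra n d) V}"

definition class_tensor ::
    "nat \<Rightarrow> nat \<Rightarrow> 'k::field umodule set \<Rightarrow> 'k umodule set \<Rightarrow> 'k umodule set" where
  "class_tensor n d A B = (\<Union>V\<in>A. \<Union>W\<in>B. iso_class n d (tensor_module n d V W))"

text \<open>The free abelian group on the isomorphism classes, with the biadditive product induced by \<open>\<otimes>\<close>.\<close>

definition free_rep_ring :: "nat \<Rightarrow> nat \<Rightarrow> ('k::field umodule set \<Rightarrow>\<^sub>0 int) ring" where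
  "free_rep_ring n d =
     \<lparr>carrier = {f. Poly_Mapping.keys f \<subseteq> iso_classes n d},
      monoid.mult = (\<lambda>f g. frag_extend (\<lambda>A. frag_extend (\<lambda>B. frag_of (class_tensor n d A B)) g) f),
      monoid.one = frag_of (iso_class n d (nak_module n d 1 0)),
      ring.zero = 0,
      ring.add = (+)\<rparr>"

definition direct_sum_relations :: "nat \<Rightarrow> nat \<Rightarrow> ('k::field umodule set \<Rightarrow>\<^sub>0 int) set" where
  "direct_sum_relations n d =
     {frag_of (iso_class n d V) + frag_of (iso_class n d W)
        - frag_of (iso_class n d (direct_sum_module V W)) | (V :: 'k umodule) (W :: 'k umodule).
        fg_module (trunc_algebra n d) V \<and> fg_module (trunc_algebra n d) W}"

text \<open>The additive subgroup generated by the relations; it is an ideal, as \<open>\<otimes>\<close> distributes over \<open>\<oplus>\<close>.\<close>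

definition rep_ideal :: "nat \<Rightarrow> nat \<Rightarrow> ('k::field umodule set \<Rightarrow>\<^sub>0 int) set" where
  "rep_ideal n d = generate (add_monoid (free_rep_ring n d)) (direct_sum_relations n d)"

definition rep_ring :: "nat \<Rightarrow> nat \<Rightarrow> ('k::field umodule set \<Rightarrow>\<^sub>0 int) set ring" where
  "rep_ring n d = free_rep_ring n d Quot rep_ideal n d"

definition rep_class ::
    "nat \<Rightarrow> nat \<Rightarrow> ('k::field trunc_elt, 'v) module \<Rightarrow> ('k umodule set \<Rightarrow>\<^sub>0 int) set" where
  "rep_class n d M = rep_ideal n d +>\<^bsub>free_rep_ring n d\<^esub> frag_of (iso_class n d M)"

end

theory Submission
  imports Defs
begin

text \<open>
  Four facts carry the proof.

  An \<open>H\<close>-module is a vector space graded by the residues modulo \<open>n\<close> together with an operator \<open>N\<close>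
  (the sum of all arrows) that raises the grade by one and satisfies \<open>N\<^sup>d = 0\<close>; the locale
  \<open>graded_space\<close> and \<open>graded_module\<close> turn such data into modules. A chain of \<open>i\<close> basis vectors that
  starts in grade \<open>j\<close> and along which \<open>N\<close> moves is \<open>M(i, j)\<close> (\<open>nak_module_iso\<close>).

  Every finitely generated module is a direct sum of such chains (\<open>fg_module_block_decomposition\<close>).
  Among the homogeneous generating families with a fixed index set, take one for which the sum of the
  nilpotency orders of the generators is least. In a linear relation between the vectors \<open>N\<^sup>k w\<^sub>a\<close>,
  the generator that occurs with the smallest \<open>k\<close> could be replaced by one of smaller order
  (\<open>shorten_family\<close>), so there is no relation, and the vectors form a basis.

  On \<open>V \<otimes> W\<close> the operator is \<open>N \<otimes> 1 + 1 \<otimes> N\<close> (\<open>comult_action\<close>, \<open>fibre_iso\<close>). Its powers follow the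
  binomial formula, and \<open>d = p\<^sup>m\<close> makes the \<open>d\<close>-th one vanish. Hence tensoring respects isomorphism
  and direct sums, and cosets in the representation ring are multiplied through representatives
  (\<open>rep_ring_mult\<close>).

  Tensoring with \<open>M(1, 1)\<close> turns \<open>M(i, j)\<close> into \<open>M(i, j + 1)\<close>, so one class of each length \<open>i\<close> is
  enough. Let \<open>q = p\<^sup>l < i \<le> p q\<close> and \<open>r = i - q\<close>. The total degree on
  \<open>M(q + 1, 0) \<otimes> M(r, 0)\<close> runs from \<open>0\<close> to \<open>i - 1\<close>, with one basis vector at either end, and \<open>N\<close> to the
  power \<open>i - 1\<close> sends the first to \<open>(i - 1 choose q)\<close> times the last. This coefficient is congruent
  modulo \<open>p\<close> to \<open>(i - 1) div q\<close>, which lies strictly between \<open>0\<close> and \<open>p\<close>. So the product has exactly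
  one summand of length \<open>i\<close>, and all others are shorter (\<open>tensor_longest_block\<close>); by induction on \<open>i\<close>
  the class of that summand is a difference of elements of the generated ring.
\<close>

section \<open>The truncated path algebra\<close>

lemma path_one_apply: "path_one n i l = (if i < n \<and> l = 0 then 1 else 0)"
proof -
  have "path_one n i l = (\<Sum>j<n. if i = j then (if l = 0 then 1 else 0) else 0)"
    unfolding path_one_def path_def by (rule sum.cong) auto
  also have "\<dots> = (if i < n \<and> l = 0 then 1 else 0)"
    by (subst sum.delta') auto
  finally show ?thesis .
qed

lemma path_algebra_simps [simp]:
  "x \<otimes>\<^bsub>path_algebra n\<^esub> y = path_mult n x y"
  "\<one>\<^bsub>path_algebra n\<^esub> = path_one n"
  "\<zero>\<^bsub>path_algebra n\<^esub> = (\<lambda>i l. 0)"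
  "x \<oplus>\<^bsub>path_algebra n\<^esub> y = (\<lambda>i l. x i l + y i l)"
  by (simp_all add: path_algebra_def)

lemma path_carrier_iff:
  "x \<in> carrier (path_algebra n) \<longleftrightarrow> finite {(i, l). x i l \<noteq> 0} \<and> (\<forall>i l. x i l \<noteq> 0 \<longrightarrow> i < n)"
  by (simp add: path_algebra_def)

lemma path_carrierI:
  assumes "\<And>i l. x i l \<noteq> 0 \<Longrightarrow> i < n \<and> l < b"
  shows "x \<in> carrier (path_algebra n)"
proof -
  have "{(i, l). x i l \<noteq> 0} \<subseteq> {..<n} \<times> {..<b}" using assms by auto
  then have "finite {(i, l). x i l \<noteq> 0}" by (rule finite_subset) auto
  with assms show ?thesis by (auto simp: path_carrier_iff)
qed

lemma path_carrierE:
  assumes "x \<in> carrier (path_algebra n)"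
  obtains b where "\<forall>i l. x i l \<noteq> 0 \<longrightarrow> i < n \<and> l < b"
proof -
  have fin: "finite {(i, l). x i l \<noteq> 0}" using assms by (simp add: path_carrier_iff)
  define b where "b = Suc (Max (snd ` {(i, l). x i l \<noteq> 0}))"
  have "l < b" if "x i l \<noteq> 0" for i l
    unfolding b_def using that fin by (auto intro!: le_imp_less_Suc Max_ge simp: image_iff)
  then have "\<forall>i l. x i l \<noteq> 0 \<longrightarrow> i < n \<and> l < b" using assms by (auto simp: path_carrier_iff)
  then show ?thesis by (rule that)
qed

lemma path_in_carrier [simp]: "i < n \<Longrightarrow> path i l \<in> carrier (path_algebra n)"
  by (rule path_carrierI[where b="Suc l"]) (auto simp: path_def split: if_splits)

lemma path_scale_in_carrier [simp]:
  assumes "x \<in> carrier (path_algebra n)"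
  shows "path_scale c x \<in> carrier (path_algebra n)"
proof -
  obtain b where "\<forall>i l. x i l \<noteq> 0 \<longrightarrow> i < n \<and> l < b" using assms by (rule path_carrierE)
  then show ?thesis by (intro path_carrierI[where b=b]) (auto simp: path_scale_def)
qed

lemma path_mult_assoc:
  "path_mult n (path_mult n x y) z = path_mult n x (path_mult n y z)"
proof (intro ext)
  fix i l
  have "path_mult n (path_mult n x y) z i l =
     (\<Sum>(k,u)\<in>(SIGMA k:{..l}. {..l-k}). x ((i+k+u) mod n) (l-k-u) * y ((i+k) mod n) u * z i k)"
    by (simp add: path_mult_def sum_distrib_right mod_simps sum.Sigma)
  also have "\<dots> = (\<Sum>(k,u)\<in>(SIGMA k:{..l}. {..k}). x ((i+k) mod n) (l-k) * (y ((i+u) mod n) (k-u) * z i u))"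
    by (rule sum.reindex_bij_witness[where i="\<lambda>(k,u). (u, k-u)" and j="\<lambda>(k,u). (k+u, k)"])
       (auto simp: add.assoc mult.assoc)
  also have "\<dots> = path_mult n x (path_mult n y z) i l"
    by (simp add: path_mult_def sum_distrib_left sum.Sigma)
  finally show "path_mult n (path_mult n x y) z i l = path_mult n x (path_mult n y z) i l" .
qed

lemma path_mult_closed:
  assumes "0 < n" "x \<in> carrier (path_algebra n)" "y \<in> carrier (path_algebra n)"
  shows "path_mult n x y \<in> carrier (path_algebra n)"
proof -
  obtain b where b: "\<forall>i l. x i l \<noteq> 0 \<longrightarrow> i < n \<and> l < b" using assms(2) by (rule path_carrierE)
  obtain e where e: "\<forall>i l. y i l \<noteq> 0 \<longrightarrow> i < n \<and> l < e" using assms(3) by (rule path_carrierE)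
  show ?thesis
  proof (rule path_carrierI[where b="b+e"])
    fix i l assume "path_mult n x y i l \<noteq> 0"
    then obtain k where "k \<le> l" "x ((i+k) mod n) (l-k) * y i k \<noteq> 0"
      unfolding path_mult_def by (meson sum.not_neutral_contains_not_neutral atMost_iff)
    with b[rule_format, of "(i+k) mod n" "l-k"] e[rule_format, of i k] show "i < n \<and> l < b + e" by auto
  qed
qed

lemma path_add_closed:
  assumes "x \<in> carrier (path_algebra n)" "y \<in> carrier (path_algebra n)"
  shows "(\<lambda>i l. x i l + y i l) \<in> carrier (path_algebra n)"
proof -
  obtain b where b: "\<forall>i l. x i l \<noteq> 0 \<longrightarrow> i < n \<and> l < b" using assms(1) by (rule path_carrierE)
  obtain e where e: "\<forall>i l. y i l \<noteq> 0 \<longrightarrow> i < n \<and> l < e" using assms(2) by (rule path_carrierE)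
  show ?thesis
  proof (rule path_carrierI[where b="b+e"])
    fix i l assume "x i l + y i l \<noteq> 0"
    then have "x i l \<noteq> 0 \<or> y i l \<noteq> 0" by auto
    with b[rule_format, of i l] e[rule_format, of i l] show "i < n \<and> l < b + e" by auto
  qed
qed

lemma path_zero_closed: "(\<lambda>i l. 0) \<in> carrier (path_algebra n)"
  by (rule path_carrierI) auto

lemma path_one_closed: "path_one n \<in> carrier (path_algebra n)"
  by (rule path_carrierI[where b=1]) (auto simp: path_one_apply split: if_splits)

lemma path_uminus_closed:
  assumes "x \<in> carrier (path_algebra n)"
  shows "(\<lambda>i l. - x i l) \<in> carrier (path_algebra n)"
proof -
  obtain b where "\<forall>i l. x i l \<noteq> 0 \<longrightarrow> i < n \<and> l < b" using assms by (rule path_carrierE)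
  then show ?thesis by (intro path_carrierI[where b=b]) auto
qed

lemma path_mult_path_right:
  "path_mult n x (path j k) i l = (if i = j \<and> k \<le> l then x ((j + k) mod n) (l - k) else 0)"
proof -
  have "path_mult n x (path j k) i l = (\<Sum>u\<le>l. if u = k then (if i = j then x ((i+k) mod n) (l-k) else 0) else 0)"
    unfolding path_mult_def path_def by (rule sum.cong) auto
  then show ?thesis by (auto simp: sum.delta')
qed

lemma path_mult_path_path:
  assumes "i < n" "j < n"
  shows "path_mult n (path i l) (path j k) = (if (j + k) mod n = i then path j (k + l) else (\<lambda>i l. 0))"
  by (intro ext) (auto simp: path_mult_path_right, auto simp: path_def)

lemma path_mult_scale:
  "path_mult n (path_scale c x) y = path_scale c (path_mult n x y)"
  "path_mult n x (path_scale c y) = path_scale c (path_mult n x y)"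
  by (simp_all add: path_mult_def path_scale_def sum_distrib_left mult.assoc mult.left_commute)

lemma path_mult_one_left:
  assumes "0 < n"
  shows "path_mult n (path_one n) x = x"
proof (intro ext)
  fix i l
  have "path_mult n (path_one n) x i l = (\<Sum>u\<le>l. if u = l then x i l else 0)"
    unfolding path_mult_def path_one_apply using assms by (intro sum.cong) auto
  then show "path_mult n (path_one n) x i l = x i l" by simp
qed

lemma path_mult_one_right:
  assumes "x \<in> carrier (path_algebra n)"
  shows "path_mult n x (path_one n) = x"
proof (intro ext)
  fix i l
  have "path_mult n x (path_one n) i l = (\<Sum>u\<le>l. if u = 0 then x i l else 0)"
    unfolding path_mult_def path_one_apply using assms
    by (intro sum.cong) (auto simp: path_carrier_iff)
  then show "path_mult n x (path_one n) i l = x i l" by simp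
qed

lemma path_algebra_ring:
  assumes "0 < n"
  shows "ring (path_algebra n :: 'k::field path_elt ring)"
proof (rule ringI)
  show "abelian_group (path_algebra n :: 'k::field path_elt ring)"
  proof (rule abelian_groupI)
    fix x :: "'k path_elt" assume "x \<in> carrier (path_algebra n)"
    then show "\<exists>y\<in>carrier (path_algebra n). y \<oplus>\<^bsub>path_algebra n\<^esub> x = \<zero>\<^bsub>path_algebra n\<^esub>"
      by (intro bexI[of _ "\<lambda>i l. - x i l"]) (auto simp: path_uminus_closed)
  qed (auto simp: path_add_closed path_zero_closed add_ac)
  show "Group.monoid (path_algebra n :: 'k::field path_elt ring)"
    by (rule monoidI) (auto simp: assms path_mult_closed path_one_closed path_mult_assoc
        path_mult_one_left path_mult_one_right)
qed (auto simp: path_mult_def distrib_left distrib_right sum.distrib intro!: ext)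

text \<open>The powers of the arrow ideal, as \<open>trunc_ideal_eq\<close> shows.\<close>

definition long_paths :: "nat \<Rightarrow> nat \<Rightarrow> 'k::field path_elt set" where
  "long_paths n k = {x \<in> carrier (path_algebra n). \<forall>i l. l < k \<longrightarrow> x i l = 0}"

lemma long_paths_carrier: "x \<in> long_paths n k \<Longrightarrow> x \<in> carrier (path_algebra n)"
  by (simp add: long_paths_def)

lemma long_pathsD: "x \<in> long_paths n k \<Longrightarrow> l < k \<Longrightarrow> x i l = 0"
  by (simp add: long_paths_def)

lemma long_pathsI:
  "x \<in> carrier (path_algebra n) \<Longrightarrow> (\<And>i l. l < k \<Longrightarrow> x i l = 0) \<Longrightarrow> x \<in> long_paths n k"
  by (simp add: long_paths_def)

lemma long_paths_ideal:
  assumes n: "0 < n"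
  shows "ideal (long_paths n k) (path_algebra n :: 'k::field path_elt ring)"
proof (rule idealI)
  interpret R: ring "path_algebra n :: 'k::field path_elt ring" using n by (rule path_algebra_ring)
  show "ring (path_algebra n :: 'k::field path_elt ring)" by (rule R.ring_axioms)
  show "subgroup (long_paths n k) (add_monoid (path_algebra n :: 'k::field path_elt ring))"
  proof (rule R.add.subgroupI)
    show "long_paths n k \<subseteq> carrier (path_algebra n)" by (auto simp: long_paths_def)
    show "(long_paths n k :: 'k::field path_elt set) \<noteq> {}" using path_zero_closed by (force simp: long_paths_def)
    fix x y :: "'k path_elt" assume x: "x \<in> long_paths n k"
    have "\<ominus>\<^bsub>path_algebra n\<^esub> x = (\<lambda>i l. - x i l)"
      using x by (intro R.minus_equality) (auto simp: long_paths_def path_uminus_closed)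
    then show "\<ominus>\<^bsub>path_algebra n\<^esub> x \<in> long_paths n k"
      using x by (auto simp: long_paths_def path_uminus_closed)
    assume "y \<in> long_paths n k"
    with x show "x \<oplus>\<^bsub>path_algebra n\<^esub> y \<in> long_paths n k"
      by (auto simp: long_paths_def path_add_closed)
  qed
  fix a x :: "'k path_elt" assume a: "a \<in> long_paths n k" "x \<in> carrier (path_algebra n)"
  show "x \<otimes>\<^bsub>path_algebra n\<^esub> a \<in> long_paths n k" 
    using a n by (auto simp: long_paths_def path_mult_closed) (auto simp: path_mult_def intro!: sum.neutral)
  show "a \<otimes>\<^bsub>path_algebra n\<^esub> x \<in> long_paths n k"
    using a n by (auto simp: long_paths_def path_mult_closed) (auto simp: path_mult_def intro!: sum.neutral)
qed

text \<open>Every element is a finite sum of scaled paths, so additive statements need only be checked on those.\<close>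

lemma path_algebra_induct [consumes 1, case_names zero step]:
  assumes "x \<in> carrier (path_algebra n)"
    and "P (\<lambda>i l. 0)"
    and "\<And>y i l. y \<in> carrier (path_algebra n) \<Longrightarrow> P y \<Longrightarrow> i < n \<Longrightarrow> x i l \<noteq> 0 \<Longrightarrow>
           P (\<lambda>i' l'. path_scale (x i l) (path i l) i' l' + y i' l')"
  shows "P x"
proof -
  define res where "res S = (\<lambda>i l. if (i, l) \<in> S then x i l else 0)" for S
  have res: "P (res S) \<and> res S \<in> carrier (path_algebra n)" if "finite S" "S \<subseteq> {(i, l). x i l \<noteq> 0}" for S
    using that
  proof (induction S)
    case empty
    have "res {} = (\<lambda>i l. 0)" by (simp add: res_def)
    then show ?case using assms(2) path_zero_closed[of n] by simp
  next
    case (insert q S)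
    obtain i l where q: "q = (i, l)" by (cases q)
    have nz: "x i l \<noteq> 0" and i: "i < n" using insert.prems q assms(1) by (auto simp: path_carrier_iff)
    have eq: "res (insert q S) = (\<lambda>i' l'. path_scale (x i l) (path i l) i' l' + res S i' l')"
      using insert.hyps q by (auto simp: res_def path_scale_def path_def intro!: ext)
    have IH: "P (res S)" "res S \<in> carrier (path_algebra n)" using insert by auto
    show ?case unfolding eq using assms(3)[OF IH(2,1) i nz] path_add_closed[OF _ IH(2)] i by auto
  qed
  have "res {(i, l). x i l \<noteq> 0} = x" by (auto simp: res_def intro!: ext)
  with res[of "{(i, l). x i l \<noteq> 0}"] assms(1) show ?thesis by (auto simp: path_carrier_iff)
qed

text \<open>
  A path of positive length is a shorter path times an arrow.
\<close>

lemma arrow_ideal_eq: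
  assumes n: "0 < n"
  shows "(arrow_ideal n :: 'k::field path_elt set) = long_paths n 1"
proof
  interpret R: ring "path_algebra n :: 'k::field path_elt ring" using n by (rule path_algebra_ring)
  have sub: "{path i 1 |i. i < n} \<subseteq> (long_paths n 1 :: 'k path_elt set)"
    by (auto simp: long_paths_def) (auto simp: path_def)
  then show "(arrow_ideal n :: 'k::field path_elt set) \<subseteq> long_paths n 1"
    unfolding arrow_ideal_def by (intro R.genideal_minimal long_paths_ideal n)
  have "ideal (arrow_ideal n) (path_algebra n :: 'k::field path_elt ring)"
    unfolding arrow_ideal_def by (rule R.genideal_ideal) auto
  then interpret I: ideal "arrow_ideal n :: 'k::field path_elt set" "path_algebra n :: 'k::field path_elt ring" .
  have arrow: "path i 1 \<in> (arrow_ideal n :: 'k::field path_elt set)" if "i < n" for i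
    unfolding arrow_ideal_def using that by (intro subsetD[OF R.genideal_self]) auto
  show "long_paths n 1 \<subseteq> (arrow_ideal n :: 'k::field path_elt set)"
  proof
    fix x :: "'k path_elt" assume x: "x \<in> long_paths n 1"
    then have "x \<in> carrier (path_algebra n)" by (rule long_paths_carrier)
    then show "x \<in> arrow_ideal n"
    proof (induction rule: path_algebra_induct)
      case zero show ?case using I.zero_closed by simp
    next
      case (step y i l)
      then have "l \<noteq> 0" using x by (auto simp: long_paths_def intro!: gr0I)
      then have "path_scale (x i l) (path i l) = path_mult n (path_scale (x i l) (path ((i+1) mod n) (l-1))) (path i 1)"
        using step n by (simp add: path_mult_scale path_mult_path_path)
      also have "\<dots> \<in> arrow_ideal n"
        using I.I_l_closed[OF arrow[OF \<open>i<n\<close>], of "path_scale (x i l) (path ((i+1) mod n) (l-1))"] n by simp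
      finally show ?case using I.a_closed[OF _ step.IH] by simp
    qed
  qed
qed

text \<open>
  Lengths add under composition, and a path of length greater than \<open>d\<close> is a nontrivial path after a
  path of length \<open>d\<close>.
\<close>

lemma trunc_ideal_eq:
  assumes n: "0 < n"
  shows "(trunc_ideal n d :: 'k::field path_elt set) = long_paths n d"
  unfolding trunc_ideal_def arrow_ideal_eq[OF n]
proof (induction d)
  case 0 show ?case by (auto simp: long_paths_def)
next
  case (Suc d)
  interpret R: ring "path_algebra n :: 'k::field path_elt ring" using n by (rule path_algebra_ring)
  interpret I: ideal "long_paths n (Suc d) :: 'k::field path_elt set" "path_algebra n :: 'k::field path_elt ring"
    by (rule long_paths_ideal[OF n])
  have mem: "path_mult n i j \<in> long_paths n (Suc d)" if i: "i \<in> long_paths n 1" and j: "j \<in> long_paths n d" for i j :: "'k path_elt"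
  proof -
    have "path_mult n i j a l = 0" if l: "l < Suc d" for a l
      unfolding path_mult_def
    proof (rule sum.neutral, rule)
      fix k assume "k \<in> {..l}"
      then consider "k = l" | "k < d" using l by force
      then show "i ((a + k) mod n) (l - k) * j a k = 0"
      proof cases
        case 1
        have "i ((a + k) mod n) 0 = 0" using i by (rule long_pathsD) simp
        with 1 show ?thesis by simp
      next
        case 2
        then have "j a k = 0" using j by (auto dest: long_pathsD)
        then show ?thesis by simp
      qed
    qed
    moreover have "path_mult n i j \<in> carrier (path_algebra n)"
      using i j n by (intro path_mult_closed long_paths_carrier)
    ultimately show ?thesis by (intro long_pathsI)
  qed
  have "ideal_prod (path_algebra n) (long_paths n 1) (long_paths n d) = (long_paths n (Suc d) :: 'k path_elt set)"
  proof (intro equalityI subsetI)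
    fix x :: "'k path_elt" assume "x \<in> ideal_prod (path_algebra n) (long_paths n 1) (long_paths n d)"
    then show "x \<in> long_paths n (Suc d)"
    proof (induction rule: ideal_prod.induct)
      case (prod i j) then show ?case using mem by simp
    qed (use I.a_closed in blast)
  next
    fix x :: "'k path_elt" assume x: "x \<in> long_paths n (Suc d)"
    then have "x \<in> carrier (path_algebra n)" by (rule long_paths_carrier)
    then show "x \<in> ideal_prod (path_algebra n) (long_paths n 1) (long_paths n d)"
    proof (induction rule: path_algebra_induct)
      case zero
      have "(\<lambda>i l. 0) \<otimes>\<^bsub>path_algebra n\<^esub> (\<lambda>i l. 0) \<in> ideal_prod (path_algebra n) (long_paths n 1) (long_paths n d :: 'k path_elt set)"
        by (intro ideal_prod.prod long_pathsI path_zero_closed) auto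
      then show ?case by (simp add: path_mult_def)
    next
      case (step y i l)
      then have l: "l \<ge> Suc d" using long_pathsD[OF x, of l i] by (cases "l < Suc d") auto
      then have eq: "path_scale (x i l) (path i l) = path_mult n (path_scale (x i l) (path ((i+d) mod n) (l-d))) (path i d)"
        using step n by (simp add: path_mult_scale path_mult_path_path)
      have "path_scale (x i l) (path ((i+d) mod n) (l-d)) \<otimes>\<^bsub>path_algebra n\<^esub> path i d \<in> ideal_prod (path_algebra n) (long_paths n 1) (long_paths n d)"
        using l n step by (intro ideal_prod.prod long_pathsI path_scale_in_carrier path_in_carrier)
            (auto simp: path_scale_def path_def)
      from ideal_prod.sum[OF this step.IH]
      show ?case by (simp add: eq)
    qed
  qed
  then show ?case using Suc by simp
qed

text \<open>
  The parameter \<open>Kt\<close> carries no value; it fixes the type of the scalars, which occurs in neither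
  assumption.
\<close>

locale nakayama =
  fixes n d :: nat and Kt :: "'k::field itself"
  assumes d_pos: "0 < d" and d_le_n: "d \<le> n"
begin

abbreviation P :: "'k path_elt ring" where "P \<equiv> path_algebra n"
abbreviation A :: "'k trunc_elt ring" where "A \<equiv> trunc_algebra n d"
abbreviation tc :: "'k path_elt \<Rightarrow> 'k trunc_elt" where "tc \<equiv> trunc_class n d"

lemma n_pos: "0 < n"
  using d_pos d_le_n by simp

lemma trunc_ideal_ideal: "ideal (trunc_ideal n d) P"
  unfolding trunc_ideal_eq[OF n_pos] by (rule long_paths_ideal[OF n_pos])

sublocale P: ring P by (rule path_algebra_ring[OF n_pos])

sublocale A: ring A
  unfolding trunc_algebra_def by (rule ideal.quotient_is_ring[OF trunc_ideal_ideal])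

lemma tc_hom: "tc \<in> ring_hom P A"
proof -
  have "tc = (+>\<^bsub>P\<^esub>) (trunc_ideal n d)" by (auto simp: trunc_class_def)
  then show ?thesis unfolding trunc_algebra_def using ideal.rcos_ring_hom[OF trunc_ideal_ideal] by simp
qed

lemma tc_closed [simp]: "x \<in> carrier P \<Longrightarrow> tc x \<in> carrier A"
  by (rule ring_hom_closed[OF tc_hom])

lemma tc_mult: "x \<in> carrier P \<Longrightarrow> y \<in> carrier P \<Longrightarrow> tc x \<otimes>\<^bsub>A\<^esub> tc y = tc (path_mult n x y)"
  using ring_hom_mult[OF tc_hom, of x y] by simp

lemma tc_add: "x \<in> carrier P \<Longrightarrow> y \<in> carrier P \<Longrightarrow> tc x \<oplus>\<^bsub>A\<^esub> tc y = tc (\<lambda>i l. x i l + y i l)"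
  using ring_hom_add[OF tc_hom, of x y] by simp

lemma tc_one: "\<one>\<^bsub>A\<^esub> = tc (path_one n)"
  using ring_hom_one[OF tc_hom] by simp

lemma tc_zero: "\<zero>\<^bsub>A\<^esub> = tc (\<lambda>i l. 0)"
  using ring_hom_zero[OF tc_hom P.ring_axioms A.ring_axioms] by simp

lemma carrier_A_E:
  assumes "a \<in> carrier A"
  obtains x where "x \<in> carrier P" "a = tc x"
  using assms unfolding trunc_algebra_def FactRing_def A_RCOSETS_def' trunc_class_def by auto

lemma mem_tc_iff:
  assumes "x \<in> carrier P"
  shows "y \<in> tc x \<longleftrightarrow> y \<in> carrier P \<and> (\<forall>i l. l < d \<longrightarrow> y i l = x i l)"
proof
  assume "y \<in> tc x"
  then obtain z where z: "z \<in> long_paths n d" "y = (\<lambda>i l. z i l + x i l)"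
    by (auto simp: trunc_class_def trunc_ideal_eq[OF n_pos] a_r_coset_def r_coset_def)
  then show "y \<in> carrier P \<and> (\<forall>i l. l < d \<longrightarrow> y i l = x i l)"
    using assms path_add_closed[OF long_paths_carrier assms] by (auto simp: long_pathsD)
next
  assume y: "y \<in> carrier P \<and> (\<forall>i l. l < d \<longrightarrow> y i l = x i l)"
  have "(\<lambda>i l. y i l + - x i l) \<in> carrier P" using y assms path_add_closed path_uminus_closed by blast
  then have "(\<lambda>i l. y i l + - x i l) \<in> long_paths n d" using y by (intro long_pathsI) auto
  moreover have "y = (\<lambda>i l. y i l + - x i l) \<oplus>\<^bsub>P\<^esub> x" by simp
  ultimately show "y \<in> tc x"
    unfolding trunc_class_def trunc_ideal_eq[OF n_pos] a_r_coset_def r_coset_def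
    by (auto intro!: bexI[of _ "\<lambda>i l. y i l + - x i l"])
qed

lemma tc_eq_iff:
  assumes "x \<in> carrier P" "y \<in> carrier P"
  shows "tc x = tc y \<longleftrightarrow> (\<forall>i l. l < d \<longrightarrow> x i l = y i l)"
proof
  assume "tc x = tc y"
  then have "x \<in> tc y" using mem_tc_iff[OF assms(1), of x] assms by auto
  then show "\<forall>i l. l < d \<longrightarrow> x i l = y i l" using mem_tc_iff[OF assms(2)] by auto
next
  assume "\<forall>i l. l < d \<longrightarrow> x i l = y i l"
  then show "tc x = tc y" using assms by (auto simp: mem_tc_iff)
qed

text \<open>Only the coefficients of length below \<open>d\<close> are independent of the choice.\<close>

definition rep :: "'k trunc_elt \<Rightarrow> 'k path_elt" where
  "rep a = (SOME x. x \<in> a)"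

lemma rep_tc:
  assumes "x \<in> carrier P"
  shows "rep (tc x) \<in> carrier P" and "l < d \<Longrightarrow> rep (tc x) i l = x i l"
proof -
  have "x \<in> tc x" using mem_tc_iff[OF assms] assms by simp
  then have "rep (tc x) \<in> tc x" unfolding rep_def by (rule someI[of "\<lambda>z. z \<in> tc x"])
  then show "rep (tc x) \<in> carrier P" and "l < d \<Longrightarrow> rep (tc x) i l = x i l"
    using mem_tc_iff[OF assms] by auto
qed

end

section \<open>Left modules and their isomorphisms\<close>

text \<open>
  The locale \<open>module\<close> is about commutative rings; this locale provides the same facts for
  left modules over any ring.
\<close>

locale left_mod = R?: ring R + M?: abelian_group M
  for R :: "('a, 'b) ring_scheme" and M :: "('a, 'v, 'c) module_scheme" (structure) +
  assumes module_axioms: "module_axioms R M"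

lemma left_module_iff: "left_module R M \<longleftrightarrow> left_mod R M"
  by (simp add: left_module_def left_mod_def left_mod_axioms_def)

context left_mod
begin

lemma smult_closed [simp, intro]: "a \<in> carrier R \<Longrightarrow> x \<in> carrier M \<Longrightarrow> a \<odot>\<^bsub>M\<^esub> x \<in> carrier M"
  using module_axioms by (simp add: module_axioms_def)

lemma smult_l_distr:
  "a \<in> carrier R \<Longrightarrow> b \<in> carrier R \<Longrightarrow> x \<in> carrier M \<Longrightarrow>
     (a \<oplus>\<^bsub>R\<^esub> b) \<odot>\<^bsub>M\<^esub> x = a \<odot>\<^bsub>M\<^esub> x \<oplus>\<^bsub>M\<^esub> b \<odot>\<^bsub>M\<^esub> x"
  using module_axioms by (simp add: module_axioms_def)

lemma smult_r_distr:
  "a \<in> carrier R \<Longrightarrow> x \<in> carrier M \<Longrightarrow> y \<in> carrier M \<Longrightarrow>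
     a \<odot>\<^bsub>M\<^esub> (x \<oplus>\<^bsub>M\<^esub> y) = a \<odot>\<^bsub>M\<^esub> x \<oplus>\<^bsub>M\<^esub> a \<odot>\<^bsub>M\<^esub> y"
  using module_axioms by (simp add: module_axioms_def)

lemma smult_assoc:
  "a \<in> carrier R \<Longrightarrow> b \<in> carrier R \<Longrightarrow> x \<in> carrier M \<Longrightarrow>
     (a \<otimes>\<^bsub>R\<^esub> b) \<odot>\<^bsub>M\<^esub> x = a \<odot>\<^bsub>M\<^esub> (b \<odot>\<^bsub>M\<^esub> x)"
  using module_axioms by (simp add: module_axioms_def)

lemma smult_one: "x \<in> carrier M \<Longrightarrow> \<one>\<^bsub>R\<^esub> \<odot>\<^bsub>M\<^esub> x = x"
  using module_axioms by (simp add: module_axioms_def)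

lemma smult_l_null: "x \<in> carrier M \<Longrightarrow> \<zero>\<^bsub>R\<^esub> \<odot>\<^bsub>M\<^esub> x = \<zero>\<^bsub>M\<^esub>"
  using smult_l_distr[of "\<zero>\<^bsub>R\<^esub>" "\<zero>\<^bsub>R\<^esub>" x] by (simp add: M.add.l_cancel_one)

lemma smult_r_null: "a \<in> carrier R \<Longrightarrow> a \<odot>\<^bsub>M\<^esub> \<zero>\<^bsub>M\<^esub> = \<zero>\<^bsub>M\<^esub>"
  using smult_r_distr[of a "\<zero>\<^bsub>M\<^esub>" "\<zero>\<^bsub>M\<^esub>"] by (simp add: M.add.l_cancel_one)

lemma smult_finsum:
  assumes "a \<in> carrier R" "finite S" "\<And>i. i \<in> S \<Longrightarrow> w i \<in> carrier M"
  shows "a \<odot>\<^bsub>M\<^esub> finsum M w S = finsum M (\<lambda>i. a \<odot>\<^bsub>M\<^esub> w i) S"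
  using assms(2,3)
proof (induction S)
  case empty then show ?case using assms(1) by (simp add: smult_r_null)
next
  case (insert i S)
  have "finsum M w (insert i S) = w i \<oplus>\<^bsub>M\<^esub> finsum M w S"
    using insert by (intro M.finsum_insert) auto
  moreover have "finsum M (\<lambda>i. a \<odot>\<^bsub>M\<^esub> w i) (insert i S) = a \<odot>\<^bsub>M\<^esub> w i \<oplus>\<^bsub>M\<^esub> finsum M (\<lambda>i. a \<odot>\<^bsub>M\<^esub> w i) S"
    using insert assms(1) by (intro M.finsum_insert) auto
  moreover have "finsum M w S \<in> carrier M" using insert by (intro M.finsum_closed) auto
  ultimately show ?case using insert assms(1) by (simp add: smult_r_distr)
qed

lemma submoduleI:
  assumes "H \<subseteq> carrier M" "\<zero>\<^bsub>M\<^esub> \<in> H" "\<And>x y. x \<in> H \<Longrightarrow> y \<in> H \<Longrightarrow> x \<oplus>\<^bsub>M\<^esub> y \<in> H"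
    and "\<And>a x. a \<in> carrier R \<Longrightarrow> x \<in> H \<Longrightarrow> a \<odot>\<^bsub>M\<^esub> x \<in> H"
  shows "submodule H R M"
proof (rule submodule.intro)
  have "\<ominus>\<^bsub>M\<^esub> x \<in> H" if "x \<in> H" for x
  proof -
    have x: "x \<in> carrier M" using that assms(1) by auto
    have "(\<ominus>\<^bsub>R\<^esub> \<one>\<^bsub>R\<^esub>) \<odot>\<^bsub>M\<^esub> x \<oplus>\<^bsub>M\<^esub> x = ((\<ominus>\<^bsub>R\<^esub> \<one>\<^bsub>R\<^esub>) \<oplus>\<^bsub>R\<^esub> \<one>\<^bsub>R\<^esub>) \<odot>\<^bsub>M\<^esub> x"
      using x by (subst smult_l_distr) (auto simp: smult_one)
    also have "\<dots> = \<zero>\<^bsub>M\<^esub>" using x by (simp add: R.l_neg smult_l_null)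
    finally have "\<ominus>\<^bsub>M\<^esub> x = (\<ominus>\<^bsub>R\<^esub> \<one>\<^bsub>R\<^esub>) \<odot>\<^bsub>M\<^esub> x" using x by (intro M.minus_equality) auto
    then show ?thesis using assms(4) that by simp
  qed
  then show "subgroup H (add_monoid M)"
    using assms by (intro M.add.subgroupI) auto
  show "submodule_axioms H R M" using assms(4) by (simp add: submodule_axioms_def)
qed

lemma submodule_finsum:
  assumes "submodule H R M" "finite S" "\<And>i. i \<in> S \<Longrightarrow> w i \<in> H"
  shows "finsum M w S \<in> H"
  using assms(2,3)
proof (induction S)
  case empty
  then show ?case using subgroup.one_closed[OF submodule.axioms(1)[OF assms(1)]] by simp
next
  case (insert i S)
  have "H \<subseteq> carrier M" using subgroup.subset[OF submodule.axioms(1)[OF assms(1)]] by simp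
  then have "finsum M w (insert i S) = w i \<oplus>\<^bsub>M\<^esub> finsum M w S"
    using insert by (intro M.finsum_insert) auto
  then show ?case using insert subgroup.m_closed[OF submodule.axioms(1)[OF assms(1)]] by simp
qed

end

lemma submoduleD:
  assumes "submodule H R M"
  shows "H \<subseteq> carrier M" "\<zero>\<^bsub>M\<^esub> \<in> H" "\<And>x y. x \<in> H \<Longrightarrow> y \<in> H \<Longrightarrow> x \<oplus>\<^bsub>M\<^esub> y \<in> H"
    "\<And>a x. a \<in> carrier R \<Longrightarrow> x \<in> H \<Longrightarrow> a \<odot>\<^bsub>M\<^esub> x \<in> H"
  using subgroup.subset[OF submodule.axioms(1)[OF assms]]
    subgroup.one_closed[OF submodule.axioms(1)[OF assms]]
    subgroup.m_closed[OF submodule.axioms(1)[OF assms]] submodule.smult_closed[OF assms] by auto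

definition module_iso ::
  "('v \<Rightarrow> 'w) \<Rightarrow> ('a, 'b) ring_scheme \<Rightarrow> ('a, 'v, 'c) module_scheme \<Rightarrow> ('a, 'w, 'e) module_scheme \<Rightarrow> bool" where
  "module_iso f R M N \<longleftrightarrow> bij_betw f (carrier M) (carrier N) \<and>
     (\<forall>x\<in>carrier M. \<forall>y\<in>carrier M. f (x \<oplus>\<^bsub>M\<^esub> y) = f x \<oplus>\<^bsub>N\<^esub> f y) \<and>
     (\<forall>r\<in>carrier R. \<forall>x\<in>carrier M. f (r \<odot>\<^bsub>M\<^esub> x) = r \<odot>\<^bsub>N\<^esub> f x)"

lemma module_isomorphic_iff: "module_isomorphic R M N \<longleftrightarrow> (\<exists>f. module_iso f R M N)"
  by (simp add: module_isomorphic_def module_iso_def)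

lemma module_isomorphicI: "module_iso f R M N \<Longrightarrow> module_isomorphic R M N"
  by (auto simp: module_isomorphic_iff)

lemma module_isoD:
  assumes "module_iso f R M N"
  shows "bij_betw f (carrier M) (carrier N)"
    "x \<in> carrier M \<Longrightarrow> f x \<in> carrier N"
    "x \<in> carrier M \<Longrightarrow> y \<in> carrier M \<Longrightarrow> f (x \<oplus>\<^bsub>M\<^esub> y) = f x \<oplus>\<^bsub>N\<^esub> f y"
    "r \<in> carrier R \<Longrightarrow> x \<in> carrier M \<Longrightarrow> f (r \<odot>\<^bsub>M\<^esub> x) = r \<odot>\<^bsub>N\<^esub> f x"
  using assms by (auto simp: module_iso_def bij_betw_def)

lemma module_iso_trans:
  assumes "module_iso f R M N" "module_iso g R N L"
  shows "module_iso (g \<circ> f) R M L"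
  using assms bij_betw_trans[OF module_isoD(1)[OF assms(1)] module_isoD(1)[OF assms(2)]]
  by (simp add: module_iso_def bij_betw_def)  (simp add: module_isoD(2)[OF assms(1)])

lemma module_isomorphic_trans:
  "module_isomorphic R M N \<Longrightarrow> module_isomorphic R N L \<Longrightarrow> module_isomorphic R M L"
  by (meson module_isomorphic_iff module_iso_trans)

lemma module_isomorphic_refl: "module_isomorphic R M M"
  by (auto simp: module_isomorphic_iff module_iso_def intro!: exI[of _ "\<lambda>x. x"] bij_betw_id[unfolded id_def])

lemma iso_class_eqI:
  assumes "module_isomorphic (trunc_algebra n d) M N" "module_isomorphic (trunc_algebra n d) N M"
  shows "iso_class n d M = iso_class n d N"
  using assms by (auto simp: iso_class_def intro: module_isomorphic_trans)

text \<open>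
  Closure of the source under its operations makes the inverse a homomorphism. The tensor product,
  as the target, is compared with a known module in this way.
\<close>

lemma module_iso_inv:
  assumes "left_module R M" "module_iso f R M N"
  shows "module_iso (the_inv_into (carrier M) f) R N M"
proof -
  interpret left_mod R M using assms(1) by (simp add: left_module_iff)
  let ?g = "the_inv_into (carrier M) f"
  have bij: "bij_betw f (carrier M) (carrier N)" by (rule module_isoD(1)[OF assms(2)])
  then have inj: "inj_on f (carrier M)" by (simp add: bij_betw_def)
  have g: "\<And>y. y \<in> carrier N \<Longrightarrow> ?g y \<in> carrier M \<and> f (?g y) = y"
    using bij by (metis bij_betw_def f_the_inv_into_f the_inv_into_into subset_refl)
  have gf: "\<And>x. x \<in> carrier M \<Longrightarrow> ?g (f x) = x" by (rule the_inv_into_f_f[OF inj])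
  show ?thesis unfolding module_iso_def
  proof (intro conjI ballI)
    show "bij_betw ?g (carrier N) (carrier M)" by (rule bij_betw_the_inv_into[OF bij])
    fix x y assume x: "x \<in> carrier N" and y: "y \<in> carrier N"
    have "f (?g x \<oplus>\<^bsub>M\<^esub> ?g y) = x \<oplus>\<^bsub>N\<^esub> y" using x y g by (simp add: module_isoD[OF assms(2)])
    then show "?g (x \<oplus>\<^bsub>N\<^esub> y) = ?g x \<oplus>\<^bsub>M\<^esub> ?g y" using gf[of "?g x \<oplus>\<^bsub>M\<^esub> ?g y"] g x y by simp
  next
    fix r x assume r: "r \<in> carrier R" and x: "x \<in> carrier N"
    have "f (r \<odot>\<^bsub>M\<^esub> ?g x) = r \<odot>\<^bsub>N\<^esub> x" using r x g by (simp add: module_isoD[OF assms(2)])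
    then show "?g (r \<odot>\<^bsub>N\<^esub> x) = r \<odot>\<^bsub>M\<^esub> ?g x" using gf[of "r \<odot>\<^bsub>M\<^esub> ?g x"] g r x by simp
  qed
qed

lemma module_isomorphic_sym:
  "left_module R M \<Longrightarrow> module_isomorphic R M N \<Longrightarrow> module_isomorphic R N M"
  by (meson module_isomorphic_iff module_iso_inv)

lemma module_iso_zero:
  assumes "left_module R M" "left_module R N" "module_iso f R M N"
  shows "f \<zero>\<^bsub>M\<^esub> = \<zero>\<^bsub>N\<^esub>"
proof -
  interpret M: left_mod R M using assms(1) by (simp add: left_module_iff)
  interpret N: left_mod R N using assms(2) by (simp add: left_module_iff)
  have "f \<zero>\<^bsub>M\<^esub> \<oplus>\<^bsub>N\<^esub> f \<zero>\<^bsub>M\<^esub> = f \<zero>\<^bsub>M\<^esub>"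
    using module_isoD(3)[OF assms(3), of "\<zero>\<^bsub>M\<^esub>" "\<zero>\<^bsub>M\<^esub>"] by simp
  moreover have "f \<zero>\<^bsub>M\<^esub> \<in> carrier N" by (rule module_isoD(2)[OF assms(3)]) simp
  ultimately show ?thesis by (simp add: N.M.add.l_cancel_one)
qed

lemma fg_module_iso:
  assumes fg: "fg_module R M" and N: "left_module R N" and iso: "module_isomorphic R M N"
  shows "fg_module R N"
proof -
  have M: "left_module R M" using fg by (simp add: fg_module_def)
  interpret M: left_mod R M using M by (simp add: left_module_iff)
  obtain f where f: "module_iso f R M N" using iso by (auto simp: module_isomorphic_iff)
  obtain S where S: "finite S" "S \<subseteq> carrier M" "\<And>L. submodule L R M \<Longrightarrow> S \<subseteq> L \<Longrightarrow> L = carrier M"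
    using fg by (auto simp: fg_module_def)
  have "L = carrier N" if L: "submodule L R N" "f ` S \<subseteq> L" for L
  proof -
    have "submodule {x \<in> carrier M. f x \<in> L} R M"
      by (rule M.submoduleI)
        (auto simp: module_iso_zero[OF M N f] module_isoD[OF f] submoduleD[OF L(1)])
    then have "{x \<in> carrier M. f x \<in> L} = carrier M" by (rule S(3)) (use S(2) L(2) in auto)
    then have "f ` carrier M \<subseteq> L" by auto
    then show ?thesis using submoduleD(1)[OF L(1)] module_isoD(1)[OF f] by (auto simp: bij_betw_def)
  qed
  then show ?thesis unfolding fg_module_def using N S module_isoD(2)[OF f]
    by (intro conjI exI[of _ "f ` S"]) auto
qed

text \<open>
  Transport of structure along an injection. It moves a module into the type over which isomorphism
  classes are formed.
\<close>

definition copy_module :: "('v \<Rightarrow> 'w) \<Rightarrow> ('a, 'v) module \<Rightarrow> ('a, 'w) module" where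
  "copy_module h M =
     \<lparr>carrier = h ` carrier M, monoid.mult = undefined, monoid.one = undefined,
      ring.zero = h \<zero>\<^bsub>M\<^esub>,
      ring.add = (\<lambda>x y. h (the_inv_into (carrier M) h x \<oplus>\<^bsub>M\<^esub> the_inv_into (carrier M) h y)),
      module.smult = (\<lambda>r x. h (r \<odot>\<^bsub>M\<^esub> the_inv_into (carrier M) h x))\<rparr>"

lemma copy_module:
  assumes M: "left_module R M" and inj: "inj_on h (carrier M)"
  shows "left_module R (copy_module h M)" and "module_iso h R M (copy_module h M)"
proof -
  interpret left_mod R M using M by (simp add: left_module_iff)
  have gf: "\<And>x. x \<in> carrier M \<Longrightarrow> the_inv_into (carrier M) h (h x) = x" by (rule the_inv_into_f_f[OF inj])
  have ab: "abelian_group (copy_module h M)"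
  proof (rule abelian_groupI)
    fix x assume "x \<in> carrier (copy_module h M)"
    then obtain u where u: "u \<in> carrier M" "x = h u" by (auto simp: copy_module_def)
    then show "\<exists>y\<in>carrier (copy_module h M). y \<oplus>\<^bsub>copy_module h M\<^esub> x = \<zero>\<^bsub>copy_module h M\<^esub>"
      by (intro bexI[of _ "h (\<ominus>\<^bsub>M\<^esub> u)"]) (auto simp: copy_module_def gf M.l_neg)
  qed (auto simp: copy_module_def gf M.a_assoc M.a_comm M.a_lcomm)
  show "left_module R (copy_module h M)"
    unfolding left_module_iff
    by (intro left_mod.intro R.ring_axioms ab left_mod_axioms.intro module_axioms.intro)
      (auto simp: copy_module_def gf smult_l_distr smult_r_distr smult_assoc smult_one)
  show "module_iso h R M (copy_module h M)"
    unfolding module_iso_def using inj by (auto simp: copy_module_def gf bij_betw_def)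
qed

lemma direct_sum_cong:
  assumes "module_isomorphic R V V'" "module_isomorphic R W W'"
  shows "module_isomorphic R (direct_sum_module V W) (direct_sum_module V' W')"
proof -
  obtain f where f: "module_iso f R V V'" using assms(1) by (auto simp: module_isomorphic_iff)
  obtain g where g: "module_iso g R W W'" using assms(2) by (auto simp: module_isomorphic_iff)
  have "module_iso (map_prod f g) R (direct_sum_module V W) (direct_sum_module V' W')"
    using bij_betw_map_prod[OF module_isoD(1)[OF f] module_isoD(1)[OF g]]
    by (auto simp: module_iso_def direct_sum_module_def module_isoD[OF f] module_isoD[OF g])
  then show ?thesis by (rule module_isomorphicI)
qed

section \<open>Modules given by a graded nilpotent operator\<close>

definition supported :: "'i set \<Rightarrow> ('i \<Rightarrow> 'k::zero) set" where
  "supported I = {f. \<forall>p. f p \<noteq> 0 \<longrightarrow> p \<in> I}"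

lemma supported_add: "f \<in> supported I \<Longrightarrow> f' \<in> supported I \<Longrightarrow> (\<lambda>p. f p + f' p :: 'k::field) \<in> supported I"
  unfolding supported_def mem_Collect_eq by (metis add.right_neutral)

lemma supported_mono: "I \<subseteq> J \<Longrightarrow> f \<in> supported I \<Longrightarrow> f \<in> supported J"
  by (auto simp: supported_def)

lemma supported_zero: "(\<lambda>p. 0 :: 'k::field) \<in> supported I"
  by (simp add: supported_def)

text \<open>
  The entry of a vector at the index \<open>p\<close> has grade \<open>g p\<close> modulo \<open>n\<close>. A path of length \<open>l\<close> acts as \<open>N\<^sup>l\<close>
  on the vectors whose grade is its source, so the entry at \<open>p\<close> of the result involves the paths that
  start \<open>l\<close> steps before the grade of \<open>p\<close>. Going back \<open>l\<close> steps modulo \<open>n\<close> is written as adding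
  \<open>(n - 1) * l\<close>, which avoids truncated subtraction.
\<close>

definition graded_action ::
  "nat \<Rightarrow> nat \<Rightarrow> ('i \<Rightarrow> nat) \<Rightarrow> (('i \<Rightarrow> 'k) \<Rightarrow> 'i \<Rightarrow> 'k) \<Rightarrow> 'k::field path_elt \<Rightarrow> ('i \<Rightarrow> 'k) \<Rightarrow> 'i \<Rightarrow> 'k" where
  "graded_action n d g N x f = (\<lambda>p. \<Sum>l<d. x ((g p + (n - 1) * l) mod n) l * (N ^^ l) f p)"

definition graded_module ::
  "nat \<Rightarrow> nat \<Rightarrow> 'i set \<Rightarrow> ('i \<Rightarrow> nat) \<Rightarrow> (('i \<Rightarrow> 'k) \<Rightarrow> 'i \<Rightarrow> 'k) \<Rightarrow> ('k::field trunc_elt, 'i \<Rightarrow> 'k) module" where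
  "graded_module n d I g N =
     \<lparr>carrier = supported I, monoid.mult = undefined, monoid.one = undefined,
      ring.zero = (\<lambda>p. 0), ring.add = (\<lambda>f f' p. f p + f' p),
      module.smult = (\<lambda>a. graded_action n d g N (SOME x. x \<in> a))\<rparr>"

definition delta :: "'i \<Rightarrow> 'i \<Rightarrow> 'k::zero_neq_one" where
  "delta p = (\<lambda>q. if q = p then 1 else 0)"

text \<open>
  Vectors of finite support are sums of multiples of basis vectors.
\<close>

lemma supported_induct [consumes 2, case_names zero step]:
  assumes "finite I" "f \<in> supported I"
    and "Q (\<lambda>p. 0)"
    and "\<And>h c p. h \<in> supported I \<Longrightarrow> Q h \<Longrightarrow> p \<in> I \<Longrightarrow> Q (\<lambda>q. c * delta p q + h q)"
  shows "Q (f :: 'i \<Rightarrow> 'k::field)"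
proof -
  define res where "res S = (\<lambda>p. if p \<in> S then f p else 0)" for S
  have "Q (res S) \<and> res S \<in> supported I" if "S \<subseteq> I" for S
    using finite_subset[OF that assms(1)] that
  proof (induction S)
    case empty
    have "res {} = (\<lambda>p. 0)" by (simp add: res_def)
    then show ?case using assms(3) by (simp add: supported_def)
  next
    case (insert p S)
    have eq: "res (insert p S) = (\<lambda>q. f p * delta p q + res S q)"
      using insert.hyps by (auto simp: res_def delta_def)
    have "res (insert p S) \<in> supported I" using insert.prems by (auto simp: res_def supported_def)
    moreover have "Q (res (insert p S))" unfolding eq using insert by (intro assms(4)) auto
    ultimately show ?case by blast
  qed
  from this[of I] have "Q (res I)" by simp
  moreover have "res I = f" using assms(2) by (auto simp: res_def supported_def fun_eq_iff)
  ultimately show ?thesis by simp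
qed

text \<open>
  The axiom \<open>N_graded\<close> expresses that \<open>N\<close> raises the grade by one: multiplying the entries of a
  vector by a function \<open>c\<close> of their grade commutes with \<open>N\<close> up to a shift of \<open>c\<close>. Constant \<open>c\<close> give
  linearity over the field.
\<close>

locale graded_operator = nakayama n d Kt for n d and Kt :: "'k::field itself" +
  fixes I :: "'i set" and g :: "'i \<Rightarrow> nat" and N :: "('i \<Rightarrow> 'k) \<Rightarrow> 'i \<Rightarrow> 'k"
  assumes fin: "finite I"
    and N_add: "\<And>f f'. N (\<lambda>p. f p + f' p) = (\<lambda>p. N f p + N f' p)"
    and N_graded: "\<And>c f. N (\<lambda>p. c (g p mod n) * f p) = (\<lambda>p. c ((g p + (n - 1)) mod n) * N f p)"
    and N_supported: "\<And>f. f \<in> supported I \<Longrightarrow> N f \<in> supported I"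
begin

lemma N_scale: "N (\<lambda>p. c * f p) = (\<lambda>p. c * N f p)"
  using N_graded[of "\<lambda>_. c" f] by simp

lemma N_zero: "N (\<lambda>p. 0) = (\<lambda>p. 0)"
  using N_scale[of 0 "\<lambda>p. 0"] by simp

lemma Npow_add: "(N ^^ l) (\<lambda>p. f p + f' p) = (\<lambda>p. (N ^^ l) f p + (N ^^ l) f' p)"
  by (induction l) (simp_all add: N_add)

lemma Npow_scale: "(N ^^ l) (\<lambda>p. c * f p) = (\<lambda>p. c * (N ^^ l) f p)"
  by (induction l) (simp_all add: N_scale)

lemma Npow_zero: "(N ^^ l) (\<lambda>p. 0) = (\<lambda>p. 0)"
  by (induction l) (simp_all add: N_zero)

lemma Npow_sum:
  assumes "finite S"
  shows "(N ^^ l) (\<lambda>p. \<Sum>s\<in>S. f s p) = (\<lambda>p. \<Sum>s\<in>S. (N ^^ l) (f s) p)"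
  using assms by (induction S) (simp_all add: Npow_zero Npow_add)

lemma Npow_graded:
  "(N ^^ l) (\<lambda>p. c (g p mod n) * f p) = (\<lambda>p. c ((g p + (n - 1) * l) mod n) * (N ^^ l) f p)"
proof (induction l)
  case (Suc l)
  have "N (\<lambda>p. c ((g p + (n - 1) * l) mod n) * (N ^^ l) f p)
      = (\<lambda>p. c ((g p + (n - 1) * Suc l) mod n) * (N ^^ Suc l) f p)"
    using N_graded[of "\<lambda>h. c ((h + (n - 1) * l) mod n)" "(N ^^ l) f"] by (simp add: mod_simps add.assoc)
  then show ?case using Suc by simp
qed simp

lemma Npow_supported: "f \<in> supported I \<Longrightarrow> (N ^^ l) f \<in> supported I"
  by (induction l) (simp_all add: N_supported)

end

locale graded_space = graded_operator n d Kt I g N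
  for n d and Kt :: "'k::field itself" and I :: "'i set" and g and N :: "('i \<Rightarrow> 'k) \<Rightarrow> 'i \<Rightarrow> 'k" +
  assumes N_nilpotent: "\<And>f. f \<in> supported I \<Longrightarrow> (N ^^ d) f = (\<lambda>p. 0)"
begin

abbreviation act :: "'k path_elt \<Rightarrow> ('i \<Rightarrow> 'k) \<Rightarrow> 'i \<Rightarrow> 'k" where "act \<equiv> graded_action n d g N"
abbreviation M :: "('k trunc_elt, 'i \<Rightarrow> 'k) module" where "M \<equiv> graded_module n d I g N"

lemma Npow_vanish:
  assumes "f \<in> supported I" "d \<le> l"
  shows "(N ^^ l) f = (\<lambda>p. 0)"
proof -
  have "(N ^^ l) f = (N ^^ (l - d)) ((N ^^ d) f)"
    using assms(2) by (simp flip: funpow_add comp_apply[of "N ^^ (l - d)" "N ^^ d"])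
  then show ?thesis using N_nilpotent[OF assms(1)] Npow_zero by simp
qed

lemma act_supported: "f \<in> supported I \<Longrightarrow> act x f \<in> supported I"
proof -
  assume f: "f \<in> supported I"
  have "(\<Sum>l<d. x ((g p + (n - 1) * l) mod n) l * (N ^^ l) f p) = 0" if "p \<notin> I" for p
    using Npow_supported[OF f] that by (intro sum.neutral) (auto simp: supported_def)
  then show ?thesis by (auto simp: graded_action_def supported_def)
qed

lemma act_cong: "(\<And>i l. l < d \<Longrightarrow> x i l = y i l) \<Longrightarrow> act x f = act y f"
  by (simp add: graded_action_def)

lemma act_add: "act x (\<lambda>p. f p + f' p) = (\<lambda>p. act x f p + act x f' p)"
  by (simp add: graded_action_def Npow_add distrib_left sum.distrib)

lemma act_zero: "act x (\<lambda>p. 0) = (\<lambda>p. 0)"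
  by (simp add: graded_action_def Npow_zero)

lemma act_scale: "act x (\<lambda>p. c * f p) = (\<lambda>p. c * act x f p)"
  by (simp add: graded_action_def Npow_scale sum_distrib_left mult.left_commute)

lemma act_add_left: "act (\<lambda>i l. x i l + y i l) f = (\<lambda>p. act x f p + act y f p)"
  by (simp add: graded_action_def distrib_right sum.distrib)

lemma act_scalar: "act (path_scale c (path_one n)) f = (\<lambda>p. c * f p)"
proof
  fix p
  have "act (path_scale c (path_one n)) f p = (\<Sum>l<d. if l = 0 then c * f p else 0)"
    unfolding graded_action_def using n_pos
    by (intro sum.cong) (auto simp: path_scale_def path_one_apply)
  then show "act (path_scale c (path_one n)) f p = c * f p" using d_pos by simp
qed

lemma act_one: "act (path_one n) f = f"
  using act_scalar[of 1 f] by (simp add: path_scale_def)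

lemma act_path:
  "l < d \<Longrightarrow> act (path i l) f p = (if (g p + (n - 1) * l) mod n = i then (N ^^ l) f p else 0)"
proof -
  assume l: "l < d"
  have "act (path i l) f p = (\<Sum>k<d. if k = l then (if (g p + (n - 1) * l) mod n = i then (N ^^ l) f p else 0) else 0)"
    unfolding graded_action_def by (intro sum.cong) (auto simp: path_def)
  then show ?thesis using l by simp
qed

text \<open>
  A coefficient of \<open>x y\<close> at length \<open>L\<close> is a sum over the ways of writing \<open>L = l + k\<close>, and \<open>N\<^sup>l\<close> moves
  the grade condition in \<open>y f\<close> back by \<open>l\<close>. The pairs with \<open>l + k \<ge> d\<close>, which only the iterated action
  contains, contribute nothing because \<open>N\<^sup>d = 0\<close>.
\<close>

lemma act_mult:
  assumes f: "f \<in> supported I"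
  shows "act (path_mult n x y) f = act x (act y f)"
proof
  fix p
  let ?s = "\<lambda>l. (g p + (n - 1) * l) mod n"
  have src: "((g p + (n - 1) * (l + k)) mod n + k) mod n = ?s l" for l k
  proof -
    have "g p + (n - 1) * (l + k) + k = g p + (n - 1) * l + n * k"
      using n_pos by (cases n) (simp_all add: algebra_simps)
    then show ?thesis by (metis mod_add_left_eq mod_mult_self2)
  qed
  have src': "((g p + (n - 1) * L) mod n + k) mod n = ?s (L - k)" if "k \<le> L" for L k
    using src[of "L - k" k] that by simp
  have "act (path_mult n x y) f p
      = (\<Sum>(L, k)\<in>(SIGMA L:{..<d}. {..L}). x ((?s L + k) mod n) (L - k) * y (?s L) k * (N ^^ L) f p)"
    by (simp add: graded_action_def path_mult_def sum_distrib_right sum.Sigma)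
  also have "\<dots> = (\<Sum>(l, k)\<in>{(l, k) \<in> {..<d} \<times> {..<d}. l + k < d}. x (?s l) l * (y (?s (l + k)) k * (N ^^ (l + k)) f p))"
    by (rule sum.reindex_bij_witness[where i="\<lambda>(l, k). (l + k, k)" and j="\<lambda>(L, k). (L - k, k)"])
       (auto simp: mult.assoc src' simp del: One_nat_def)
  also have "\<dots> = (\<Sum>(l, k)\<in>{..<d} \<times> {..<d}. x (?s l) l * (y (?s (l + k)) k * (N ^^ (l + k)) f p))"
    by (rule sum.mono_neutral_left) (auto, metis Npow_vanish[OF f] not_less)
  also have "\<dots> = (\<Sum>l<d. x (?s l) l * (\<Sum>k<d. y (?s (l + k)) k * (N ^^ (l + k)) f p))"
    by (simp add: sum_distrib_left sum.cartesian_product)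
  also have "\<dots> = (\<Sum>l<d. x (?s l) l * (N ^^ l) (act y f) p)"
  proof (rule sum.cong[OF refl])
    fix l
    have "(N ^^ l) (\<lambda>p. y ((g p + (n - 1) * k) mod n) k * (N ^^ k) f p)
        = (\<lambda>p. y ((g p + (n - 1) * (l + k)) mod n) k * (N ^^ (l + k)) f p)" for k
      using Npow_graded[of l "\<lambda>h. y ((h + (n - 1) * k) mod n) k" "(N ^^ k) f"]
      by (simp add: mod_simps funpow_add distrib_left add.assoc del: One_nat_def)
    then have "(N ^^ l) (act y f) = (\<lambda>p. \<Sum>k<d. y ((g p + (n - 1) * (l + k)) mod n) k * (N ^^ (l + k)) f p)"
      unfolding graded_action_def by (subst Npow_sum) simp_all
    then show "x (?s l) l * (\<Sum>k<d. y (?s (l + k)) k * (N ^^ (l + k)) f p) = x (?s l) l * (N ^^ l) (act y f) p"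
      by simp
  qed
  finally show "act (path_mult n x y) f p = act x (act y f) p" by (simp add: graded_action_def)
qed

lemma M_simps [simp]:
  "carrier M = supported I" "\<zero>\<^bsub>M\<^esub> = (\<lambda>p. 0)" "f \<oplus>\<^bsub>M\<^esub> f' = (\<lambda>p. f p + f' p)"
  by (simp_all add: graded_module_def)

lemma M_smult: "x \<in> carrier P \<Longrightarrow> tc x \<odot>\<^bsub>M\<^esub> f = act x f"
  using rep_tc[of x] by (auto simp: graded_module_def rep_def intro!: act_cong)

lemma M_left_module: "left_module A M"
proof -
  have ab: "abelian_group M"
  proof (rule abelian_groupI)
    fix f assume "f \<in> carrier M"
    then show "\<exists>f'\<in>carrier M. f' \<oplus>\<^bsub>M\<^esub> f = \<zero>\<^bsub>M\<^esub>"
      by (intro bexI[of _ "\<lambda>p. - f p"]) (auto simp: supported_def)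
  qed (auto simp: supported_add supported_zero add_ac)
  show ?thesis unfolding left_module_iff
  proof (intro left_mod.intro A.ring_axioms ab left_mod_axioms.intro module_axioms.intro)
    fix a b f f' assume "a \<in> carrier A" "b \<in> carrier A" and f: "f \<in> carrier M" "f' \<in> carrier M"
    then obtain x y where x: "x \<in> carrier P" "a = tc x" and y: "y \<in> carrier P" "b = tc y"
      by (metis carrier_A_E)
    show "a \<odot>\<^bsub>M\<^esub> f \<in> carrier M" using x f by (simp add: M_smult act_supported)
    show "a \<odot>\<^bsub>M\<^esub> (f \<oplus>\<^bsub>M\<^esub> f') = a \<odot>\<^bsub>M\<^esub> f \<oplus>\<^bsub>M\<^esub> a \<odot>\<^bsub>M\<^esub> f'" using x by (simp add: M_smult act_add)
    show "(a \<oplus>\<^bsub>A\<^esub> b) \<odot>\<^bsub>M\<^esub> f = a \<odot>\<^bsub>M\<^esub> f \<oplus>\<^bsub>M\<^esub> b \<odot>\<^bsub>M\<^esub> f"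
      using x y by (simp add: M_smult tc_add path_add_closed act_add_left)
    show "(a \<otimes>\<^bsub>A\<^esub> b) \<odot>\<^bsub>M\<^esub> f = a \<odot>\<^bsub>M\<^esub> (b \<odot>\<^bsub>M\<^esub> f)"
      using x y f n_pos by (simp add: M_smult tc_mult path_mult_closed act_mult)
  next
    fix f assume "f \<in> carrier M"
    show "\<one>\<^bsub>A\<^esub> \<odot>\<^bsub>M\<^esub> f = f" by (simp add: tc_one M_smult path_one_closed act_one)
  qed
qed

lemma delta_supported: "p \<in> I \<Longrightarrow> delta p \<in> supported I"
  by (auto simp: supported_def delta_def)

lemma M_fg: "fg_module A M"
proof -
  have "L = carrier M" if L: "submodule L A M" "delta ` I \<subseteq> L" for L
  proof
    show "carrier M \<subseteq> L"
    proof
      fix f assume "f \<in> carrier M"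
      then have "f \<in> supported I" by simp
      with fin show "f \<in> L"
      proof (induction rule: supported_induct)
        case zero show ?case using submoduleD(2)[OF L(1)] by simp
      next
        case (step h c p)
        have "tc (path_scale c (path_one n)) \<odot>\<^bsub>M\<^esub> delta p \<in> L"
          using step L(2) by (intro submoduleD(4)[OF L(1)]) (auto simp: path_one_closed)
        then have "(\<lambda>q. c * delta p q) \<in> L" by (simp add: M_smult path_one_closed act_scalar)
        from submoduleD(3)[OF L(1) this step.IH] show ?case by simp
      qed
    qed
  qed (use submoduleD(1)[OF L(1)] in simp)
  then show ?thesis unfolding fg_module_def using fin M_left_module delta_supported
    by (intro conjI exI[of _ "delta ` I"]) auto
qed

end

text \<open>A vector is the sum of its restrictions to the two parts, each of which \<open>N\<close> preserves.\<close>

lemma graded_module_union: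
  fixes I J :: "'i set" and N :: "('i \<Rightarrow> 'k::field) \<Rightarrow> 'i \<Rightarrow> 'k"
  assumes 1: "graded_space n d I g N" and 2: "graded_space n d J g N"
    and disj: "I \<inter> J = {}"
  shows "module_isomorphic (trunc_algebra n d) (graded_module n d (I \<union> J) g N)
           (direct_sum_module (graded_module n d I g N) (graded_module n d J g N))"
proof -
  interpret I: graded_space n d "TYPE('k)" I g N by fact
  interpret J: graded_space n d "TYPE('k)" J g N by fact
  define r where "r S f = (\<lambda>p. if p \<in> S then f p else (0::'k))" for S :: "'i set" and f
  have dec: "f = (\<lambda>p. r I f p + r J f p)" if "f \<in> supported (I \<union> J)" for f
    using that disj by (auto simp: r_def supported_def fun_eq_iff)
  have rs: "r S f \<in> supported S" for S f by (auto simp: r_def supported_def)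
  have r_sum: "r I (\<lambda>p. f p + f' p) = f" "r J (\<lambda>p. f p + f' p) = f'"
    if "f \<in> supported I" "f' \<in> supported J" for f f' 
    using that disj by (auto simp: r_def supported_def fun_eq_iff)
  let ?U = "graded_module n d (I \<union> J) g N"
  let ?f = "\<lambda>f. (r I f, r J f)"
  have "module_iso ?f I.A ?U (direct_sum_module I.M J.M)"
    unfolding module_iso_def
  proof (intro conjI ballI)
    have "(\<lambda>p. f p + f' p) \<in> supported (I \<union> J)" if "f \<in> supported I" "f' \<in> supported J" for f f' :: "'i \<Rightarrow> 'k"
      by (rule supported_add[OF supported_mono[OF _ that(1)] supported_mono[OF _ that(2)]]) auto
    then show "bij_betw ?f (carrier ?U) (carrier (direct_sum_module I.M J.M))"
      by (intro bij_betw_byWitness[where f'="\<lambda>(f, f') p. f p + f' p"])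
        (auto simp: direct_sum_module_def graded_module_def rs r_sum dec[symmetric])
    fix x y assume "x \<in> carrier ?U" "y \<in> carrier ?U"
    show "?f (x \<oplus>\<^bsub>?U\<^esub> y) = ?f x \<oplus>\<^bsub>direct_sum_module I.M J.M\<^esub> ?f y"
      by (auto simp: direct_sum_module_def graded_module_def r_def)
  next
    fix a f assume a: "a \<in> carrier I.A" and f: "f \<in> carrier ?U"
    then obtain x where x: "x \<in> carrier I.P" "a = I.tc x" by (metis I.carrier_A_E)
    have f': "f \<in> supported (I \<union> J)" using f by (simp add: graded_module_def)
    have "a \<odot>\<^bsub>?U\<^esub> f = a \<odot>\<^bsub>I.M\<^esub> f" by (simp add: graded_module_def)
    also have "\<dots> = I.act x f" using x by (simp add: I.M_smult)
    also have "\<dots> = I.act x (\<lambda>p. r I f p + r J f p)" using dec[OF f'] by simp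
    finally have "a \<odot>\<^bsub>?U\<^esub> f = (\<lambda>p. I.act x (r I f) p + I.act x (r J f) p)" by (simp add: I.act_add)
    then show "?f (a \<odot>\<^bsub>?U\<^esub> f) = a \<odot>\<^bsub>direct_sum_module I.M J.M\<^esub> ?f f"
      using x rs by (simp add: direct_sum_module_def I.M_smult J.M_smult r_sum I.act_supported J.act_supported)
  qed
  then show ?thesis by (rule module_isomorphicI)
qed

text \<open>
  Pulling vectors back along \<open>\<pi>\<close> commutes with every power of the operators, hence with the action.
\<close>

lemma graded_module_reindex:
  fixes N :: "('i \<Rightarrow> 'k::field) \<Rightarrow> 'i \<Rightarrow> 'k" and N' :: "('j \<Rightarrow> 'k) \<Rightarrow> 'j \<Rightarrow> 'k"
  assumes 1: "graded_space n d I g N" and 2: "graded_space n d J g' N'"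
    and bij: "bij_betw \<pi> J I" and grade: "\<And>q. q \<in> J \<Longrightarrow> g (\<pi> q) mod n = g' q mod n"
    and shift: "\<And>f. f \<in> supported I \<Longrightarrow>
      (\<lambda>q. if q \<in> J then N f (\<pi> q) else 0) = N' (\<lambda>q. if q \<in> J then f (\<pi> q) else 0)"
  shows "iso_class n d (graded_module n d I g N) = iso_class n d (graded_module n d J g' N')"
proof -
  interpret I: graded_space n d "TYPE('k)" I g N by fact
  interpret J: graded_space n d "TYPE('k)" J g' N' by fact
  define pull where "pull f = (\<lambda>q. if q \<in> J then f (\<pi> q) else (0::'k))" for f
  have pull_supported: "pull f \<in> supported J" for f by (simp add: pull_def supported_def)
  have \<pi>: "\<pi> q \<in> I" if "q \<in> J" for q using bij that by (auto simp: bij_betw_def)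
  have pow: "pull ((N ^^ l) f) = (N' ^^ l) (pull f)" if "f \<in> supported I" for f l
    using shift[OF I.Npow_supported[OF that]] by (induction l) (simp_all add: pull_def)
  have act: "pull (I.act x f) = J.act x (pull f)" if f: "f \<in> supported I" for x f
  proof
    fix q
    show "pull (I.act x f) q = J.act x (pull f) q"
    proof (cases "q \<in> J")
      case True
      have "(g (\<pi> q) + (n - 1) * l) mod n = (g' q + (n - 1) * l) mod n" for l
        using grade[OF True] by (metis mod_add_left_eq)
      moreover have "(N ^^ l) f (\<pi> q) = (N' ^^ l) (pull f) q" for l
        using fun_cong[OF pow[OF f, of l], of q] True by (simp add: pull_def)
      ultimately show ?thesis using True by (simp add: graded_action_def pull_def)
    next
      case False
      then have "J.act x (pull f) q = 0" using J.act_supported[OF pull_supported] unfolding supported_def by blast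
      then show ?thesis using False by (simp add: pull_def)
    qed
  qed
  have "module_iso pull I.A I.M J.M"
    unfolding module_iso_def
  proof (intro conjI ballI)
    have "inj_on pull (supported I)"
    proof (rule inj_onI)
      fix f f' assume f: "f \<in> supported I" "f' \<in> supported I" and eq: "pull f = pull f'"
      have "f p = f' p" for p
      proof (cases "p \<in> I")
        case True
        then obtain q where "q \<in> J" "p = \<pi> q" using bij by (auto simp: bij_betw_def)
        then show ?thesis using fun_cong[OF eq, of q] by (simp add: pull_def)
      next
        case False
        then have "f p = 0" "f' p = 0" using f unfolding supported_def by blast+
        then show ?thesis by simp
      qed
      then show "f = f'" ..
    qed
    moreover have "h \<in> pull ` supported I" if h: "h \<in> supported J" for h
    proof
      let ?f = "\<lambda>p. if p \<in> I then h (the_inv_into J \<pi> p) else 0"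
      show "?f \<in> supported I" by (simp add: supported_def)
      show "h = pull ?f"
        using h \<pi> bij by (auto simp: pull_def supported_def fun_eq_iff bij_betw_def the_inv_into_f_f)
    qed
    ultimately show "bij_betw pull (carrier I.M) (carrier J.M)"
      using pull_supported by (auto simp: bij_betw_def)
    fix f f' show "pull (f \<oplus>\<^bsub>I.M\<^esub> f') = pull f \<oplus>\<^bsub>J.M\<^esub> pull f'" by (auto simp: pull_def)
  next
    fix a f assume a: "a \<in> carrier I.A" and f: "f \<in> carrier I.M"
    from a obtain x where "x \<in> carrier I.P" "a = I.tc x" by (rule I.carrier_A_E)
    then show "pull (a \<odot>\<^bsub>I.M\<^esub> f) = a \<odot>\<^bsub>J.M\<^esub> pull f"
      using act f by (simp add: I.M_smult J.M_smult)
  qed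
  then have iso: "module_isomorphic I.A I.M J.M" by (rule module_isomorphicI)
  show ?thesis by (rule iso_class_eqI[OF iso module_isomorphic_sym[OF I.M_left_module iso]])
qed

section \<open>Block modules\<close>

text \<open>
  A block is a chain of basis vectors \<open>(a, 0), \<dots>, (a, len a - 1)\<close> in the grades \<open>j a, j a + 1, \<dots>\<close>,
  along which the operator moves.
\<close>

definition blocks :: "nat set \<Rightarrow> (nat \<Rightarrow> nat) \<Rightarrow> (nat \<times> nat) set" where
  "blocks B len = {(a, k). a \<in> B \<and> k < len a}"

definition block_grade :: "(nat \<Rightarrow> nat) \<Rightarrow> nat \<times> nat \<Rightarrow> nat" where
  "block_grade j = (\<lambda>(a, k). j a + k)"

text \<open>
  The operator does not mention the set of blocks, so that the same operator serves every part of a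
  disjoint union of blocks.
\<close>

definition block_shift :: "(nat \<Rightarrow> nat) \<Rightarrow> (nat \<times> nat \<Rightarrow> 'k::zero) \<Rightarrow> nat \<times> nat \<Rightarrow> 'k" where
  "block_shift len f = (\<lambda>(a, k). if 0 < k \<and> k < len a then f (a, k - 1) else 0)"

definition block_module ::
  "nat \<Rightarrow> nat \<Rightarrow> nat set \<Rightarrow> (nat \<Rightarrow> nat) \<Rightarrow> (nat \<Rightarrow> nat) \<Rightarrow> ('k::field trunc_elt, nat \<times> nat \<Rightarrow> 'k) module" where
  "block_module n d B j len = graded_module n d (blocks B len) (block_grade j) (block_shift len)"

lemma finite_blocks: "finite B \<Longrightarrow> finite (blocks B len)"
proof -
  assume "finite B"
  moreover have "blocks B len = (SIGMA a:B. {..<len a})" by (auto simp: blocks_def)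
  ultimately show ?thesis by simp
qed

lemma block_shift_pow:
  "0 < l \<Longrightarrow> (block_shift len ^^ l) f (a, k) = (if l \<le> k \<and> k < len a then f (a, k - l) else 0)"
proof (induction l arbitrary: k)
  case (Suc l)
  show ?case
  proof (cases "l = 0")
    case False
    have "(block_shift len ^^ Suc l) f (a, k)
        = (if 0 < k \<and> k < len a then (block_shift len ^^ l) f (a, k - 1) else 0)"
      by (simp add: block_shift_def[of len "(block_shift len ^^ l) f"])
    then show ?thesis using Suc.IH[of "k - 1"] False by auto
  qed (auto simp: block_shift_def)
qed simp

lemma block_shift_pow_supported:
  assumes "f \<in> supported (blocks B len)"
  shows "(block_shift len ^^ l) f (a, k) = (if l \<le> k \<and> k < len a then f (a, k - l) else 0)"
  using assms block_shift_pow[of l len f a k] by (cases "l = 0") (auto simp: supported_def blocks_def)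

lemma mod_add_cancel:
  fixes n x y k :: nat
  assumes "0 < n" "(x + k) mod n = (y + k) mod n"
  shows "x mod n = y mod n"
proof -
  have *: "(z + k + (n - 1) * k) mod n = z mod n" for z
  proof -
    have "z + k + (n - 1) * k = z + n * k" using assms(1) by (cases n) (simp_all add: algebra_simps)
    then show ?thesis by (simp only: mod_mult_self2)
  qed
  have "(x + k + (n - 1) * k) mod n = (y + k + (n - 1) * k) mod n"
    using assms(2) by (metis mod_add_left_eq)
  then show ?thesis unfolding * .
qed

context nakayama
begin

lemma block_graded_space:
  assumes "finite B" "\<And>a. a \<in> B \<Longrightarrow> len a \<le> d"
  shows "graded_space n d (blocks B len) (block_grade j) (block_shift len :: (_ \<Rightarrow> 'k) \<Rightarrow> _)"
proof unfold_locales
  show "finite (blocks B len)" by (rule finite_blocks[OF assms(1)])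
next
  fix f f' :: "nat \<times> nat \<Rightarrow> 'k"
  show "block_shift len (\<lambda>p. f p + f' p) = (\<lambda>p. block_shift len f p + block_shift len f' p)"
    by (auto simp: block_shift_def fun_eq_iff)
next
  fix c :: "nat \<Rightarrow> 'k" and f
  have "(j a + k + (n - 1)) mod n = (j a + (k - 1)) mod n" if "0 < k" for a k
  proof -
    have "j a + k + (n - 1) = j a + (k - 1) + n" using that n_pos by simp
    then show ?thesis by (simp only: mod_add_self2)
  qed
  then show "block_shift len (\<lambda>p. c (block_grade j p mod n) * f p)
      = (\<lambda>p. c ((block_grade j p + (n - 1)) mod n) * block_shift len f p)"
    by (auto simp: block_shift_def block_grade_def fun_eq_iff)
next
  fix f :: "nat \<times> nat \<Rightarrow> 'k" assume f: "f \<in> supported (blocks B len)"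
  show "block_shift len f \<in> supported (blocks B len)"
    using f by (auto simp: supported_def blocks_def block_shift_def)
  have "(block_shift len ^^ d) f (a, k) = 0" for a k
  proof (cases "a \<in> B")
    case True then show ?thesis using assms(2)[OF True] by (auto simp: block_shift_pow_supported[OF f])
  next
    case False then show ?thesis using f by (auto simp: block_shift_pow_supported[OF f] supported_def blocks_def)
  qed
  then show "(block_shift len ^^ d) f = (\<lambda>p. 0)" by auto
qed

text \<open>
  On a single block the action is multiplication in the path algebra: block \<open>a\<close> is the span of the
  paths that start at \<open>j a\<close>, truncated at length \<open>len a\<close>.
\<close>

lemma block_action:
  assumes "finite B" "\<And>a. a \<in> B \<Longrightarrow> len a \<le> d" "f \<in> supported (blocks B len)" "a \<in> B" "k < len a"
  shows "graded_action n d (block_grade j) (block_shift len) x f (a, k)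
    = (\<Sum>u\<le>k. x ((j a + u) mod n) (k - u) * f (a, u))"
proof -
  have src: "(j a + k + (n - 1) * l) mod n = (j a + (k - l)) mod n" if "l \<le> k" for l
  proof -
    have "j a + k + (n - 1) * l = j a + (k - l) + n * l" using that n_pos by (cases n) (simp_all add: algebra_simps)
    then show ?thesis by (simp only: mod_mult_self2)
  qed
  have "graded_action n d (block_grade j) (block_shift len) x f (a, k)
      = (\<Sum>l<d. if l \<le> k then x ((j a + (k - l)) mod n) l * f (a, k - l) else 0)"
    unfolding graded_action_def block_shift_pow_supported[OF assms(3)] block_grade_def
    using assms(5) src by (intro sum.cong) (auto simp del: One_nat_def)
  also have "\<dots> = (\<Sum>l\<le>k. x ((j a + (k - l)) mod n) l * f (a, k - l))"
    using assms(2)[OF assms(4)] assms(5) by (intro sum.mono_neutral_cong_right) auto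
  also have "\<dots> = (\<Sum>u\<le>k. x ((j a + u) mod n) (k - u) * f (a, u))"
    by (rule sum.reindex_bij_witness[where i="\<lambda>u. k - u" and j="\<lambda>u. k - u"]) auto
  finally show ?thesis .
qed

section \<open>Every finitely generated module is a sum of blocks\<close>

text \<open>
  The part of \<open>f\<close> in block \<open>a\<close>, read as an element of the path algebra.
\<close>

definition row :: "(nat \<Rightarrow> nat) \<Rightarrow> (nat \<Rightarrow> nat) \<Rightarrow> (nat \<times> nat \<Rightarrow> 'k) \<Rightarrow> nat \<Rightarrow> 'k path_elt" where
  "row j len f a = (\<lambda>i l. if i = j a \<and> l < len a then f (a, l) else 0)"

lemma row_closed: "j a < n \<Longrightarrow> row j len f a \<in> carrier P"
  by (rule path_carrierI[where b="len a"]) (auto simp: row_def split: if_splits)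

text \<open>
  Generators \<open>w a\<close> that are concentrated at the vertex \<open>j a\<close> and killed by the path of length \<open>len a\<close>;
  \<open>len a\<close> may be larger than the actual nilpotency order and may be \<open>0\<close>, which lets the index set stay
  fixed while lengths decrease.
\<close>

definition homogeneous_family ::
  "('k trunc_elt, 'v) module \<Rightarrow> nat set \<Rightarrow> (nat \<Rightarrow> 'v) \<Rightarrow> (nat \<Rightarrow> nat) \<Rightarrow> (nat \<Rightarrow> nat) \<Rightarrow> bool" where
  "homogeneous_family V B w j len \<longleftrightarrow> finite B \<and> (\<forall>a\<in>B. w a \<in> carrier V \<and> j a < n \<and> len a \<le> d \<and>
     tc (path (j a) 0) \<odot>\<^bsub>V\<^esub> w a = w a \<and> tc (path (j a) (len a)) \<odot>\<^bsub>V\<^esub> w a = \<zero>\<^bsub>V\<^esub>)"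

definition combination ::
  "('k trunc_elt, 'v) module \<Rightarrow> nat set \<Rightarrow> (nat \<Rightarrow> 'v) \<Rightarrow> (nat \<Rightarrow> nat) \<Rightarrow> (nat \<Rightarrow> nat) \<Rightarrow> (nat \<times> nat \<Rightarrow> 'k) \<Rightarrow> 'v" where
  "combination V B w j len f = finsum V (\<lambda>a. tc (row j len f a) \<odot>\<^bsub>V\<^esub> w a) B"

definition generating :: "('k trunc_elt, 'v) module \<Rightarrow> nat set \<Rightarrow> (nat \<Rightarrow> 'v) \<Rightarrow> bool" where
  "generating V B w \<longleftrightarrow> (\<forall>L. submodule L A V \<and> w ` B \<subseteq> L \<longrightarrow> L = carrier V)"

end

locale nakayama_family = nakayama n d Kt + V: left_mod "trunc_algebra n d" V
  for n d and Kt :: "'k::field itself" and V :: "('k trunc_elt, 'v) module" +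
  fixes B :: "nat set" and w :: "nat \<Rightarrow> 'v" and j len :: "nat \<Rightarrow> nat"
  assumes family: "homogeneous_family V B w j len"
begin

lemma finB: "finite B" using family by (simp add: homogeneous_family_def)

lemma fam:
  assumes "a \<in> B"
  shows "w a \<in> carrier V" "j a < n" "len a \<le> d" "tc (path (j a) 0) \<odot>\<^bsub>V\<^esub> w a = w a"
    "tc (path (j a) (len a)) \<odot>\<^bsub>V\<^esub> w a = \<zero>\<^bsub>V\<^esub>"
  using family assms by (auto simp: homogeneous_family_def)

sublocale S: graded_space n d Kt "blocks B len" "block_grade j" "block_shift len :: (_ \<Rightarrow> 'k) \<Rightarrow> _"
  by (rule block_graded_space[OF finB fam(3)])

abbreviation "comb \<equiv> combination V B w j len"

lemma row_closed': "a \<in> B \<Longrightarrow> row j len f a \<in> carrier P"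
  by (rule row_closed) (rule fam)

lemma term_closed: "a \<in> B \<Longrightarrow> tc (row j len f a) \<odot>\<^bsub>V\<^esub> w a \<in> carrier V"
  by (simp add: row_closed' fam)

lemma comb_closed: "comb f \<in> carrier V"
  unfolding combination_def by (rule V.M.finsum_closed) (auto simp: term_closed)

lemma comb_add: "comb (\<lambda>p. f p + f' p) = comb f \<oplus>\<^bsub>V\<^esub> comb f'"
proof -
  have "tc (row j len (\<lambda>p. f p + f' p) a) \<odot>\<^bsub>V\<^esub> w a = tc (row j len f a) \<odot>\<^bsub>V\<^esub> w a \<oplus>\<^bsub>V\<^esub> tc (row j len f' a) \<odot>\<^bsub>V\<^esub> w a"
    if "a \<in> B" for a
  proof -
    have "row j len (\<lambda>p. f p + f' p) a = (\<lambda>i l. row j len f a i l + row j len f' a i l)"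
      by (auto simp: row_def fun_eq_iff)
    then show ?thesis using that by (simp add: tc_add[symmetric] row_closed' V.smult_l_distr fam)
  qed
  then have "comb (\<lambda>p. f p + f' p)
      = finsum V (\<lambda>a. tc (row j len f a) \<odot>\<^bsub>V\<^esub> w a \<oplus>\<^bsub>V\<^esub> tc (row j len f' a) \<odot>\<^bsub>V\<^esub> w a) B"
    unfolding combination_def by (intro V.M.finsum_cong') (auto simp: term_closed)
  then show ?thesis unfolding combination_def by (simp add: V.M.finsum_addf term_closed Pi_iff)
qed

text \<open>
  Paths that do not start at \<open>j a\<close> annihilate \<open>w a\<close> since \<open>w a\<close> is concentrated there, and paths of
  length at least \<open>len a\<close> factor through the one that annihilates it.
\<close>

lemma tc_smult_low:
  assumes a: "a \<in> B" and x: "x \<in> carrier P"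
  shows "tc x \<odot>\<^bsub>V\<^esub> w a = tc (\<lambda>i l. if i = j a \<and> l < len a then x i l else 0) \<odot>\<^bsub>V\<^esub> w a"
proof -
  obtain b where b: "\<forall>i l. x i l \<noteq> 0 \<longrightarrow> i < n \<and> l < b" using x by (rule path_carrierE)
  define y where "y = (\<lambda>i l. if i = j a \<and> l < len a then x i l else 0)"
  define z where "z = (\<lambda>i l. if i = (j a + len a) mod n then x (j a) (l + len a) else 0)"
  have y: "y \<in> carrier P" unfolding y_def by (rule path_carrierI[where b=b]) (use b in \<open>auto split: if_splits\<close>)
  have z: "z \<in> carrier P" unfolding z_def
  proof (rule path_carrierI[where b=b])
    fix i l assume "(if i = (j a + len a) mod n then x (j a) (l + len a) else 0) \<noteq> 0"
    then show "i < n \<and> l < b" using b[rule_format, of "j a" "l + len a"] n_pos by (auto split: if_splits)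
  qed
  have p: "path (j a) k \<in> carrier P" for k using fam(2)[OF a] by simp
  have "tc x \<odot>\<^bsub>V\<^esub> w a = tc x \<odot>\<^bsub>V\<^esub> (tc (path (j a) 0) \<odot>\<^bsub>V\<^esub> w a)" by (simp add: fam[OF a])
  also have "\<dots> = tc (path_mult n x (path (j a) 0)) \<odot>\<^bsub>V\<^esub> w a"
    using x p fam(1)[OF a] by (simp add: tc_mult[symmetric] V.smult_assoc)
  also have "path_mult n x (path (j a) 0) = (\<lambda>i l. y i l + path_mult n z (path (j a) (len a)) i l)"
    using fam(2)[OF a] by (auto simp: path_mult_path_right y_def z_def fun_eq_iff)
  also have "tc \<dots> \<odot>\<^bsub>V\<^esub> w a = tc y \<odot>\<^bsub>V\<^esub> w a \<oplus>\<^bsub>V\<^esub> tc z \<odot>\<^bsub>V\<^esub> (tc (path (j a) (len a)) \<odot>\<^bsub>V\<^esub> w a)"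
    using y z p fam(1)[OF a] n_pos
    by (simp add: tc_add[symmetric] tc_mult[symmetric] path_mult_closed V.smult_l_distr V.smult_assoc)
  also have "\<dots> = tc y \<odot>\<^bsub>V\<^esub> w a" using y z fam[OF a] by (simp add: V.smult_r_null)
  finally show ?thesis by (simp add: y_def)
qed

text \<open>
  By \<open>block_action\<close>, multiplying the row of \<open>f\<close> by \<open>x\<close> gives the row of \<open>x f\<close> up to paths that
  annihilate the generator.
\<close>

lemma comb_smult:
  assumes x: "x \<in> carrier P" and f: "f \<in> supported (blocks B len)"
  shows "tc x \<odot>\<^bsub>V\<^esub> comb f = comb (S.act x f)"
proof -
  have "tc x \<odot>\<^bsub>V\<^esub> (tc (row j len f a) \<odot>\<^bsub>V\<^esub> w a) = tc (row j len (S.act x f) a) \<odot>\<^bsub>V\<^esub> w a" if a: "a \<in> B" for a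
  proof -
    have "tc x \<odot>\<^bsub>V\<^esub> (tc (row j len f a) \<odot>\<^bsub>V\<^esub> w a) = tc (path_mult n x (row j len f a)) \<odot>\<^bsub>V\<^esub> w a"
      using x fam(1)[OF a] a by (simp add: tc_mult[symmetric] row_closed' V.smult_assoc)
    also have "\<dots> = tc (\<lambda>i l. if i = j a \<and> l < len a then path_mult n x (row j len f a) i l else 0) \<odot>\<^bsub>V\<^esub> w a"
      using x a n_pos by (intro tc_smult_low path_mult_closed row_closed')
    also have "(\<lambda>i l. if i = j a \<and> l < len a then path_mult n x (row j len f a) i l else 0) = row j len (S.act x f) a"
      by (auto simp: row_def fun_eq_iff block_action[OF finB fam(3) f a] path_mult_def intro!: sum.cong)
    finally show ?thesis .
  qed
  then show ?thesis unfolding combination_def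
    using x finB by (simp add: V.smult_finsum term_closed cong: V.M.finsum_cong)
qed

lemma comb_zero: "comb (\<lambda>p. 0) = \<zero>\<^bsub>V\<^esub>"
proof -
  have "comb (\<lambda>p. 0) \<oplus>\<^bsub>V\<^esub> comb (\<lambda>p. 0) = comb (\<lambda>p. 0)" using comb_add[of "\<lambda>p. 0" "\<lambda>p. 0"] by simp
  then show ?thesis using comb_closed by (simp add: V.M.add.l_cancel_one)
qed

lemma comb_delta:
  assumes "a \<in> B"
  shows "w a \<in> comb ` supported (blocks B len)"
proof (cases "len a = 0")
  case True
  have "w a = \<zero>\<^bsub>V\<^esub>" using fam(4,5)[OF assms] True by simp
  then show ?thesis using comb_zero supported_zero by (metis image_eqI)
next
  case False
  have "tc (row j len (delta (a, 0)) b) \<odot>\<^bsub>V\<^esub> w b = (if a = b then w b else \<zero>\<^bsub>V\<^esub>)" if "b \<in> B" for b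
  proof (cases "a = b")
    case True
    have "row j len (delta (a, 0)) b = path (j b) 0" using False True by (auto simp: row_def delta_def path_def fun_eq_iff)
    then show ?thesis using True fam(4)[OF that] by simp
  next
    case ne: False
    then have "row j len (delta (a, 0)) b = (\<lambda>i l. 0)" by (auto simp: row_def delta_def fun_eq_iff)
    then show ?thesis using ne fam(1)[OF that] by (simp add: tc_zero[symmetric] V.smult_l_null)
  qed
  then have "comb (delta (a, 0)) = finsum V (\<lambda>b. if a = b then w b else \<zero>\<^bsub>V\<^esub>) B"
    unfolding combination_def using fam(1) by (intro V.M.finsum_cong') auto
  also have "\<dots> = w a" using assms finB fam(1) by (intro V.M.add.finprod_singleton) auto
  finally show ?thesis using assms False
    by (intro image_eqI[of _ _ "delta (a, 0)"] S.delta_supported) (auto simp: blocks_def)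
qed

lemma comb_iso:
  assumes gen: "generating V B w"
    and indep: "\<And>f. f \<in> supported (blocks B len) \<Longrightarrow> comb f = \<zero>\<^bsub>V\<^esub> \<Longrightarrow> f = (\<lambda>p. 0)"
  shows "module_iso comb A (block_module n d B j len) V"
proof -
  have "submodule (comb ` supported (blocks B len)) A V"
  proof (rule V.submoduleI)
    show "\<zero>\<^bsub>V\<^esub> \<in> comb ` supported (blocks B len)" using comb_zero supported_zero by (metis image_eqI)
    show "x \<oplus>\<^bsub>V\<^esub> y \<in> comb ` supported (blocks B len)"
      if "x \<in> comb ` supported (blocks B len)" "y \<in> comb ` supported (blocks B len)" for x y
      using that by (auto simp flip: comb_add intro!: imageI supported_add)
    show "a \<odot>\<^bsub>V\<^esub> x \<in> comb ` supported (blocks B len)"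
      if "a \<in> carrier A" "x \<in> comb ` supported (blocks B len)" for a x
      using that by (auto elim!: carrier_A_E simp: comb_smult intro!: imageI S.act_supported)
  qed (auto simp: comb_closed)
  then have surj: "comb ` supported (blocks B len) = carrier V"
    using gen comb_delta by (auto simp: generating_def)
  have inj: "inj_on comb (supported (blocks B len))"
  proof (rule inj_onI)
    fix f f' assume f: "f \<in> supported (blocks B len)" "f' \<in> supported (blocks B len)" and eq: "comb f = comb f'"
    have m: "(\<lambda>p. - 1 * f' p) \<in> supported (blocks B len)" using f(2) by (auto simp: supported_def)
    have "comb (\<lambda>p. f p + - 1 * f' p) = comb f' \<oplus>\<^bsub>V\<^esub> comb (\<lambda>p. - 1 * f' p)" by (subst comb_add) (simp add: eq)
    also have "\<dots> = comb (\<lambda>p. f' p + - 1 * f' p)" by (rule comb_add[symmetric])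
    also have "\<dots> = \<zero>\<^bsub>V\<^esub>" using comb_zero by simp
    finally have "(\<lambda>p. f p + - 1 * f' p) = (\<lambda>p. 0)" by (intro indep supported_add f m)
    then show "f = f'" by (auto simp: fun_eq_iff)
  qed
  show ?thesis unfolding module_iso_def block_module_def
    using inj surj by (auto simp: bij_betw_def comb_add S.M_smult comb_smult elim!: carrier_A_E)
qed

text \<open>
  A relation may be taken homogeneous. If \<open>N\<^sup>k w\<^sub>a\<close> occurs in it with the least exponent \<open>k\<close>, dividing
  the relation by \<open>N\<^sup>k\<close> yields a vector that is killed by \<open>N\<^sup>k\<close> and in which \<open>w\<^sub>a\<close> has an invertible
  coefficient. This vector can take the place of \<open>w\<^sub>a\<close>, and it is shorter because \<open>k < len a\<close>.
\<close>

lemma shorten_family: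
  assumes gen: "generating V B w" and f: "f \<in> supported (blocks B len)" "comb f = \<zero>\<^bsub>V\<^esub>" "f \<noteq> (\<lambda>p. 0)"
  obtains w' len' where "homogeneous_family V B w' j len'" "generating V B w'" "sum len' B < sum len B"
proof -
  obtain a1 k1 where f1': "f (a1, k1) \<noteq> 0" using f(3) by fastforce
  \<comment> \<open>The component of the relation in the grade of one of its terms is again a relation.\<close>
  define h where "h = (j a1 + k1) mod n"
  have h: "h < n" using n_pos by (simp add: h_def)
  define f1 where "f1 = S.act (path h 0) f"
  have f1: "f1 (a, k) = (if (j a + k) mod n = h then f (a, k) else 0)" for a k
    unfolding f1_def S.act_path[OF d_pos] by (simp add: block_grade_def)
  have f1s: "f1 \<in> supported (blocks B len)" unfolding f1_def by (rule S.act_supported[OF f(1)])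
  have comb_f1: "comb f1 = \<zero>\<^bsub>V\<^esub>"
    using comb_smult[of "path h 0" f] h f by (simp add: f1_def V.smult_r_null)
  define k0 where "k0 = (LEAST k. \<exists>a. f1 (a, k) \<noteq> 0)"
  have "f1 (a1, k1) \<noteq> 0" using f1' by (simp add: f1 h_def)
  then have ex: "\<exists>k a. f1 (a, k) \<noteq> 0" by blast
  have "\<exists>a. f1 (a, k0) \<noteq> 0" unfolding k0_def by (rule LeastI_ex[OF ex])
  then obtain a0 where a0: "f1 (a0, k0) \<noteq> 0" by blast
  have k0_le: "k0 \<le> k" if "f1 (a, k) \<noteq> 0" for a k unfolding k0_def using that by (intro Least_le) blast
  have a0B: "a0 \<in> B" and k0: "k0 < len a0" using f1s a0 by (auto simp: supported_def blocks_def)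
  have k0d: "k0 < d" using k0 fam(3)[OF a0B] by simp
  have hj: "h = (j a0 + k0) mod n" using a0 by (simp add: f1 split: if_splits)
  \<comment> \<open>The relation divided by the path of length \<open>k0\<close>.\<close>
  define f2 where "f2 = (\<lambda>(a, k). f1 (a, k + k0))"
  have f2s: "f2 \<in> supported (blocks B len)" using f1s by (fastforce simp: supported_def blocks_def f2_def)
  have f2_grade: "(j a + k) mod n = j a0" if "f2 (a, k) \<noteq> 0" for a k
  proof -
    have "(j a + k + k0) mod n = (j a0 + k0) mod n" using that hj by (auto simp: f2_def f1 add.assoc split: if_splits)
    from mod_add_cancel[OF n_pos this] show ?thesis using fam(2)[OF a0B] by simp
  qed
  have act0: "S.act (path (j a0) 0) f2 = f2"
    using f2_grade unfolding S.act_path[OF d_pos] fun_eq_iff by (auto simp: block_grade_def)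
  have actk: "S.act (path (j a0) k0) f2 = f1"
  proof
    fix p :: "nat \<times> nat"
    obtain a l where p: "p = (a, l)" by (cases p)
    have ac: "S.act (path (j a0) k0) f2 p = (if (j a + l + (n - 1) * k0) mod n = j a0 then
        (if k0 \<le> l \<and> l < len a then f1 (a, l) else 0) else 0)"
      unfolding S.act_path[OF k0d] p block_shift_pow_supported[OF f2s] by (simp add: block_grade_def f2_def)
    show "S.act (path (j a0) k0) f2 p = f1 p"
    proof (cases "f1 (a, l) = 0")
      case False
      have l: "k0 \<le> l" "l < len a" using k0_le[OF False] f1s False by (auto simp: supported_def blocks_def)
      have "f2 (a, l - k0) \<noteq> 0" using False l by (simp add: f2_def)
      then have "(j a + (l - k0)) mod n = j a0" by (rule f2_grade)
      moreover have "j a + l + (n - 1) * k0 = j a + (l - k0) + n * k0"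
        using l n_pos by (cases n) (simp_all add: algebra_simps)
      ultimately have "(j a + l + (n - 1) * k0) mod n = j a0" by (simp only: mod_mult_self2)
      then show ?thesis using l unfolding ac by (simp add: p)
    next
      case True
      then show ?thesis unfolding ac by (simp add: p)
    qed
  qed
  define c where "c = f1 (a0, k0)"
  \<comment> \<open>Since \<open>d \<le> n\<close>, the grades within a block are distinct, so the vertex \<open>j a0\<close> occurs only at the
    start of block \<open>a0\<close>.\<close>
  have row0: "row j len f2 a0 = path_scale c (path (j a0) 0)"
  proof -
    have "f2 (a0, l) = (if l = 0 then c else 0)" if "l < len a0" for l
    proof (cases "f2 (a0, l) = 0")
      case False
      have "(l + j a0) mod n = (0 + j a0) mod n" using f2_grade[OF False] fam(2)[OF a0B] by (simp add: add.commute)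
      from mod_add_cancel[OF n_pos this] have "l mod n = 0" by simp
      moreover have "l < n" using that fam(3)[OF a0B] d_le_n by simp
      ultimately show ?thesis by (simp add: f2_def c_def)
    next
      case True
      then show ?thesis using a0 by (cases "l = 0") (auto simp: f2_def c_def)
    qed
    then show ?thesis using k0 by (auto simp: row_def path_scale_def path_def fun_eq_iff)
  qed
  define w' where "w' = w(a0 := comb f2)"
  define len' where "len' = len(a0 := k0)"
  have "homogeneous_family V B w' j len'"
    unfolding homogeneous_family_def
  proof (intro conjI ballI finB)
    fix a assume a: "a \<in> B"
    show "w' a \<in> carrier V" using a fam(1) comb_closed by (auto simp: w'_def)
    show "j a < n" by (rule fam(2)[OF a])
    show "len' a \<le> d" using a fam(3) k0d by (auto simp: len'_def)
    show "tc (path (j a) 0) \<odot>\<^bsub>V\<^esub> w' a = w' a"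
      using fam(2)[OF a] fam(4)[OF a] f2s act0 by (auto simp: w'_def comb_smult)
    show "tc (path (j a) (len' a)) \<odot>\<^bsub>V\<^esub> w' a = \<zero>\<^bsub>V\<^esub>"
      using fam(2)[OF a] fam(5)[OF a] f2s actk comb_f1 by (auto simp: w'_def len'_def comb_smult)
  qed
  moreover have "generating V B w'"
    unfolding generating_def
  proof (intro allI impI, elim conjE)
    fix L assume L: "submodule L A V" and sub: "w' ` B \<subseteq> L"
    have wL: "w a \<in> L" if "a \<in> B" "a \<noteq> a0" for a using that sub by (auto simp: w'_def)
    \<comment> \<open>The new generator is a multiple of the old one plus a combination of the others.\<close>
    define u where "u = tc (row j len f2 a0) \<odot>\<^bsub>V\<^esub> w a0"
    define R where "R = finsum V (\<lambda>a. tc (row j len f2 a) \<odot>\<^bsub>V\<^esub> w a) (B - {a0})"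
    have u: "u \<in> carrier V" unfolding u_def by (rule term_closed[OF a0B])
    have "comb f2 = finsum V (\<lambda>a. tc (row j len f2 a) \<odot>\<^bsub>V\<^esub> w a) (insert a0 (B - {a0}))"
      using a0B by (simp add: combination_def insert_absorb)
    also have "\<dots> = u \<oplus>\<^bsub>V\<^esub> R" unfolding u_def R_def
      using finB a0B by (intro V.M.finsum_insert) (auto simp: term_closed)
    finally have uR: "comb f2 = u \<oplus>\<^bsub>V\<^esub> R" .
    have RL: "R \<in> L" unfolding R_def using finB wL
      by (intro V.submodule_finsum[OF L]) (auto intro!: submoduleD(4)[OF L] row_closed' tc_closed)
    then have R: "R \<in> carrier V" using submoduleD(1)[OF L] by auto
    have "comb f2 \<in> L" using sub a0B by (auto simp: w'_def)
    moreover have "\<ominus>\<^bsub>V\<^esub> R \<in> L"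
      using subgroup.m_inv_closed[OF submodule.axioms(1)[OF L] RL] by (simp add: a_inv_def)
    ultimately have "comb f2 \<oplus>\<^bsub>V\<^esub> \<ominus>\<^bsub>V\<^esub> R \<in> L" by (rule submoduleD(3)[OF L])
    moreover have "comb f2 \<oplus>\<^bsub>V\<^esub> \<ominus>\<^bsub>V\<^esub> R = u" using u R by (simp add: uR V.M.a_assoc V.M.r_neg)
    ultimately have uL: "u \<in> L" by simp
    have p: "path_scale (1 / c) (path_one n) \<in> carrier P" "path (j a0) 0 \<in> carrier P"
      using fam(2)[OF a0B] by (simp_all add: path_one_closed)
    have "tc (path_scale (1 / c) (path_one n)) \<odot>\<^bsub>V\<^esub> u
        = tc (path_mult n (path_scale (1 / c) (path_one n)) (path_scale c (path (j a0) 0))) \<odot>\<^bsub>V\<^esub> w a0"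
      unfolding u_def row0 using p fam(1)[OF a0B] by (simp add: tc_mult[symmetric] V.smult_assoc)
    also have "path_mult n (path_scale (1 / c) (path_one n)) (path_scale c (path (j a0) 0)) = path (j a0) 0"
      unfolding path_mult_scale path_mult_one_left[OF n_pos] using a0 by (simp add: path_scale_def c_def)
    finally have "w a0 = tc (path_scale (1 / c) (path_one n)) \<odot>\<^bsub>V\<^esub> u" using fam(4)[OF a0B] by simp
    then have "w a0 \<in> L" using submoduleD(4)[OF L] uL p by simp
    then have "w ` B \<subseteq> L" using wL by auto
    then show "L = carrier V" using gen L by (simp add: generating_def)
  qed
  moreover have "sum len' B < sum len B"
    using a0B finB k0 by (intro sum_strict_mono_ex1) (auto simp: len'_def)
  ultimately show ?thesis by (rule that)
qed

end

context nakayama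
begin

text \<open>
  The offset \<open>s\<close> allows two modules to be decomposed over disjoint sets of blocks.
\<close>

theorem fg_module_block_decomposition:
  fixes V :: "('k trunc_elt, 'v) module"
  assumes fg: "fg_module A V"
  obtains t j len where "\<And>a. a \<in> {s..<s + t} \<Longrightarrow> j a < n" "\<And>a. a \<in> {s..<s + t} \<Longrightarrow> len a \<le> d"
    "module_isomorphic A (block_module n d {s..<s + t} j len) V"
proof -
  have V: "left_module A V" using fg by (simp add: fg_module_def)
  interpret V: left_mod A V using V by (simp add: left_module_iff)
  obtain S where S: "finite S" "S \<subseteq> carrier V" "\<And>L. submodule L A V \<Longrightarrow> S \<subseteq> L \<Longrightarrow> L = carrier V"
    using fg by (auto simp: fg_module_def)
  define t where "t = card (S \<times> {..<n})"
  define B where "B = {s..<s + t}"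
  have "finite (S \<times> {..<n})" using S by simp
  then obtain e where e: "bij_betw e B (S \<times> {..<n})"
    unfolding B_def t_def by (metis add_diff_cancel_left' card_atLeastLessThan finite_atLeastLessThan finite_same_card_bij)
  \<comment> \<open>The homogeneous components of finitely many generators, all with the trivial length \<open>d\<close>.\<close>
  define w0 where "w0 a = tc (path (snd (e a)) 0) \<odot>\<^bsub>V\<^esub> fst (e a)" for a
  define j where "j a = snd (e a)" for a
  have eB: "fst (e a) \<in> S" "snd (e a) < n" if "a \<in> B" for a
    using bij_betwE[OF e] that by (auto simp: mem_Times_iff)
  have 1: "homogeneous_family V B w0 j (\<lambda>_. d)"
    unfolding homogeneous_family_def
  proof (intro conjI ballI)
    fix a assume a: "a \<in> B"
    have v: "fst (e a) \<in> carrier V" and ja: "j a < n" using eB[OF a] S(2) by (auto simp: j_def)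
    show "w0 a \<in> carrier V" "j a < n" "d \<le> d" using v ja by (simp_all add: w0_def j_def)
    have *: "tc (path (j a) k) \<odot>\<^bsub>V\<^esub> w0 a = tc (path (j a) k) \<odot>\<^bsub>V\<^esub> fst (e a)" for k
      using v ja by (simp add: w0_def j_def[symmetric] V.smult_assoc[symmetric] tc_mult path_mult_path_path)
    show "tc (path (j a) 0) \<odot>\<^bsub>V\<^esub> w0 a = w0 a" unfolding * by (simp add: w0_def j_def)
    have "tc (path (j a) d) = \<zero>\<^bsub>A\<^esub>"
      using ja by (simp add: tc_zero tc_eq_iff path_zero_closed) (simp add: path_def)
    then show "tc (path (j a) d) \<odot>\<^bsub>V\<^esub> w0 a = \<zero>\<^bsub>V\<^esub>" unfolding * using v by (simp add: V.smult_l_null)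
  qed (simp add: B_def)
  have 2: "generating V B w0"
    unfolding generating_def
  proof (intro allI impI, elim conjE)
    fix L assume L: "submodule L A V" and sub: "w0 ` B \<subseteq> L"
    have "v \<in> L" if v: "v \<in> S" for v
    proof -
      have vc: "v \<in> carrier V" using v S by auto
      have in_L: "tc (path i 0) \<odot>\<^bsub>V\<^esub> v \<in> L" if "i < n" for i
      proof -
        have "(v, i) \<in> e ` B" using e v that by (simp add: bij_betw_def)
        then obtain a where "a \<in> B" "e a = (v, i)" by auto
        then show ?thesis using sub by (force simp: w0_def)
      qed
      \<comment> \<open>An element is the sum of its components at the vertices, because the vertices sum to \<open>1\<close>.\<close>
      have part: "tc (\<lambda>i l. if i < m \<and> l = 0 then 1 else 0) \<odot>\<^bsub>V\<^esub> v \<in> L" if "m \<le> n" for m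
        using that
      proof (induction m)
        case 0
        show ?case using vc submoduleD(2)[OF L] by (simp add: tc_zero[symmetric] V.smult_l_null)
      next
        case (Suc m)
        have c: "(\<lambda>i l. if i < m \<and> l = 0 then 1 else 0) \<in> carrier P"
          using Suc.prems by (intro path_carrierI[where b=1]) (auto split: if_splits)
        have "(\<lambda>i l. if i < Suc m \<and> l = 0 then 1 else 0)
            = (\<lambda>i l. path m 0 i l + (if i < m \<and> l = 0 then 1 else (0::'k)))"
          by (auto simp: path_def fun_eq_iff)
        then have "tc (\<lambda>i l. if i < Suc m \<and> l = 0 then 1 else 0) \<odot>\<^bsub>V\<^esub> v
            = tc (path m 0) \<odot>\<^bsub>V\<^esub> v \<oplus>\<^bsub>V\<^esub> tc (\<lambda>i l. if i < m \<and> l = 0 then 1 else 0) \<odot>\<^bsub>V\<^esub> v"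
          using Suc.prems c vc by (simp add: tc_add[symmetric] V.smult_l_distr)
        then show ?case using Suc in_L by (simp add: submoduleD(3)[OF L])
      qed
      have "path_one n = (\<lambda>i l. if i < n \<and> l = 0 then 1 else (0::'k))" by (auto simp: path_one_apply fun_eq_iff)
      then show ?thesis using part[of n] vc V.smult_one[of v] by (simp add: tc_one)
    qed
    then show "L = carrier V" using S(3)[OF L] by auto
  qed
  \<comment> \<open>A family of least total length admits no further shortening.\<close>
  let ?Q = "\<lambda>(w, len). homogeneous_family V B w j len \<and> generating V B w"
  have "?Q (w0, \<lambda>_. d)" using 1 2 by simp
  from ex_has_least_nat[of ?Q, OF this, of "\<lambda>(w, len). sum len B"]
  obtain w len where fam: "homogeneous_family V B w j len" and gen: "generating V B w"
    and least: "\<And>w' len'. homogeneous_family V B w' j len' \<Longrightarrow> generating V B w' \<Longrightarrow> sum len B \<le> sum len' B"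
    by fastforce
  interpret F: nakayama_family n d Kt V B w j len by unfold_locales (rule fam)
  have "module_iso F.comb A (block_module n d B j len) V"
  proof (rule F.comb_iso[OF gen])
    fix f assume "f \<in> supported (blocks B len)" "F.comb f = \<zero>\<^bsub>V\<^esub>"
    then show "f = (\<lambda>p. 0)" using F.shorten_family[OF gen] least by (metis not_less)
  qed
  then show ?thesis using F.fam unfolding B_def by (intro that module_isomorphicI) auto
qed

end

section \<open>The comultiplication in coordinates\<close>

lemma finite_splittings: "finite (splittings n h)"
  by (rule finite_subset[of _ "{..<n} \<times> {..<n}"]) (auto simp: splittings_def)

lemma comult_vertex_apply:
  "comult_vertex n h (j, a) (j', b) = (if (j, j') \<in> splittings n h \<and> a = 0 \<and> b = 0 then 1 else (0::'k::field))"
proof -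
  have "comult_vertex n h (j, a) (j', b)
      = (\<Sum>g\<in>splittings n h. if (j, j') = g then (if a = 0 \<and> b = 0 then 1 else (0::'k)) else 0)"
    unfolding comult_vertex_def by (intro sum.cong) (auto simp: pure_tensor_def path_def split: if_splits)
  then show ?thesis by (simp add: finite_splittings)
qed

lemma comult_arrow_apply:
  "comult_arrow n h (j, a) (j', b) =
     (if (j, j') \<in> splittings n h \<and> (a = 1 \<and> b = 0 \<or> a = 0 \<and> b = 1) then 1 else (0::'k::field))"
proof -
  have "comult_arrow n h (j, a) (j', b)
      = (\<Sum>g\<in>splittings n h. if (j, j') = g then (if a = 1 \<and> b = 0 \<or> a = 0 \<and> b = 1 then 1 else (0::'k)) else 0)"
    unfolding comult_arrow_def by (intro sum.cong) (auto simp: pure_tensor_def path_def split: if_splits)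
  then show ?thesis by (simp add: finite_splittings)
qed

text \<open>
  Prolonging the path by an arrow prolongs one of the two tensor factors, which is Pascal's rule. The
  sources of the factors add up to the source of the path; their ends then do so as well.
\<close>

lemma comult_path_apply:
  assumes "i < n"
  shows "comult_path n i l (j, a) (j', b) =
    (if (j, j') \<in> splittings n i \<and> a + b = l then of_nat (l choose a) else (0::'k::field))"
proof (induction l arbitrary: a b)
  case 0 then show ?case by (auto simp: comult_vertex_apply)
next
  case (Suc l)
  have eq: "comult_path n i (Suc l) (j, a) (j', b) =
      (\<Sum>u\<le>a. \<Sum>v\<le>b. comult_arrow n ((i + l) mod n) ((j + u) mod n, a - u) ((j' + v) mod n, b - v)
        * (if (j, j') \<in> splittings n i \<and> u + v = l then of_nat (l choose u) else (0::'k)))"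
    by (simp only: comult_path.simps path_tensor_mult_def prod.case Suc)
  show ?case
  proof (cases "(j, j') \<in> splittings n i \<and> a + b = Suc l")
    case False
    have "comult_arrow n ((i + l) mod n) ((j + u) mod n, a - u) ((j' + v) mod n, b - v)
        * (if (j, j') \<in> splittings n i \<and> u + v = l then of_nat (l choose u) else (0::'k)) = 0"
      if "u \<le> a" "v \<le> b" for u v
      using False that by (auto simp: comult_arrow_apply)
    then show ?thesis unfolding eq using False by (auto intro!: sum.neutral)
  next
    case True
    then have spl: "(j, j') \<in> splittings n i" and ab: "a + b = Suc l" by auto
    have split': "((j + u) mod n, (j' + v) mod n) \<in> splittings n ((i + l) mod n)" if "u + v = l" for u v
    proof -
      have "((j + u) mod n + (j' + v) mod n) mod n = ((j + u) + (j' + v)) mod n" by (rule mod_add_eq)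
      also have "(j + u) + (j' + v) = (j + j') + (u + v)" by simp
      also have "\<dots> mod n = ((j + j') mod n + (u + v)) mod n" by (simp only: mod_add_left_eq)
      finally have "((j + u) mod n + (j' + v) mod n) mod n = ((j + j') mod n + (u + v)) mod n" .
      then show ?thesis using spl that assms by (auto simp: splittings_def)
    qed
    have t: "comult_arrow n ((i + l) mod n) ((j + u) mod n, a - u) ((j' + v) mod n, b - v)
        * (if (j, j') \<in> splittings n i \<and> u + v = l then of_nat (l choose u) else (0::'k))
       = (if b = v then (if a = Suc u then of_nat (l choose u) else 0) else 0)
       + (if b = Suc v then (if a = u then of_nat (l choose u) else 0) else 0)"
      if "u \<le> a" "v \<le> b" for u v
      using that ab spl split'[of u v] by (auto simp: comult_arrow_apply)
    have "comult_path n i (Suc l) (j, a) (j', b) =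
        (\<Sum>u\<le>a. \<Sum>v\<le>b. (if b = v then (if a = Suc u then of_nat (l choose u) else 0) else 0)
       + (if b = Suc v then (if a = u then of_nat (l choose u) else (0::'k)) else 0))"
      unfolding eq by (intro sum.cong refl t) auto
    also have "\<dots> = (\<Sum>u\<le>a. if a = Suc u then of_nat (l choose u) else 0)
       + (\<Sum>u\<le>a. \<Sum>v\<le>b. if b = Suc v then (if a = u then of_nat (l choose u) else 0) else 0)"
      by (simp add: sum.distrib)
    also have "(\<Sum>u\<le>a. if a = Suc u then of_nat (l choose u) else 0) = (if a = 0 then 0 else of_nat (l choose (a - 1)) :: 'k)"
    proof (cases a)
      case (Suc a')
      have "(\<Sum>u\<le>a. if a = Suc u then of_nat (l choose u) else 0) = (\<Sum>u\<le>a. if a' = u then of_nat (l choose u) else (0::'k))"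
        using Suc by (intro sum.cong) auto
      then show ?thesis using Suc by simp
    qed simp
    also have "(\<Sum>u\<le>a. \<Sum>v\<le>b. if b = Suc v then (if a = u then of_nat (l choose u) else 0) else 0)
        = (of_nat (l choose a) :: 'k)"
    proof (cases b)
      case 0
      then have "a = Suc l" using ab by simp
      then show ?thesis using 0 by (simp add: binomial_eq_0)
    next
      case (Suc b')
      have "(\<Sum>u\<le>a. \<Sum>v\<le>b. if b = Suc v then (if a = u then of_nat (l choose u) else 0) else 0)
          = (\<Sum>u\<le>a. \<Sum>v\<le>b. if b' = v then (if a = u then of_nat (l choose u) else 0) else (0::'k))"
        using Suc by (intro sum.cong) auto
      then show ?thesis using Suc by simp
    qed
    also have "(if a = 0 then 0 else of_nat (l choose (a - 1))) + of_nat (l choose a) = (of_nat (Suc l choose a) :: 'k)"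
      by (cases a) simp_all
    finally show ?thesis using True by simp
  qed
qed

lemma comult_apply:
  assumes "x \<in> carrier (path_algebra n)"
  shows "comult n x (j, a) (j', b) =
    (if j < n \<and> j' < n then x ((j + j') mod n) (a + b) * of_nat (a + b choose a) else (0::'k::field))"
proof -
  have fin: "finite {(i, l). x i l \<noteq> 0}" using assms by (simp add: path_carrier_iff)
  have "comult n x (j, a) (j', b)
      = (\<Sum>q\<in>{(i, l). x i l \<noteq> 0}. if ((j + j') mod n, a + b) = q then
          (if j < n \<and> j' < n then x ((j + j') mod n) (a + b) * of_nat (a + b choose a) else 0) else 0)"
    unfolding comult_def
  proof (intro sum.cong refl, clarify)
    fix i l assume "x i l \<noteq> 0"
    then have "i < n" using assms by (auto simp: path_carrier_iff)
    then show "x i l * comult_path n i l (j, a) (j', b) = (if ((j + j') mod n, a + b) = (i, l) then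
          (if j < n \<and> j' < n then x ((j + j') mod n) (a + b) * of_nat (a + b choose a) else 0) else 0)"
      by (auto simp: comult_path_apply splittings_def)
  qed
  also have "\<dots> = (if j < n \<and> j' < n then x ((j + j') mod n) (a + b) * of_nat (a + b choose a) else 0)"
    using fin by (subst sum.delta') auto
  finally show ?thesis .
qed

lemma finite_comult_support:
  assumes "x \<in> carrier (path_algebra n)"
  shows "finite {(p, q). comult n (x :: 'k::field path_elt) p q \<noteq> 0}"
proof -
  obtain b where b: "\<forall>i l. x i l \<noteq> 0 \<longrightarrow> i < n \<and> l < b" using assms by (rule path_carrierE)
  have "{(p, q). comult n x p q \<noteq> 0} \<subseteq> ({..<n} \<times> {..<b}) \<times> ({..<n} \<times> {..<b})"
  proof
    fix r assume "r \<in> {(p, q). comult n x p q \<noteq> 0}"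
    then obtain j a j' c where r: "r = ((j, a), (j', c))" and "comult n x (j, a) (j', c) \<noteq> 0" by auto
    then have "j < n" "j' < n" "x ((j + j') mod n) (a + c) \<noteq> 0"
      by (auto simp: comult_apply[OF assms] split: if_splits)
    with b[rule_format, of "(j + j') mod n" "a + c"]
    show "r \<in> ({..<n} \<times> {..<b}) \<times> ({..<n} \<times> {..<b})" by (auto simp: r)
  qed
  then show ?thesis by (rule finite_subset) auto
qed

section \<open>The tensor product of graded spaces\<close>

text \<open>
  Pascal's rule, in the form in which it computes the powers of \<open>N \<otimes> 1 + 1 \<otimes> N\<close>.
\<close>

lemma binomial_step:
  fixes u v :: "nat \<Rightarrow> 'k::field"
  shows "(\<Sum>a\<le>l. of_nat (l choose a) * (u (Suc a) * v (l - a))) + (\<Sum>a\<le>l. of_nat (l choose a) * (u a * v (Suc (l - a))))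
    = (\<Sum>a\<le>Suc l. of_nat (Suc l choose a) * (u a * v (Suc l - a)))"
proof -
  have "(\<Sum>a\<le>Suc l. of_nat (l choose a) * (u a * v (Suc l - a))) = (\<Sum>a\<le>l. of_nat (l choose a) * (u a * v (Suc (l - a))))"
    by (simp add: Suc_diff_le binomial_eq_0)
  then have 1: "(\<Sum>a\<le>l. of_nat (l choose a) * (u a * v (Suc (l - a))))
      = u 0 * v (Suc l) + (\<Sum>a\<le>l. of_nat (l choose Suc a) * (u (Suc a) * v (l - a)))"
    by (simp only: sum.atMost_Suc_shift) simp
  have "(\<Sum>a\<le>Suc l. of_nat (Suc l choose a) * (u a * v (Suc l - a)))
      = u 0 * v (Suc l) + (\<Sum>a\<le>l. of_nat (Suc l choose Suc a) * (u (Suc a) * v (l - a)))"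
    by (simp only: sum.atMost_Suc_shift) simp
  then show ?thesis unfolding 1 by (simp add: distrib_right sum.distrib)
qed

definition tensor_grade :: "('i \<Rightarrow> nat) \<Rightarrow> ('j \<Rightarrow> nat) \<Rightarrow> 'i \<times> 'j \<Rightarrow> nat" where
  "tensor_grade g g' = (\<lambda>(p, q). g p + g' q)"

definition tensor_shift ::
  "(('i \<Rightarrow> 'k) \<Rightarrow> 'i \<Rightarrow> 'k) \<Rightarrow> (('j \<Rightarrow> 'k) \<Rightarrow> 'j \<Rightarrow> 'k) \<Rightarrow> ('i \<times> 'j \<Rightarrow> 'k) \<Rightarrow> 'i \<times> 'j \<Rightarrow> 'k::field" where
  "tensor_shift N N' F = (\<lambda>(p, q). N (\<lambda>p'. F (p', q)) p + N' (\<lambda>q'. F (p, q')) q)"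

definition ptensor :: "('i \<Rightarrow> 'k) \<Rightarrow> ('j \<Rightarrow> 'k) \<Rightarrow> 'i \<times> 'j \<Rightarrow> 'k::field" where
  "ptensor f f' = (\<lambda>(p, q). f p * f' q)"

text \<open>
  The vanishing of the inner binomial coefficients is the only property of \<open>d\<close> and the characteristic
  on which the tensor product depends; it makes the \<open>d\<close>-th power of \<open>N \<otimes> 1 + 1 \<otimes> N\<close> vanish.
\<close>

locale graded_pair = nakayama n d Kt + S: graded_space n d Kt I g N + S': graded_space n d Kt I' g' N'
  for n d and Kt :: "'k::field itself" and I :: "'i set" and g and N :: "('i \<Rightarrow> 'k) \<Rightarrow> 'i \<Rightarrow> 'k"
    and I' :: "'j set" and g' and N' :: "('j \<Rightarrow> 'k) \<Rightarrow> 'j \<Rightarrow> 'k" +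
  assumes choose_zero: "\<And>c. 0 < c \<Longrightarrow> c < d \<Longrightarrow> (of_nat (d choose c) :: 'k) = 0"
begin

abbreviation gT where "gT \<equiv> tensor_grade g g'"
abbreviation NT where "NT \<equiv> tensor_shift N N'"

sublocale T0: graded_operator n d Kt "I \<times> I'" gT NT
proof unfold_locales
  show "finite (I \<times> I')" using S.fin S'.fin by simp
  fix F F' :: "'i \<times> 'j \<Rightarrow> 'k"
  show "NT (\<lambda>p. F p + F' p) = (\<lambda>p. NT F p + NT F' p)"
    by (auto simp: tensor_shift_def S.N_add S'.N_add add_ac)
  show "NT F \<in> supported (I \<times> I')" if F: "F \<in> supported (I \<times> I')"
  proof -
    have 1: "N (\<lambda>p'. F (p', q)) p = 0" if "\<not> (p \<in> I \<and> q \<in> I')" for p q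
    proof (cases "q \<in> I'")
      case True
      have "(\<lambda>p'. F (p', q)) \<in> supported I" using F by (auto simp: supported_def)
      then have "N (\<lambda>p'. F (p', q)) \<in> supported I" by (rule S.N_supported)
      then show ?thesis using that True by (auto simp: supported_def)
    next
      case False
      then have "(\<lambda>p'. F (p', q)) = (\<lambda>p. 0)" using F by (auto simp: supported_def)
      then show ?thesis by (simp add: S.N_zero)
    qed
    have 2: "N' (\<lambda>q'. F (p, q')) q = 0" if "\<not> (p \<in> I \<and> q \<in> I')" for p q
    proof (cases "p \<in> I")
      case True
      have "(\<lambda>q'. F (p, q')) \<in> supported I'" using F by (auto simp: supported_def)
      then have "N' (\<lambda>q'. F (p, q')) \<in> supported I'" by (rule S'.N_supported)
      then show ?thesis using that True by (auto simp: supported_def)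
    next
      case False
      then have "(\<lambda>q'. F (p, q')) = (\<lambda>p. 0)" using F by (auto simp: supported_def)
      then show ?thesis by (simp add: S'.N_zero)
    qed
    have "NT F (p, q) = 0" if "\<not> (p \<in> I \<and> q \<in> I')" for p q
      using 1[OF that] 2[OF that] by (simp add: tensor_shift_def)
    then show ?thesis by (auto simp: supported_def)
  qed
  fix c :: "nat \<Rightarrow> 'k"
  show "NT (\<lambda>p. c (gT p mod n) * F p) = (\<lambda>p. c ((gT p + (n - 1)) mod n) * NT F p)"
  proof
    fix pq :: "'i \<times> 'j" obtain p q where pq: "pq = (p, q)" by (cases pq)
    have 1: "N (\<lambda>p'. c ((g p' + g' q) mod n) * F (p', q)) p = c ((g p + g' q + (n - 1)) mod n) * N (\<lambda>p'. F (p', q)) p"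
      using S.N_graded[of "\<lambda>h. c ((h + g' q) mod n)" "\<lambda>p'. F (p', q)"]
      by (simp add: mod_simps add_ac fun_eq_iff del: One_nat_def)
    have 2: "N' (\<lambda>q'. c ((g p + g' q') mod n) * F (p, q')) q = c ((g p + g' q + (n - 1)) mod n) * N' (\<lambda>q'. F (p, q')) q"
      using S'.N_graded[of "\<lambda>h. c ((g p + h) mod n)" "\<lambda>q'. F (p, q')"]
      by (simp add: mod_simps add_ac fun_eq_iff del: One_nat_def)
    show "NT (\<lambda>p. c (gT p mod n) * F p) pq = c ((gT pq + (n - 1)) mod n) * NT F pq"
      unfolding pq tensor_shift_def tensor_grade_def prod.case 1 2 by (simp add: distrib_left)
  qed
qed

lemma NT_ptensor: "NT (ptensor f f') = (\<lambda>p. ptensor (N f) f' p + ptensor f (N' f') p)"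
  using S.N_scale[of _ f] S'.N_scale[of _ f']
  by (auto simp: tensor_shift_def ptensor_def fun_eq_iff mult.commute[of "f _" "f' _"] mult.commute[of "N f _" "f' _"])
     (simp add: mult.commute[of "f' _" "f _"])

lemma NT_pow_ptensor:
  "(NT ^^ l) (ptensor f f') = (\<lambda>p. \<Sum>a\<le>l. of_nat (l choose a) * ptensor ((N ^^ a) f) ((N' ^^ (l - a)) f') p)"
proof (induction l)
  case 0 show ?case by simp
next
  case (Suc l)
  have "(NT ^^ Suc l) (ptensor f f') = (\<lambda>p. \<Sum>a\<le>l. of_nat (l choose a) * NT (ptensor ((N ^^ a) f) ((N' ^^ (l - a)) f')) p)"
    using Suc T0.Npow_sum[of "{..l}" 1] T0.N_scale by simp
  also have "\<dots> = (\<lambda>p. (\<Sum>a\<le>Suc l. of_nat (Suc l choose a) * ptensor ((N ^^ a) f) ((N' ^^ (Suc l - a)) f') p))"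
  proof
    fix pq :: "'i \<times> 'j" obtain p q where pq: "pq = (p, q)" by (cases pq)
    show "(\<Sum>a\<le>l. of_nat (l choose a) * NT (ptensor ((N ^^ a) f) ((N' ^^ (l - a)) f')) pq)
      = (\<Sum>a\<le>Suc l. of_nat (Suc l choose a) * ptensor ((N ^^ a) f) ((N' ^^ (Suc l - a)) f') pq)"
      using binomial_step[of l "\<lambda>a. (N ^^ a) f p" "\<lambda>b. (N' ^^ b) f' q"]
      unfolding NT_ptensor unfolding pq ptensor_def prod.case by (simp add: distrib_left sum.distrib)
  qed
  finally show ?case .
qed

lemma delta_ptensor: "delta (p, q) = ptensor (delta p) (delta q)"
  by (auto simp: delta_def ptensor_def fun_eq_iff)

sublocale T: graded_space n d Kt "I \<times> I'" gT NT
proof unfold_locales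
  fix F :: "'i \<times> 'j \<Rightarrow> 'k" assume "F \<in> supported (I \<times> I')"
  with T0.fin show "(NT ^^ d) F = (\<lambda>p. 0)"
  proof (induction rule: supported_induct)
    case zero show ?case by (rule T0.Npow_zero)
  next
    case (step h c pq)
    obtain p q where pq: "pq = (p, q)" "p \<in> I" "q \<in> I'" using step by auto
    have "of_nat (d choose a) * ptensor ((N ^^ a) (delta p)) ((N' ^^ (d - a)) (delta q)) r = 0" if "a \<le> d" for a r
    proof -
      have "a = 0 \<or> a = d \<or> (0 < a \<and> a < d)" using that by linarith
      then consider "a = 0" | "a = d" | "0 < a" "a < d" by blast
      then show ?thesis
      proof cases
        case 1 then show ?thesis using S'.N_nilpotent[OF S'.delta_supported[OF pq(3)]] by (auto simp: ptensor_def)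
      next
        case 2 then show ?thesis using S.N_nilpotent[OF S.delta_supported[OF pq(2)]] by (auto simp: ptensor_def)
      next
        case 3 then show ?thesis by (simp add: choose_zero)
      qed
    qed
    then have "(NT ^^ d) (delta pq) = (\<lambda>p. 0)" unfolding pq delta_ptensor NT_pow_ptensor
      by (intro ext sum.neutral ballI) simp
    then show ?case using step.IH by (simp add: T0.Npow_add T0.Npow_scale)
  qed
qed

text \<open>
  The powers of \<open>N \<otimes> 1 + 1 \<otimes> N\<close> from \<open>d\<close> on vanish, so the sum over \<open>L < d\<close> may be extended to
  \<open>L < 2 d\<close>. It then runs over all pairs \<open>a, b < d\<close>, including those with \<open>a + b \<ge> d\<close>.
\<close>

lemma act_ptensor:
  assumes f: "f \<in> supported I" "f' \<in> supported I'"
  shows "T.act x (ptensor f f') (p, q) =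
    (\<Sum>a<d. \<Sum>b<d. x ((g p + g' q + (n - 1) * (a + b)) mod n) (a + b) *
       (of_nat (a + b choose a) * ((N ^^ a) f p * (N' ^^ b) f' q)))"
proof -
  let ?t = "\<lambda>a b. x ((g p + g' q + (n - 1) * (a + b)) mod n) (a + b) *
       (of_nat (a + b choose a) * ((N ^^ a) f p * (N' ^^ b) f' q))"
  have sup: "ptensor f f' \<in> supported (I \<times> I')" using f by (auto simp: supported_def ptensor_def)
  have "T.act x (ptensor f f') (p, q) = (\<Sum>L<d. x ((g p + g' q + (n - 1) * L) mod n) L * (NT ^^ L) (ptensor f f') (p, q))"
    by (simp add: graded_action_def tensor_grade_def)
  also have "\<dots> = (\<Sum>L<2*d. x ((g p + g' q + (n - 1) * L) mod n) L * (NT ^^ L) (ptensor f f') (p, q))"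
    using T.Npow_vanish[OF sup] by (intro sum.mono_neutral_left) auto
  also have "\<dots> = (\<Sum>L<2*d. \<Sum>a\<le>L. x ((g p + g' q + (n - 1) * L) mod n) L *
      (of_nat (L choose a) * ((N ^^ a) f p * (N' ^^ (L - a)) f' q)))"
    unfolding NT_pow_ptensor by (simp add: ptensor_def sum_distrib_left)
  also have "\<dots> = (\<Sum>(L, a)\<in>(SIGMA L:{..<2*d}. {..L}). x ((g p + g' q + (n - 1) * L) mod n) L *
      (of_nat (L choose a) * ((N ^^ a) f p * (N' ^^ (L - a)) f' q)))"
    by (simp add: sum.Sigma)
  also have "\<dots> = (\<Sum>(a, b)\<in>{(a, b). a + b < 2 * d}. ?t a b)"
    by (rule sum.reindex_bij_witness[where i="\<lambda>(a, b). (a + b, a)" and j="\<lambda>(L, a). (a, L - a)"]) auto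
  also have "\<dots> = (\<Sum>(a, b)\<in>{..<d} \<times> {..<d}. ?t a b)"
  proof (rule sum.mono_neutral_right)
    show "finite {(a, b). a + b < 2 * d}" by (rule finite_subset[of _ "{..<2*d} \<times> {..<2*d}"]) auto
    have v: "(N ^^ a) f p * (N' ^^ b) f' q = 0" if "\<not> (a < d \<and> b < d)" for a b
      using S.Npow_vanish[OF f(1), of a] S'.Npow_vanish[OF f(2), of b] that by (auto simp: not_less)
    show "\<forall>i\<in>{(a, b). a + b < 2 * d} - {..<d} \<times> {..<d}. (case i of (a, b) \<Rightarrow> ?t a b) = 0"
    proof
      fix r assume "r \<in> {(a, b). a + b < 2 * d} - {..<d} \<times> {..<d}"
      then obtain a b where "r = (a, b)" "\<not> (a < d \<and> b < d)" by auto
      then show "(case r of (a, b) \<Rightarrow> ?t a b) = 0" using v[of a b] by simp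
    qed
  qed auto
  also have "\<dots> = (\<Sum>a<d. \<Sum>b<d. ?t a b)" by (simp add: sum.cartesian_product)
  finally show ?thesis .
qed

text \<open>
  A path acts on \<open>f\<close> at the index \<open>p\<close> only if its source is the grade of \<open>p\<close> moved back by its length,
  so each pair of lengths contributes one term to the sum over the comultiplication.
\<close>

lemma comult_action:
  assumes x: "x \<in> carrier P" and f: "f \<in> supported I" "f' \<in> supported I'"
  shows "(\<Sum>((i, k), (j, l))\<in>{(p, q). comult n x p q \<noteq> 0}.
      S.act (path_scale (comult n x (i, k) (j, l)) (path i k)) f p * S'.act (path j l) f' q)
    = T.act x (ptensor f f') (p, q)"
proof -
  define h where "h = (\<lambda>((i, k), (j, l)).
      S.act (path_scale (comult n x (i, k) (j, l)) (path i k)) f p * S'.act (path j l) f' q)"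
  define s where "s k = (g p + (n - 1) * k) mod n" for k
  define s' where "s' l = (g' q + (n - 1) * l) mod n" for l
  let ?e = "\<lambda>(k, l). ((s k, k), (s' l, l))"
  let ?t = "\<lambda>a b. x ((g p + g' q + (n - 1) * (a + b)) mod n) (a + b) *
       (of_nat (a + b choose a) * ((N ^^ a) f p * (N' ^^ b) f' q))"
  have sc: "S.act (path_scale c y) f = (\<lambda>p. c * S.act y f p)" for c y
    by (simp add: graded_action_def path_scale_def sum_distrib_left mult.assoc)
  \<comment> \<open>Paths of length at least \<open>d\<close> act as zero on the factors, although they occur in the comultiplication.\<close>
  have low: "S.act (path i k) f p = (if k < d \<and> s k = i then (N ^^ k) f p else 0)" for i k
  proof (cases "k < d")
    case False
    then have "S.act (path i k) f p = 0" unfolding graded_action_def path_def by (intro sum.neutral) auto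
    then show ?thesis using False by simp
  qed (simp add: S.act_path s_def)
  have low': "S'.act (path j l) f' q = (if l < d \<and> s' l = j then (N' ^^ l) f' q else 0)" for j l
  proof (cases "l < d")
    case False
    then have "S'.act (path j l) f' q = 0" unfolding graded_action_def path_def by (intro sum.neutral) auto
    then show ?thesis using False by simp
  qed (simp add: S'.act_path s'_def)
  have h: "h ((i, k), (j, l)) = comult n x (i, k) (j, l) *
      ((if k < d \<and> s k = i then (N ^^ k) f p else 0) * (if l < d \<and> s' l = j then (N' ^^ l) f' q else 0))" for i k j l
    unfolding h_def by (simp add: sc low low')
  have "(\<Sum>r\<in>{(p, q). comult n x p q \<noteq> 0}. h r) = (\<Sum>r\<in>?e ` ({..<d} \<times> {..<d}). h r)"
  proof (rule sum.mono_neutral_cong)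
    show "finite {(p, q). comult n x p q \<noteq> 0}" by (rule finite_comult_support[OF x])
  qed (auto simp: h)
  also have "\<dots> = (\<Sum>(k, l)\<in>{..<d} \<times> {..<d}. h ((s k, k), (s' l, l)))"
    by (subst sum.reindex) (auto simp: inj_on_def case_prod_unfold)
  also have "\<dots> = (\<Sum>(k, l)\<in>{..<d} \<times> {..<d}. ?t k l)"
  proof (rule sum.cong[OF refl])
    fix r assume "r \<in> {..<d} \<times> {..<d}"
    then obtain k l where r: "r = (k, l)" "k < d" "l < d" by auto
    have "(s k + s' l) mod n = (g p + (n - 1) * k + (g' q + (n - 1) * l)) mod n"
      unfolding s_def s'_def by (rule mod_add_eq)
    also have "g p + (n - 1) * k + (g' q + (n - 1) * l) = g p + g' q + (n - 1) * (k + l)"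
      by (simp add: distrib_left)
    finally have "(s k + s' l) mod n = (g p + g' q + (n - 1) * (k + l)) mod n" .
    moreover have "s k < n" "s' l < n" using n_pos by (simp_all add: s_def s'_def)
    ultimately show "(case r of (k, l) \<Rightarrow> h ((s k, k), (s' l, l))) = (case r of (k, l) \<Rightarrow> ?t k l)"
      using r by (simp add: h comult_apply[OF x] mult.assoc)
  qed
  also have "\<dots> = T.act x (ptensor f f') (p, q)" unfolding act_ptensor[OF f] by (simp add: sum.cartesian_product)
  finally show ?thesis by (simp add: h_def)
qed

end

section \<open>The tensor product of modules\<close>

definition frag_eval :: "('a \<Rightarrow> 'k::field) \<Rightarrow> ('a \<Rightarrow>\<^sub>0 int) \<Rightarrow> 'k" where
  "frag_eval h z = (\<Sum>v\<in>Poly_Mapping.keys z. of_int (poly_mapping.lookup z v) * h v)"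

lemma frag_eval_superset:
  assumes "finite S" "Poly_Mapping.keys z \<subseteq> S"
  shows "frag_eval h z = (\<Sum>v\<in>S. of_int (poly_mapping.lookup z v) * h v)"
  unfolding frag_eval_def using assms by (intro sum.mono_neutral_left) (auto simp: in_keys_iff)

lemma frag_eval_add: "frag_eval h (z + z') = frag_eval h z + frag_eval h z'"
proof -
  let ?S = "Poly_Mapping.keys z \<union> Poly_Mapping.keys z'"
  have "finite ?S" by simp
  moreover have "Poly_Mapping.keys (z + z') \<subseteq> ?S" by (rule keys_add)
  ultimately show ?thesis
    by (simp add: frag_eval_superset[of ?S] lookup_add distrib_right sum.distrib)
qed

lemma frag_eval_zero [simp]: "frag_eval h 0 = 0"
  by (simp add: frag_eval_def)

lemma frag_eval_uminus: "frag_eval h (- z) = - frag_eval h z"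
  using frag_eval_add[of h z "- z"] by (simp add: eq_neg_iff_add_eq_0 add.commute)

lemma frag_eval_diff: "frag_eval h (z - z') = frag_eval h z - frag_eval h z'"
  using frag_eval_add[of h z "- z'"] by (simp add: frag_eval_uminus)

lemma frag_eval_of [simp]: "frag_eval h (frag_of v) = h v"
  by (simp add: frag_eval_def keys_frag_of)

lemma frag_eval_sum: "finite S \<Longrightarrow> frag_eval h (\<Sum>s\<in>S. z s) = (\<Sum>s\<in>S. frag_eval h (z s))"
  by (induction S rule: finite_induct) (simp_all add: frag_eval_add)

text \<open>
  Modules \<open>V\<close> and \<open>W\<close> with coordinates \<open>\<phi>\<close> and \<open>\<psi>\<close>. The coordinates identify their tensor product,
  a quotient of a free abelian group, with the graded module on pairs of indices. Since any
  coordinates will do, this also shows that the tensor product respects isomorphism.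
\<close>

locale graded_pair_copy = graded_pair n d Kt I g N I' g' N'
  for n d and Kt :: "'k::field itself" and I :: "'i set" and g and N :: "('i \<Rightarrow> 'k) \<Rightarrow> 'i \<Rightarrow> 'k"
    and I' :: "'j set" and g' and N' :: "('j \<Rightarrow> 'k) \<Rightarrow> 'j \<Rightarrow> 'k" +
  fixes V :: "('k trunc_elt, 'v) module" and W :: "('k trunc_elt, 'w) module" and \<phi> \<psi>
  assumes V: "left_module A V" and W: "left_module A W"
    and \<phi>: "module_iso \<phi> A V S.M" and \<psi>: "module_iso \<psi> A W S'.M"
begin

sublocale V: left_mod A V using V by (simp add: left_module_iff)
sublocale W: left_mod A W using W by (simp add: left_module_iff)

abbreviation "VW \<equiv> carrier V \<times> carrier W"
abbreviation "F \<equiv> free_Abelian_group VW"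
abbreviation "Rel \<equiv> tensor_kernel n d V W"

definition \<Phi> :: "('v \<times> 'w \<Rightarrow>\<^sub>0 int) \<Rightarrow> 'i \<times> 'j \<Rightarrow> 'k" where
  "\<Phi> z = (\<lambda>(p, q). frag_eval (\<lambda>(v, w). \<phi> v p * \<psi> w q) z)"

lemma \<Phi>_add: "\<Phi> (z + z') = (\<lambda>p. \<Phi> z p + \<Phi> z' p)"
  and \<Phi>_diff: "\<Phi> (z - z') = (\<lambda>p. \<Phi> z p - \<Phi> z' p)"
  and \<Phi>_uminus: "\<Phi> (- z) = (\<lambda>p. - \<Phi> z p)"
  and \<Phi>_zero: "\<Phi> 0 = (\<lambda>p. 0)"
  and \<Phi>_of: "\<Phi> (frag_of (v, w)) = ptensor (\<phi> v) (\<psi> w)"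
  by (auto simp: \<Phi>_def frag_eval_add frag_eval_diff frag_eval_uminus ptensor_def)

lemma \<phi>_supported: "v \<in> carrier V \<Longrightarrow> \<phi> v \<in> supported I"
  using module_isoD(2)[OF \<phi>, of v] by simp

lemma \<psi>_supported: "w \<in> carrier W \<Longrightarrow> \<psi> w \<in> supported I'"
  using module_isoD(2)[OF \<psi>, of w] by simp

lemma \<phi>_smult: "x \<in> carrier P \<Longrightarrow> v \<in> carrier V \<Longrightarrow> \<phi> (tc x \<odot>\<^bsub>V\<^esub> v) = S.act x (\<phi> v)"
  using module_isoD(4)[OF \<phi>, of "tc x" v] by (simp add: S.M_smult)

lemma \<psi>_smult: "x \<in> carrier P \<Longrightarrow> w \<in> carrier W \<Longrightarrow> \<psi> (tc x \<odot>\<^bsub>W\<^esub> w) = S'.act x (\<psi> w)"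
  using module_isoD(4)[OF \<psi>, of "tc x" w] by (simp add: S'.M_smult)

lemma \<phi>_add: "v \<in> carrier V \<Longrightarrow> v' \<in> carrier V \<Longrightarrow> \<phi> (v \<oplus>\<^bsub>V\<^esub> v') = (\<lambda>p. \<phi> v p + \<phi> v' p)"
  using module_isoD(3)[OF \<phi>, of v v'] by simp

lemma \<psi>_add: "w \<in> carrier W \<Longrightarrow> w' \<in> carrier W \<Longrightarrow> \<psi> (w \<oplus>\<^bsub>W\<^esub> w') = (\<lambda>p. \<psi> w p + \<psi> w' p)"
  using module_isoD(3)[OF \<psi>, of w w'] by simp

lemma ptensor_supported: "f \<in> supported I \<Longrightarrow> f' \<in> supported I' \<Longrightarrow> ptensor f f' \<in> supported (I \<times> I')"
  by (auto simp: supported_def ptensor_def)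

lemma \<Phi>_supported: "Poly_Mapping.keys z \<subseteq> VW \<Longrightarrow> \<Phi> z \<in> supported (I \<times> I')"
proof (induction z rule: free_Abelian_group_induct[consumes 1])
  case 1 show ?case by (simp add: \<Phi>_zero supported_zero)
next
  case (2 x y)
  then show ?case by (auto simp: \<Phi>_diff supported_def) (metis diff_self)+
next
  case (3 a)
  then show ?case by (auto simp: \<Phi>_of ptensor_supported \<phi>_supported \<psi>_supported)
qed

definition sc :: "'k \<Rightarrow> 'k trunc_elt" where "sc c = tc (path_scale c (path_one n))"

lemma sc_closed: "sc c \<in> carrier A"
  by (simp add: sc_def path_one_closed)

lemma \<phi>_sc: "v \<in> carrier V \<Longrightarrow> \<phi> (sc c \<odot>\<^bsub>V\<^esub> v) = (\<lambda>p. c * \<phi> v p)"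
  by (simp add: sc_def \<phi>_smult path_one_closed S.act_scalar)

lemma \<psi>_sc: "w \<in> carrier W \<Longrightarrow> \<psi> (sc c \<odot>\<^bsub>W\<^esub> w) = (\<lambda>p. c * \<psi> w p)"
  by (simp add: sc_def \<psi>_smult path_one_closed S'.act_scalar)

lemma relations_carrier: "tensor_relations n d V W \<subseteq> carrier F"
proof -
  have k: "Poly_Mapping.keys (frag_of a - frag_of b - frag_of c) \<subseteq> {a, b, c}" for a b c :: "'v \<times> 'w"
    using keys_diff[of "frag_of a - frag_of b" "frag_of c"] keys_diff[of "frag_of a" "frag_of b"]
    by (auto simp: keys_frag_of)
  have k2: "Poly_Mapping.keys (frag_of a - frag_of b) \<subseteq> {a, b}" for a b :: "'v \<times> 'w"
    using keys_diff[of "frag_of a" "frag_of b"] by (auto simp: keys_frag_of)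
  have "sc c \<odot>\<^bsub>V\<^esub> v \<in> carrier V" "sc c \<odot>\<^bsub>W\<^esub> w \<in> carrier W" if "v \<in> carrier V" "w \<in> carrier W" for c v w
    using that sc_closed by auto
  then show ?thesis unfolding tensor_relations_def sc_def[symmetric]
    by (auto intro!: order_trans[OF k] order_trans[OF k2])
qed

lemma Rel_subgroup: "subgroup Rel F"
  unfolding tensor_kernel_def by (intro group.generate_is_subgroup group_free_Abelian_group relations_carrier)

lemma Rel_carrier: "z \<in> Rel \<Longrightarrow> Poly_Mapping.keys z \<subseteq> VW"
  using subsetD[OF subgroup.subset[OF Rel_subgroup], of z] by simp

lemma Rel_zero: "0 \<in> Rel"
  using subgroup.one_closed[OF Rel_subgroup] by simp

lemma Rel_add: "y \<in> Rel \<Longrightarrow> z \<in> Rel \<Longrightarrow> y + z \<in> Rel"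
  using subgroup.m_closed[OF Rel_subgroup] by simp

lemma Rel_uminus: "z \<in> Rel \<Longrightarrow> - z \<in> Rel"
  using subgroup.m_inv_closed[OF Rel_subgroup, of z] Rel_carrier[of z] by simp

lemma Rel_diff: "y \<in> Rel \<Longrightarrow> z \<in> Rel \<Longrightarrow> y - z \<in> Rel"
  using Rel_add[of y "- z"] Rel_uminus[of z] by simp

lemma Rel_left: "v \<in> carrier V \<Longrightarrow> v' \<in> carrier V \<Longrightarrow> w \<in> carrier W \<Longrightarrow>
    frag_of (v \<oplus>\<^bsub>V\<^esub> v', w) - frag_of (v, w) - frag_of (v', w) \<in> Rel"
  unfolding tensor_kernel_def tensor_relations_def by (rule generate.incl) blast

lemma Rel_right: "v \<in> carrier V \<Longrightarrow> w \<in> carrier W \<Longrightarrow> w' \<in> carrier W \<Longrightarrow>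
    frag_of (v, w \<oplus>\<^bsub>W\<^esub> w') - frag_of (v, w) - frag_of (v, w') \<in> Rel"
  unfolding tensor_kernel_def tensor_relations_def by (rule generate.incl) blast

lemma Rel_scalar: "v \<in> carrier V \<Longrightarrow> w \<in> carrier W \<Longrightarrow>
    frag_of (sc c \<odot>\<^bsub>V\<^esub> v, w) - frag_of (v, sc c \<odot>\<^bsub>W\<^esub> w) \<in> Rel"
  unfolding tensor_kernel_def tensor_relations_def sc_def by (rule generate.incl) blast

lemma \<Phi>_Rel: "z \<in> Rel \<Longrightarrow> \<Phi> z = (\<lambda>p. 0)"
proof -
  have rel: "\<Phi> h = (\<lambda>p. 0)" if "h \<in> tensor_relations n d V W" for h
    using that unfolding tensor_relations_def sc_def[symmetric]
    by (auto simp: \<Phi>_diff \<Phi>_of ptensor_def \<phi>_add \<psi>_add \<phi>_sc \<psi>_sc distrib_left distrib_right mult_ac fun_eq_iff)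
  show "\<Phi> z = (\<lambda>p. 0)" if "z \<in> Rel"
    using that unfolding tensor_kernel_def
  proof (induction rule: generate.induct)
    case one show ?case by (simp add: \<Phi>_zero)
  next
    case (incl h) then show ?case by (rule rel)
  next
    case (inv h)
    then have "h \<in> carrier F" using relations_carrier by (rule subsetD[rotated])
    then have "Poly_Mapping.keys h \<subseteq> VW" by simp
    then show ?case using rel[OF inv] by (simp add: \<Phi>_uminus)
  next
    case (eng h1 h2) then show ?case by (simp add: \<Phi>_add)
  qed
qed

text \<open>
  The basis vectors of \<open>W\<close>.
\<close>

definition e :: "'j \<Rightarrow> 'w" where "e q = the_inv_into (carrier W) \<psi> (delta q)"

lemma \<psi>_inj: "inj_on \<psi> (carrier W)" using module_isoD(1)[OF \<psi>] by (simp add: bij_betw_def)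
lemma \<phi>_inj: "inj_on \<phi> (carrier V)" using module_isoD(1)[OF \<phi>] by (simp add: bij_betw_def)
lemma \<psi>_surj: "\<psi> ` carrier W = supported I'" using module_isoD(1)[OF \<psi>] by (simp add: bij_betw_def)
lemma \<phi>_surj: "\<phi> ` carrier V = supported I" using module_isoD(1)[OF \<phi>] by (simp add: bij_betw_def)

lemma e: "q \<in> I' \<Longrightarrow> e q \<in> carrier W" "q \<in> I' \<Longrightarrow> \<psi> (e q) = delta q"
  unfolding e_def using S'.delta_supported[of q] \<psi>_surj
  by (auto intro: the_inv_into_into[OF \<psi>_inj] f_the_inv_into_f[OF \<psi>_inj])

lemma \<phi>_zero: "\<phi> \<zero>\<^bsub>V\<^esub> = (\<lambda>p. 0)"
  using module_iso_zero[OF V S.M_left_module \<phi>] by simp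

lemma \<psi>_zero: "\<psi> \<zero>\<^bsub>W\<^esub> = (\<lambda>p. 0)"
  using module_iso_zero[OF W S'.M_left_module \<psi>] by simp

lemma Rel_zero_left: "w \<in> carrier W \<Longrightarrow> frag_of (\<zero>\<^bsub>V\<^esub>, w) \<in> Rel"
  using Rel_uminus[OF Rel_left[of "\<zero>\<^bsub>V\<^esub>" "\<zero>\<^bsub>V\<^esub>" w]] by simp

lemma Rel_zero_right: "v \<in> carrier V \<Longrightarrow> frag_of (v, \<zero>\<^bsub>W\<^esub>) \<in> Rel"
  using Rel_uminus[OF Rel_right[of v "\<zero>\<^bsub>W\<^esub>" "\<zero>\<^bsub>W\<^esub>"]] by simp

text \<open>
  Modulo the relations every element has the form \<open>\<Sum> v\<^sub>q \<otimes> e\<^sub>q\<close>. The coefficients \<open>v\<^sub>q\<close> can be read off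
  from \<open>\<Phi>\<close>, which determines the kernel of \<open>\<Phi>\<close>.
\<close>

definition expandable :: "('v \<times> 'w \<Rightarrow>\<^sub>0 int) \<Rightarrow> bool" where
  "expandable z \<longleftrightarrow> (\<exists>v. (\<forall>q\<in>I'. v q \<in> carrier V) \<and> z - (\<Sum>q\<in>I'. frag_of (v q, e q)) \<in> Rel)"

lemma Rel_sum: "finite S \<Longrightarrow> (\<And>s. s \<in> S \<Longrightarrow> z s \<in> Rel) \<Longrightarrow> sum z S \<in> Rel"
  by (induction S rule: finite_induct) (auto simp: Rel_zero Rel_add)

lemma expandable_zero: "expandable 0"
proof -
  have "- (\<Sum>q\<in>I'. frag_of (\<zero>\<^bsub>V\<^esub>, e q)) \<in> Rel"
    using S'.fin e by (intro Rel_uminus Rel_sum Rel_zero_left) auto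
  then show ?thesis unfolding expandable_def by (intro exI[of _ "\<lambda>q. \<zero>\<^bsub>V\<^esub>"]) auto
qed

lemma expandable_add:
  assumes "expandable y" "expandable z" shows "expandable (y + z)"
proof -
  obtain v where v: "\<forall>q\<in>I'. v q \<in> carrier V" "y - (\<Sum>q\<in>I'. frag_of (v q, e q)) \<in> Rel"
    using assms(1) by (auto simp: expandable_def)
  obtain v' where v': "\<forall>q\<in>I'. v' q \<in> carrier V" "z - (\<Sum>q\<in>I'. frag_of (v' q, e q)) \<in> Rel"
    using assms(2) by (auto simp: expandable_def)
  have "(\<Sum>q\<in>I'. frag_of (v q \<oplus>\<^bsub>V\<^esub> v' q, e q) - frag_of (v q, e q) - frag_of (v' q, e q)) \<in> Rel"
    using S'.fin v v' e by (intro Rel_sum Rel_left) auto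
  from Rel_diff[OF Rel_add[OF v(2) v'(2)] this]
  have "y + z - (\<Sum>q\<in>I'. frag_of (v q \<oplus>\<^bsub>V\<^esub> v' q, e q)) \<in> Rel"
    unfolding sum_subtractf by (simp add: algebra_simps)
  then show ?thesis unfolding expandable_def using v v' by (intro exI[of _ "\<lambda>q. v q \<oplus>\<^bsub>V\<^esub> v' q"]) auto
qed

lemma expandable_uminus:
  assumes "expandable z" shows "expandable (- z)"
proof -
  obtain v where v: "\<forall>q\<in>I'. v q \<in> carrier V" "z - (\<Sum>q\<in>I'. frag_of (v q, e q)) \<in> Rel"
    using assms(1) by (auto simp: expandable_def)
  have "frag_of (v q, e q) + frag_of (\<ominus>\<^bsub>V\<^esub> v q, e q) \<in> Rel" if q: "q \<in> I'" for q
  proof -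
    have vq: "v q \<in> carrier V" using v q by auto
    have "frag_of (\<zero>\<^bsub>V\<^esub>, e q) - frag_of (v q, e q) - frag_of (\<ominus>\<^bsub>V\<^esub> v q, e q) \<in> Rel"
      using Rel_left[of "v q" "\<ominus>\<^bsub>V\<^esub> v q" "e q"] vq e[OF q] by (simp add: V.M.r_neg)
    from Rel_diff[OF Rel_zero_left[OF e(1)[OF q]] this] show ?thesis by (simp add: algebra_simps)
  qed
  then have "(\<Sum>q\<in>I'. frag_of (v q, e q) + frag_of (\<ominus>\<^bsub>V\<^esub> v q, e q)) \<in> Rel"
    using S'.fin by (intro Rel_sum)
  from Rel_uminus[OF Rel_add[OF v(2) this]]
  have "- z - (\<Sum>q\<in>I'. frag_of (\<ominus>\<^bsub>V\<^esub> v q, e q)) \<in> Rel"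
    by (simp add: sum.distrib algebra_simps)
  then show ?thesis unfolding expandable_def using v by (intro exI[of _ "\<lambda>q. \<ominus>\<^bsub>V\<^esub> v q"]) auto
qed

lemma expandable_cong: "expandable z \<Longrightarrow> y - z \<in> Rel \<Longrightarrow> expandable y"
  unfolding expandable_def
proof (elim exE conjE)
  fix v assume yz: "y - z \<in> Rel" and v: "\<forall>q\<in>I'. v q \<in> carrier V" "z - (\<Sum>q\<in>I'. frag_of (v q, e q)) \<in> Rel"
  have "y - (\<Sum>q\<in>I'. frag_of (v q, e q)) \<in> Rel" using Rel_add[OF yz v(2)] by simp
  then show "\<exists>v. (\<forall>q\<in>I'. v q \<in> carrier V) \<and> y - (\<Sum>q\<in>I'. frag_of (v q, e q)) \<in> Rel" using v by blast
qed

lemma expandable_basis: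
  assumes "v \<in> carrier V" "p \<in> I'"
  shows "expandable (frag_of (v, e p))"
proof -
  have "(\<Sum>q\<in>I'. frag_of (if q = p then v else \<zero>\<^bsub>V\<^esub>, e q))
      = frag_of (v, e p) + (\<Sum>q\<in>I' - {p}. frag_of (\<zero>\<^bsub>V\<^esub>, e q))"
    using S'.fin assms(2) by (subst sum.remove[of _ p]) (auto intro!: sum.cong)
  moreover have "- (\<Sum>q\<in>I' - {p}. frag_of (\<zero>\<^bsub>V\<^esub>, e q)) \<in> Rel"
    using S'.fin e by (intro Rel_uminus Rel_sum Rel_zero_left) auto
  ultimately show ?thesis unfolding expandable_def using assms
    by (intro exI[of _ "\<lambda>q. if q = p then v else \<zero>\<^bsub>V\<^esub>"]) auto
qed

text \<open>
  Decomposing \<open>w\<close> along the basis, a multiple \<open>c e\<^sub>p\<close> is absorbed through \<open>v \<otimes> c e\<^sub>p = c v \<otimes> e\<^sub>p\<close>.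
\<close>

lemma expandable_of:
  assumes v: "v \<in> carrier V" and w: "w \<in> carrier W"
  shows "expandable (frag_of (v, w))"
proof -
  have "f' \<in> supported I' \<Longrightarrow> \<forall>w\<in>carrier W. \<psi> w = f' \<longrightarrow> expandable (frag_of (v, w))" for f'
    using S'.fin
  proof (induction rule: supported_induct)
    case zero
    show ?case
    proof (intro ballI impI)
      fix w assume "w \<in> carrier W" "\<psi> w = (\<lambda>p. 0)"
      then have "w = \<zero>\<^bsub>W\<^esub>" using \<psi>_zero inj_onD[OF \<psi>_inj, of w "\<zero>\<^bsub>W\<^esub>"] by simp
      then show "expandable (frag_of (v, w))"
        using expandable_cong[OF expandable_zero, of "frag_of (v, w)"] Rel_zero_right[OF v] by simp
    qed
  next
    case (step h c p)
    show ?case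
    proof (intro ballI impI)
      fix w assume w: "w \<in> carrier W" "\<psi> w = (\<lambda>q. c * delta p q + h q)"
      obtain w' where w': "w' \<in> carrier W" "\<psi> w' = h" using \<psi>_surj step by (metis imageE)
      have ep: "e p \<in> carrier W" "sc c \<odot>\<^bsub>W\<^esub> e p \<in> carrier W" using e step sc_closed by auto
      have "\<psi> (sc c \<odot>\<^bsub>W\<^esub> e p \<oplus>\<^bsub>W\<^esub> w') = \<psi> w" using w w' ep e step by (simp add: \<psi>_add \<psi>_sc)
      then have weq: "w = sc c \<odot>\<^bsub>W\<^esub> e p \<oplus>\<^bsub>W\<^esub> w'" using w w' ep by (intro inj_onD[OF \<psi>_inj]) auto
      have scv: "sc c \<odot>\<^bsub>V\<^esub> v \<in> carrier V" using v sc_closed by auto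
      have "expandable (frag_of (sc c \<odot>\<^bsub>V\<^esub> v, e p) + frag_of (v, w'))"
        using step w' scv by (intro expandable_add expandable_basis) auto
      moreover have "frag_of (v, w) - (frag_of (sc c \<odot>\<^bsub>V\<^esub> v, e p) + frag_of (v, w')) \<in> Rel"
        using Rel_diff[OF Rel_right[OF v ep(2) w'(1)] Rel_scalar[OF v ep(1), of c]]
        by (simp add: weq algebra_simps)
      ultimately show "expandable (frag_of (v, w))" by (rule expandable_cong)
    qed
  qed
  then show ?thesis using w \<psi>_supported by blast
qed

lemma expandable_all: "Poly_Mapping.keys z \<subseteq> VW \<Longrightarrow> expandable z"
proof (induction z rule: free_Abelian_group_induct[consumes 1])
  case (2 x y)
  then show ?case using expandable_add[of x "- y"] expandable_uminus[of y] by simp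
qed (auto simp: expandable_zero expandable_of)

lemma \<Phi>_kernel:
  assumes z: "Poly_Mapping.keys z \<subseteq> VW" and 0: "\<Phi> z = (\<lambda>p. 0)"
  shows "z \<in> Rel"
proof -
  obtain v where v: "\<forall>q\<in>I'. v q \<in> carrier V" and R: "z - (\<Sum>q\<in>I'. frag_of (v q, e q)) \<in> Rel"
    using expandable_all[OF z] by (auto simp: expandable_def)
  have \<Phi>s: "\<Phi> (\<Sum>q\<in>J. frag_of (v q, e q)) = (\<lambda>r. \<Sum>q\<in>J. ptensor (\<phi> (v q)) (\<psi> (e q)) r)" if "finite J" for J
    using that by (induction J rule: finite_induct) (auto simp: \<Phi>_zero \<Phi>_add \<Phi>_of)
  have "(\<Sum>q\<in>I'. ptensor (\<phi> (v q)) (\<psi> (e q)) r) = 0" for r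
    using fun_cong[OF \<Phi>_Rel[OF R], of r] by (simp add: \<Phi>_diff 0 \<Phi>s[OF S'.fin])
  moreover have "(\<Sum>q\<in>I'. ptensor (\<phi> (v q)) (\<psi> (e q)) (p, q')) = \<phi> (v q') p" if "q' \<in> I'" for p q'
  proof -
    have "(\<Sum>q\<in>I'. ptensor (\<phi> (v q)) (\<psi> (e q)) (p, q')) = (\<Sum>q\<in>I'. if q = q' then \<phi> (v q) p else 0)"
      by (intro sum.cong) (auto simp: ptensor_def e delta_def)
    then show ?thesis using that S'.fin by simp
  qed
  ultimately have "\<phi> (v q) = (\<lambda>p. 0)" if "q \<in> I'" for q using that by auto
  then have "v q = \<zero>\<^bsub>V\<^esub>" if "q \<in> I'" for q
    using that v \<phi>_zero by (intro inj_onD[OF \<phi>_inj]) auto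
  then have "(\<Sum>q\<in>I'. frag_of (v q, e q)) \<in> Rel"
    using S'.fin e by (intro Rel_sum) (auto intro: Rel_zero_left)
  from Rel_add[OF R this] show ?thesis by simp
qed

lemma \<Phi>_surj:
  assumes "G \<in> supported (I \<times> I')"
  shows "\<exists>z. Poly_Mapping.keys z \<subseteq> VW \<and> \<Phi> z = G"
  using T0.fin assms
proof (induction rule: supported_induct)
  case zero show ?case by (intro exI[of _ 0]) (simp add: \<Phi>_zero)
next
  case (step h c pq)
  obtain p q where pq: "pq = (p, q)" "p \<in> I" "q \<in> I'" using step by auto
  obtain z where z: "Poly_Mapping.keys z \<subseteq> VW" "\<Phi> z = h" using step by auto
  have "(\<lambda>r. c * delta p r) \<in> supported I" using pq by (auto simp: supported_def delta_def)
  then obtain v where v: "v \<in> carrier V" "\<phi> v = (\<lambda>r. c * delta p r)" using \<phi>_surj by (metis imageE)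
  have "\<Phi> (frag_of (v, e q) + z) = (\<lambda>r. c * delta pq r + h r)"
    using pq v z by (auto simp: \<Phi>_add \<Phi>_of ptensor_def e delta_def fun_eq_iff)
  moreover have "Poly_Mapping.keys (frag_of (v, e q) + z) \<subseteq> VW"
    using z v e pq keys_add[of "frag_of (v, e q)" z] by (auto simp: keys_frag_of)
  ultimately show ?case by blast
qed

text \<open>
  On generators this is \<open>comult_action\<close>; both sides are additive.
\<close>

lemma tensor_act:
  assumes x: "x \<in> carrier P" and z: "Poly_Mapping.keys z \<subseteq> VW"
  shows "Poly_Mapping.keys (tensor_act n d V W x z) \<subseteq> VW \<and> \<Phi> (tensor_act n d V W x z) = T.act x (\<Phi> z)"
  using z
proof (induction z rule: free_Abelian_group_induct[consumes 1])
  case 1 show ?case by (simp add: tensor_act_def \<Phi>_zero T.act_zero)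
next
  case (2 y z)
  have eq: "tensor_act n d V W x (y - z) = tensor_act n d V W x y - tensor_act n d V W x z"
    by (simp add: tensor_act_def frag_extend_diff)
  have "T.act x (\<lambda>p. \<Phi> y p - \<Phi> z p) = (\<lambda>p. T.act x (\<Phi> y) p - T.act x (\<Phi> z) p)"
    using T.act_add[of x "\<Phi> y" "\<lambda>p. - 1 * \<Phi> z p"] T.act_scale[of x "- 1" "\<Phi> z"] by simp
  then show ?case unfolding eq \<Phi>_diff using 2 keys_diff by fastforce
next
  case (3 vw)
  obtain v w where vw: "vw = (v, w)" "v \<in> carrier V" "w \<in> carrier W" using 3 by auto
  let ?s = "{(p, q). comult n x p q \<noteq> 0}"
  let ?t = "\<lambda>((i, k), (j, l)). (tc (path_scale (comult n x (i, k) (j, l)) (path i k)) \<odot>\<^bsub>V\<^esub> v, tc (path j l) \<odot>\<^bsub>W\<^esub> w)"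
  have fin: "finite ?s" by (rule finite_comult_support[OF x])
  have eq: "tensor_act n d V W x (frag_of vw) = (\<Sum>r\<in>?s. frag_of (?t r))"
    by (simp add: tensor_act_def vw case_prod_unfold)
  have lt: "i < n \<and> j < n" if "((i, k), (j, l)) \<in> ?s" for i k j l
    using that by (auto simp: comult_apply[OF x] split: if_splits)
  have t: "?t r \<in> VW" "\<Phi> (frag_of (?t r)) (p, q) = (case r of ((i, k), (j, l)) \<Rightarrow>
      S.act (path_scale (comult n x (i, k) (j, l)) (path i k)) (\<phi> v) p * S'.act (path j l) (\<psi> w) q)"
    if "r \<in> ?s" for r p q
  proof -
    obtain i k j l where r: "r = ((i, k), (j, l))" by (metis surj_pair)
    have "i < n" "j < n" using lt that r by blast+
    then show "?t r \<in> VW" "\<Phi> (frag_of (?t r)) (p, q) = (case r of ((i, k), (j, l)) \<Rightarrow>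
      S.act (path_scale (comult n x (i, k) (j, l)) (path i k)) (\<phi> v) p * S'.act (path j l) (\<psi> w) q)"
      using vw by (simp_all add: r \<Phi>_of ptensor_def \<phi>_smult \<psi>_smult)
  qed
  have "Poly_Mapping.keys (\<Sum>r\<in>J. frag_of (?t r)) \<subseteq> VW" if "finite J" "J \<subseteq> ?s" for J
    using that
  proof (induction J rule: finite_induct)
    case (insert r J)
    then show ?case using t(1)[of r] keys_add[of "frag_of (?t r)" "\<Sum>r\<in>J. frag_of (?t r)"] by (auto simp: keys_frag_of)
  qed simp
  then have k: "Poly_Mapping.keys (tensor_act n d V W x (frag_of vw)) \<subseteq> VW" unfolding eq using fin by blast
  have "\<Phi> (\<Sum>r\<in>?s. frag_of (?t r)) (p, q) = T.act x (\<Phi> (frag_of vw)) (p, q)" for p q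
  proof -
    have "\<Phi> (\<Sum>r\<in>?s. frag_of (?t r)) (p, q) = (\<Sum>r\<in>?s. \<Phi> (frag_of (?t r)) (p, q))"
      unfolding \<Phi>_def prod.case by (rule frag_eval_sum[OF fin])
    also have "\<dots> = (\<Sum>((i, k), (j, l))\<in>?s.
      S.act (path_scale (comult n x (i, k) (j, l)) (path i k)) (\<phi> v) p * S'.act (path j l) (\<psi> w) q)"
    proof (rule sum.cong[OF refl])
      fix r assume r: "r \<in> ?s"
      show "\<Phi> (frag_of (?t r)) (p, q) = (\<lambda>((i, k), (j, l)).
        S.act (path_scale (comult n x (i, k) (j, l)) (path i k)) (\<phi> v) p * S'.act (path j l) (\<psi> w) q) r"
        using t(2)[OF r, of p q] by (simp add: case_prod_unfold)
    qed
    also have "\<dots> = T.act x (ptensor (\<phi> v) (\<psi> w)) (p, q)"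
      using vw by (intro comult_action x \<phi>_supported \<psi>_supported)
    finally show ?thesis by (simp add: vw \<Phi>_of)
  qed
  then show ?case using k unfolding eq by auto
qed

text \<open>
  The fibres of \<open>\<Phi>\<close> are the cosets of the relations. Sending a vector to its fibre is an isomorphism
  that involves no choice of representatives, and it starts at a module.
\<close>

definition fibre :: "('i \<times> 'j \<Rightarrow> 'k) \<Rightarrow> ('v \<times> 'w \<Rightarrow>\<^sub>0 int) set" where
  "fibre G = {z. Poly_Mapping.keys z \<subseteq> VW \<and> \<Phi> z = G}"

lemma fibre_coset:
  assumes z: "Poly_Mapping.keys z \<subseteq> VW"
  shows "Rel #>\<^bsub>F\<^esub> z = fibre (\<Phi> z)"
proof (intro equalityI subsetI)
  fix y assume "y \<in> Rel #>\<^bsub>F\<^esub> z"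
  then obtain r where r: "r \<in> Rel" "y = r + z" by (auto simp: r_coset_def)
  then show "y \<in> fibre (\<Phi> z)"
    using z Rel_carrier[OF r(1)] keys_add[of r z] \<Phi>_Rel[OF r(1)] by (auto simp: fibre_def \<Phi>_add)
next
  fix y assume y: "y \<in> fibre (\<Phi> z)"
  have "y - z \<in> Rel"
    using y z keys_diff[of y z] by (intro \<Phi>_kernel) (auto simp: fibre_def \<Phi>_diff)
  then show "y \<in> Rel #>\<^bsub>F\<^esub> z" by (force simp: r_coset_def)
qed

lemma fibre_iso: "module_iso fibre A (graded_module n d (I \<times> I') gT NT) (tensor_module n d V W)"
proof -
  let ?T = "tensor_module n d V W"
  have carr: "carrier ?T = {fibre G | G. G \<in> supported (I \<times> I')}"
  proof (intro equalityI subsetI)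
    fix C assume "C \<in> carrier ?T"
    then obtain z where z: "z \<in> carrier F" "C = Rel #>\<^bsub>F\<^esub> z"
      by (auto simp: tensor_module_def Let_def RCOSETS_def)
    then have "Poly_Mapping.keys z \<subseteq> VW" by simp
    then show "C \<in> {fibre G | G. G \<in> supported (I \<times> I')}" using z(2) fibre_coset \<Phi>_supported by blast
  next
    fix C assume "C \<in> {fibre G | G. G \<in> supported (I \<times> I')}"
    then obtain G where G: "C = fibre G" "G \<in> supported (I \<times> I')" by blast
    obtain z where z: "Poly_Mapping.keys z \<subseteq> VW" "\<Phi> z = G" using \<Phi>_surj[OF G(2)] by blast
    then have "C = Rel #>\<^bsub>F\<^esub> z" using fibre_coset G by simp
    moreover have "z \<in> carrier F" using z by simp
    ultimately show "C \<in> carrier ?T" unfolding tensor_module_def Let_def RCOSETS_def by auto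
  qed
  have ne: "fibre G \<noteq> {}" if "G \<in> supported (I \<times> I')" for G using \<Phi>_surj[OF that] by (auto simp: fibre_def)
  show ?thesis unfolding module_iso_def
  proof (intro conjI ballI)
    have "inj_on fibre (supported (I \<times> I'))"
    proof (rule inj_onI)
      fix G H assume "G \<in> supported (I \<times> I')" and eq: "fibre G = fibre H"
      then obtain z where "z \<in> fibre G" using ne by blast
      moreover from this have "z \<in> fibre H" using eq by simp
      ultimately show "G = H" unfolding fibre_def by auto
    qed
    then show "bij_betw fibre (carrier T.M) (carrier ?T)"
      by (auto simp: bij_betw_def carr)
  next
    fix G H assume "G \<in> carrier T.M" "H \<in> carrier T.M"
    then have GH: "G \<in> supported (I \<times> I')" "H \<in> supported (I \<times> I')" by simp_all
    obtain z where z: "Poly_Mapping.keys z \<subseteq> VW" "\<Phi> z = H" using \<Phi>_surj[OF GH(2)] by blast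
    have "fibre (\<lambda>p. G p + H p) = (\<Union>y\<in>fibre G. \<Union>z\<in>fibre H. {y + z})"
    proof (intro equalityI subsetI)
      fix y assume y: "y \<in> fibre (\<lambda>p. G p + H p)"
      have "y - z \<in> fibre G" using y z keys_diff[of y z] by (auto simp: fibre_def \<Phi>_diff)
      moreover have "z \<in> fibre H" using z by (simp add: fibre_def)
      moreover have "y = (y - z) + z" by simp
      ultimately show "y \<in> (\<Union>y\<in>fibre G. \<Union>z\<in>fibre H. {y + z})" by blast
    next
      fix y assume "y \<in> (\<Union>y\<in>fibre G. \<Union>z\<in>fibre H. {y + z})"
      then obtain u v where uv: "u \<in> fibre G" "v \<in> fibre H" "y = u + v" by blast
      then show "y \<in> fibre (\<lambda>p. G p + H p)" using keys_add[of u v] by (auto simp: fibre_def \<Phi>_add)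
    qed
    then show "fibre (G \<oplus>\<^bsub>T.M\<^esub> H) = fibre G \<oplus>\<^bsub>?T\<^esub> fibre H"
      by (simp add: tensor_module_def Let_def set_mult_def)
  next
    fix a G assume a: "a \<in> carrier A" and "G \<in> carrier T.M"
    then have G: "G \<in> supported (I \<times> I')" by simp
    obtain x where x: "x \<in> carrier P" "a = tc x" using a by (rule carrier_A_E)
    \<comment> \<open>All representatives of \<open>a\<close> and of the coset give the same fibre, so the union that defines
      scalar multiplication is one coset.\<close>
    have "Rel #>\<^bsub>F\<^esub> tensor_act n d V W y z = fibre (T.act x G)" if "y \<in> a" "z \<in> fibre G" for y z
    proof -
      have y: "y \<in> carrier P" "\<forall>i l. l < d \<longrightarrow> y i l = x i l" using that x mem_tc_iff[OF x(1)] by auto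
      have "T.act y G = T.act x G" using y by (intro T.act_cong) auto
      then show ?thesis using tensor_act[OF y(1), of z] that by (subst fibre_coset) (auto simp: fibre_def)
    qed
    moreover have "a \<noteq> {}" using x mem_tc_iff[OF x(1), of x] by auto
    ultimately have "(\<Union>y\<in>a. \<Union>z\<in>fibre G. Rel #>\<^bsub>F\<^esub> tensor_act n d V W y z) = fibre (T.act x G)"
      using ne[OF G] by auto
    then show "fibre (a \<odot>\<^bsub>T.M\<^esub> G) = a \<odot>\<^bsub>?T\<^esub> fibre G"
      using x by (simp add: T.M_smult) (simp add: tensor_module_def Let_def)
  qed
qed

end

section \<open>The modules \<open>M(i, j)\<close>\<close>

locale nakayama_vertex = nakayama n d Kt for n d and Kt :: "'k::field itself" +
  fixes j :: nat
  assumes j: "j < n"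
begin

text \<open>
  The elements of \<open>P\<^sub>j = H v\<^sub>j\<close> are the combinations of paths that start at \<open>j\<close>.
\<close>

definition elem :: "(nat \<Rightarrow> 'k) \<Rightarrow> 'k trunc_elt" where
  "elem f = tc (\<lambda>i l. if i = j \<and> l < d then f l else 0)"

text \<open>
  The coefficients of the product of \<open>y\<close> with a combination of paths that start at \<open>j\<close>.
\<close>

definition shift_coeffs :: "'k path_elt \<Rightarrow> (nat \<Rightarrow> 'k) \<Rightarrow> nat \<Rightarrow> 'k" where
  "shift_coeffs y f = (\<lambda>l. \<Sum>u\<le>l. y ((j + u) mod n) (l - u) * f u)"

abbreviation Pj :: "('k trunc_elt, 'k trunc_elt) module" where "Pj \<equiv> proj_module n d j"

text \<open>
  The span of the paths of length at least \<open>k\<close>; it is the \<open>k\<close>-th radical power (\<open>radical_power_U\<close>).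
\<close>

definition U :: "nat \<Rightarrow> 'k trunc_elt set" where
  "U k = {elem f | f. \<forall>l<k. f l = 0}"

lemma elem_coeffs_closed: "(\<lambda>i l. if i = j \<and> l < d then f l else 0) \<in> carrier P"
  using j by (intro path_carrierI[where b=d]) (auto split: if_splits)

lemma elem_closed: "elem f \<in> carrier A"
  by (simp add: elem_def elem_coeffs_closed)

lemma elem_eq_iff: "elem f = elem f' \<longleftrightarrow> (\<forall>l<d. f l = f' l)"
  unfolding elem_def tc_eq_iff[OF elem_coeffs_closed elem_coeffs_closed] by auto

lemma elem_add: "elem f \<oplus>\<^bsub>A\<^esub> elem f' = elem (\<lambda>l. f l + f' l)"
  unfolding elem_def tc_add[OF elem_coeffs_closed elem_coeffs_closed]
  by (rule arg_cong[of _ _ tc]) (auto simp: fun_eq_iff)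

lemma elem_zero: "elem (\<lambda>l. 0) = \<zero>\<^bsub>A\<^esub>"
  by (simp add: elem_def tc_zero)

lemma elem_mult:
  assumes y: "y \<in> carrier P"
  shows "tc y \<otimes>\<^bsub>A\<^esub> elem f = elem (shift_coeffs y f)"
  unfolding elem_def tc_mult[OF y elem_coeffs_closed]
    tc_eq_iff[OF path_mult_closed[OF n_pos y elem_coeffs_closed] elem_coeffs_closed]
  by (auto simp: path_mult_def shift_coeffs_def intro!: sum.cong)

lemma Pj_simps [simp]:
  "\<zero>\<^bsub>Pj\<^esub> = \<zero>\<^bsub>A\<^esub>" "x \<oplus>\<^bsub>Pj\<^esub> y = x \<oplus>\<^bsub>A\<^esub> y" "a \<odot>\<^bsub>Pj\<^esub> x = a \<otimes>\<^bsub>A\<^esub> x"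
  by (simp_all add: proj_module_def principal_module_def)

lemma elem_path: "elem f = elem f \<otimes>\<^bsub>A\<^esub> tc (path j 0)"
proof -
  have p: "path j 0 \<in> carrier P" using j by simp
  show ?thesis
    unfolding elem_def tc_mult[OF elem_coeffs_closed p]
      tc_eq_iff[OF elem_coeffs_closed path_mult_closed[OF n_pos elem_coeffs_closed p]]
    using j by (auto simp: path_mult_path_right)
qed

lemma Pj_carrier: "carrier Pj = U 0"
proof -
  have "\<exists>f. a \<otimes>\<^bsub>A\<^esub> tc (path j 0) = elem f" if a: "a \<in> carrier A" for a
  proof -
    obtain x where x: "x \<in> carrier P" "a = tc x" using a by (rule carrier_A_E)
    have p: "path j 0 \<in> carrier P" using j by simp
    have "a \<otimes>\<^bsub>A\<^esub> tc (path j 0) = elem (\<lambda>l. x j l)"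
      unfolding x(2) elem_def tc_mult[OF x(1) p]
        tc_eq_iff[OF path_mult_closed[OF n_pos x(1) p] elem_coeffs_closed]
      using j by (auto simp: path_mult_path_right)
    then show ?thesis by blast
  qed
  moreover have "\<exists>a. elem f = a \<otimes>\<^bsub>A\<^esub> tc (path j 0) \<and> a \<in> carrier A" for f
    using elem_path[of f] elem_closed[of f] by blast
  ultimately show ?thesis unfolding U_def proj_module_def principal_module_def by auto
qed

lemma mem_U_iff: "k \<le> d \<Longrightarrow> elem f \<in> U k \<longleftrightarrow> (\<forall>l<k. f l = 0)"
  unfolding U_def by (auto simp: elem_eq_iff)

lemma U_E:
  assumes "x \<in> U k" obtains f where "x = elem f" "\<forall>l<k. f l = 0"
  using assms by (auto simp: U_def)

lemma U_I: "(\<And>l. l < k \<Longrightarrow> f l = 0) \<Longrightarrow> elem f \<in> U k"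
  by (auto simp: U_def)

lemma U_mono: "k \<le> k' \<Longrightarrow> U k' \<subseteq> U k"
  by (fastforce simp: U_def)

lemma U_add: "x \<in> U k \<Longrightarrow> y \<in> U k \<Longrightarrow> x \<oplus>\<^bsub>A\<^esub> y \<in> U k"
  by (auto elim!: U_E simp: elem_add intro!: U_I)

lemma U_zero: "\<zero>\<^bsub>A\<^esub> \<in> U k"
  unfolding elem_zero[symmetric] by (rule U_I) simp

lemma U_smult: "a \<in> carrier A \<Longrightarrow> x \<in> U k \<Longrightarrow> a \<otimes>\<^bsub>A\<^esub> x \<in> U k"
  by (auto elim!: U_E carrier_A_E simp: elem_mult shift_coeffs_def intro!: U_I sum.neutral)

lemma U_carrier: "x \<in> U k \<Longrightarrow> x \<in> carrier A"
  by (auto elim!: U_E simp: elem_closed)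

lemma Pj_U_left_mod: "left_mod A (Pj\<lparr>carrier := U k\<rparr>)"
proof -
  have ab: "abelian_group (Pj\<lparr>carrier := U k\<rparr>)"
  proof (rule abelian_groupI)
    fix x assume "x \<in> carrier (Pj\<lparr>carrier := U k\<rparr>)"
    then obtain f where f: "x = elem f" "\<forall>l<k. f l = 0" by (auto elim: U_E)
    show "\<exists>y\<in>carrier (Pj\<lparr>carrier := U k\<rparr>). y \<oplus>\<^bsub>Pj\<lparr>carrier := U k\<rparr>\<^esub> x = \<zero>\<^bsub>Pj\<lparr>carrier := U k\<rparr>\<^esub>"
      using f by (intro bexI[of _ "elem (\<lambda>l. - f l)"]) (auto simp: elem_add elem_zero intro!: U_I)
  qed (auto simp: U_add U_zero A.a_assoc A.a_comm A.a_lcomm U_carrier)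
  show ?thesis
    by (intro left_mod.intro A.ring_axioms ab left_mod_axioms.intro module_axioms.intro)
      (auto simp: U_smult U_carrier A.l_distr A.r_distr A.m_assoc)
qed

text \<open>
  An element with a nonzero coefficient at length \<open>k\<close> generates all of \<open>U k\<close>: multiplying it by a
  multiple of a path of length \<open>l - k\<close> produces any prescribed leading term of length \<open>l\<close>, and what
  remains is longer. Hence \<open>U (Suc k)\<close> is the only maximal submodule of \<open>U k\<close>.
\<close>

lemma submodule_U_full:
  assumes k: "k < d" and N: "submodule L A (Pj\<lparr>carrier := U k\<rparr>)" and ne: "\<not> L \<subseteq> U (Suc k)"
  shows "L = U k"
proof
  show "L \<subseteq> U k" using submoduleD(1)[OF N] by simp
  obtain x where x: "x \<in> L" "x \<notin> U (Suc k)" using ne by auto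
  then have "x \<in> U k" using \<open>L \<subseteq> U k\<close> by auto
  then obtain f where f: "x = elem f" "\<forall>l<k. f l = 0" by (rule U_E)
  have fk: "f k \<noteq> 0"
  proof
    assume "f k = 0"
    then have "elem f \<in> U (Suc k)" using f(2) by (intro U_I) (auto simp: less_Suc_eq)
    then show False using x(2) f(1) by simp
  qed
  have add: "u \<oplus>\<^bsub>A\<^esub> v \<in> L" if "u \<in> L" "v \<in> L" for u v using submoduleD(3)[OF N that] by simp
  have smult: "a \<otimes>\<^bsub>A\<^esub> v \<in> L" if "a \<in> carrier A" "v \<in> L" for a v using submoduleD(4)[OF N that] by simp
  \<comment> \<open>Induction downwards on the length of the leading term.\<close>
  have claim: "\<forall>h. (\<forall>t<d - m. h t = 0) \<longrightarrow> elem h \<in> L" if "m \<le> d - k" for m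
    using that
  proof (induction m)
    case 0
    have "elem h = \<zero>\<^bsub>A\<^esub>" if "\<forall>t<d. h t = 0" for h unfolding elem_zero[symmetric] elem_eq_iff using that by simp
    then show ?case using submoduleD(2)[OF N] by simp
  next
    case (Suc m)
    define l where "l = d - Suc m"
    have l: "k \<le> l" "l < d" "Suc l = d - m" using Suc.prems by (auto simp: l_def)
    show ?case unfolding l_def[symmetric]
    proof (intro allI impI)
      fix h :: "nat \<Rightarrow> 'k" assume h: "\<forall>t<l. h t = 0"
      define y where "y = path_scale (h l / f k) (path ((j + k) mod n) (l - k) :: 'k path_elt)"
      have y: "y \<in> carrier P" using n_pos by (simp add: y_def)
      have sh: "shift_coeffs y f t = h t" if "t \<le> l" for t
      proof -
        have "y ((j + u) mod n) (t - u) * f u = (if u = k then (if t = l then h t else 0) else 0)" if "u \<le> t" for u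
        proof (cases "u < k")
          case False
          then show ?thesis using \<open>u \<le> t\<close> \<open>t \<le> l\<close> l(1) fk
            by (auto simp: y_def path_scale_def path_def)
        qed (simp add: f)
        then have "shift_coeffs y f t = (\<Sum>u\<le>t. if u = k then (if t = l then h t else 0) else 0)"
          unfolding shift_coeffs_def by (intro sum.cong) auto
        then show ?thesis using that h l(1) by (cases "t = l") auto
      qed
      have "tc y \<otimes>\<^bsub>A\<^esub> elem f \<in> L" using x f y by (intro smult) auto
      then have 1: "elem (shift_coeffs y f) \<in> L" by (simp add: elem_mult y)
      have "\<forall>t<d - m. h t - shift_coeffs y f t = 0" using sh l(3) by auto
      then have 2: "elem (\<lambda>t. h t - shift_coeffs y f t) \<in> L" using Suc by simp
      show "elem h \<in> L" using add[OF 1 2] by (simp add: elem_add)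
    qed
  qed
  show "U k \<subseteq> L"
  proof
    fix z assume "z \<in> U k"
    then obtain h where "z = elem h" "\<forall>l<k. h l = 0" by (rule U_E)
    then show "z \<in> L" using claim[of "d - k"] k by simp
  qed
qed

lemma radical_U:
  assumes k: "k < d"
  shows "radical A (Pj\<lparr>carrier := U k\<rparr>) = U (Suc k)"
proof -
  interpret Uk: left_mod A "Pj\<lparr>carrier := U k\<rparr>" by (rule Pj_U_left_mod)
  have sub: "submodule (U (Suc k)) A (Pj\<lparr>carrier := U k\<rparr>)"
    using U_mono[of k "Suc k"] by (intro Uk.submoduleI) (auto simp: U_zero U_add U_smult)
  have "elem (\<lambda>l. if l = k then 1 else 0) \<in> U k" by (rule U_I) auto
  moreover have "elem (\<lambda>l. if l = k then 1 else 0) \<notin> U (Suc k)" using k by (subst mem_U_iff) auto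
  ultimately have ne: "U (Suc k) \<noteq> U k" by blast
  have "maximal_submodule L A (Pj\<lparr>carrier := U k\<rparr>) \<longleftrightarrow> L = U (Suc k)" for L
  proof
    assume L: "maximal_submodule L A (Pj\<lparr>carrier := U k\<rparr>)"
    then have "L \<subseteq> U (Suc k)" using submodule_U_full[OF k, of L] by (auto simp: maximal_submodule_def)
    then show "L = U (Suc k)" using L sub ne by (auto simp: maximal_submodule_def)
  next
    assume "L = U (Suc k)"
    then show "maximal_submodule L A (Pj\<lparr>carrier := U k\<rparr>)"
      using sub ne submodule_U_full[OF k] by (auto simp: maximal_submodule_def)
  qed
  then show ?thesis using U_mono[of k "Suc k"] by (auto simp: radical_def)
qed

lemma radical_power_U: "i \<le> d \<Longrightarrow> radical_power A Pj i = U i"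
proof (induction i)
  case 0 show ?case by (simp add: Pj_carrier)
next
  case (Suc i) then show ?case using radical_U[of i] by simp
qed

text \<open>
  The cosets of \<open>U i\<close> are the sets of elements with prescribed coefficients below length \<open>i\<close>; as for
  tensor products, sending the coefficients to their coset is an isomorphism.
\<close>

definition coeff_fibre :: "nat \<Rightarrow> (nat \<times> nat \<Rightarrow> 'k) \<Rightarrow> 'k trunc_elt set" where
  "coeff_fibre i f = {elem h | h. \<forall>l<i. h l = f (0, l)}"

lemma U_coset:
  assumes "i \<le> d" "\<forall>l<i. h l = f (0, l)"
  shows "U i +>\<^bsub>Pj\<^esub> elem h = coeff_fibre i f"
proof (intro equalityI subsetI)
  fix x assume "x \<in> U i +>\<^bsub>Pj\<^esub> elem h"
  then obtain u where u: "u \<in> U i" "x = u \<oplus>\<^bsub>A\<^esub> elem h" by (auto simp: a_r_coset_def r_coset_def)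
  obtain h' where h': "u = elem h'" "\<forall>l<i. h' l = 0" using u(1) by (rule U_E)
  have "x = elem (\<lambda>l. h' l + h l)" by (simp add: u h' elem_add)
  then show "x \<in> coeff_fibre i f" using h' assms(2) unfolding coeff_fibre_def by auto
next
  fix x assume "x \<in> coeff_fibre i f"
  then obtain h' where h': "x = elem h'" "\<forall>l<i. h' l = f (0, l)" by (auto simp: coeff_fibre_def)
  have "elem (\<lambda>l. h' l - h l) \<in> U i" using h' assms(2) by (intro U_I) auto
  moreover have "x = elem (\<lambda>l. h' l - h l) \<oplus>\<^bsub>A\<^esub> elem h" by (simp add: elem_add h')
  ultimately show "x \<in> U i +>\<^bsub>Pj\<^esub> elem h" unfolding a_r_coset_def r_coset_def by auto
qed

theorem nak_module_iso:
  assumes i: "i \<le> d"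
  shows "module_isomorphic A (block_module n d {0} (\<lambda>_. j) (\<lambda>_. i)) (nak_module n d i j)"
proof -
  let ?B = "blocks {0} (\<lambda>_. i)" and ?Q = "nak_module n d i j :: ('k trunc_elt, 'k trunc_elt set) module"
  interpret S: graded_space n d Kt ?B "block_grade (\<lambda>_. j)" "block_shift (\<lambda>_. i) :: (_ \<Rightarrow> 'k) \<Rightarrow> _"
    by (rule block_graded_space) (use i in auto)
  have Q: "?Q = quotient_module Pj (U i)" by (simp add: nak_module_def radical_power_U i)
  have B: "f (a, l) = 0" if "f \<in> supported ?B" "\<not> (a = 0 \<and> l < i)" for f :: "nat \<times> nat \<Rightarrow> 'k" and a l
    using that by (auto simp: supported_def blocks_def)
  define ext where "ext h = (\<lambda>(a, l). if a = 0 \<and> l < i then h l else (0::'k))" for h :: "nat \<Rightarrow> 'k" and a :: nat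
  have carr: "carrier ?Q = coeff_fibre i ` supported ?B"
  proof (intro equalityI subsetI)
    fix C assume "C \<in> carrier ?Q"
    then obtain h where h: "C = U i +>\<^bsub>Pj\<^esub> elem h"
      unfolding Q quotient_module_def A_RCOSETS_def' using Pj_carrier by (auto elim: U_E)
    let ?f = "\<lambda>(a, l). if a = (0::nat) \<and> l < i then h l else 0"
    have "C = coeff_fibre i ?f" unfolding h by (rule U_coset[OF i]) auto
    moreover have "?f \<in> supported ?B" by (auto simp: supported_def blocks_def)
    ultimately show "C \<in> coeff_fibre i ` supported ?B" by blast
  next
    fix C assume "C \<in> coeff_fibre i ` supported ?B"
    then obtain f where f: "C = coeff_fibre i f" by blast
    have "U i +>\<^bsub>Pj\<^esub> elem (\<lambda>l. f (0, l)) = C" unfolding f by (rule U_coset[OF i]) auto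
    moreover have "elem (\<lambda>l. f (0, l)) \<in> carrier Pj" unfolding Pj_carrier by (rule U_I) auto
    ultimately show "C \<in> carrier ?Q" unfolding Q quotient_module_def A_RCOSETS_def' by auto
  qed
  have fib_mem: "elem h \<in> coeff_fibre i f \<longleftrightarrow> (\<forall>l<i. h l = f (0, l))" for h f
    unfolding coeff_fibre_def using i by (auto simp: elem_eq_iff)
  have "module_iso (coeff_fibre i) A S.M ?Q"
    unfolding module_iso_def
  proof (intro conjI ballI)
    have "inj_on (coeff_fibre i) (supported ?B)"
    proof (rule inj_onI)
      fix f f' assume f: "f \<in> supported ?B" "f' \<in> supported ?B" and eq: "coeff_fibre i f = coeff_fibre i f'"
      have "elem (\<lambda>l. f (0, l)) \<in> coeff_fibre i f'" unfolding eq[symmetric] fib_mem by simp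
      then have "\<forall>l<i. f (0, l) = f' (0, l)" unfolding fib_mem .
      then have "f (a, l) = f' (a, l)" for a l using B[OF f(1), of a l] B[OF f(2), of a l] by (cases "a = 0 \<and> l < i") auto
      then show "f = f'" by auto
    qed
    then show "bij_betw (coeff_fibre i) (carrier S.M) (carrier ?Q)" by (simp add: bij_betw_def carr)
  next
    fix f f' :: "nat \<times> nat \<Rightarrow> 'k"
    have "coeff_fibre i (\<lambda>p. f p + f' p) = (\<Union>x\<in>coeff_fibre i f. \<Union>y\<in>coeff_fibre i f'. {x \<oplus>\<^bsub>A\<^esub> y})"
    proof (intro equalityI subsetI)
      fix x assume "x \<in> coeff_fibre i (\<lambda>p. f p + f' p)"
      then obtain h where h: "x = elem h" "\<forall>l<i. h l = f (0, l) + f' (0, l)" by (auto simp: coeff_fibre_def)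
      have "x = elem (\<lambda>l. f (0, l)) \<oplus>\<^bsub>A\<^esub> elem (\<lambda>l. h l - f (0, l))" by (simp add: h elem_add)
      moreover have "elem (\<lambda>l. f (0, l)) \<in> coeff_fibre i f" "elem (\<lambda>l. h l - f (0, l)) \<in> coeff_fibre i f'"
        using h by (simp_all add: fib_mem)
      ultimately show "x \<in> (\<Union>x\<in>coeff_fibre i f. \<Union>y\<in>coeff_fibre i f'. {x \<oplus>\<^bsub>A\<^esub> y})" by blast
    next
      fix x assume "x \<in> (\<Union>x\<in>coeff_fibre i f. \<Union>y\<in>coeff_fibre i f'. {x \<oplus>\<^bsub>A\<^esub> y})"
      then show "x \<in> coeff_fibre i (\<lambda>p. f p + f' p)" by (auto simp: coeff_fibre_def elem_add)
    qed
    then show "coeff_fibre i (f \<oplus>\<^bsub>S.M\<^esub> f') = coeff_fibre i f \<oplus>\<^bsub>?Q\<^esub> coeff_fibre i f'"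
      unfolding Q quotient_module_def by (simp add: set_add_def')
  next
    fix a f assume a: "a \<in> carrier A" and f: "f \<in> carrier S.M"
    then obtain y where y: "y \<in> carrier P" "a = tc y" by (metis carrier_A_E)
    have fs: "f \<in> supported ?B" using f by simp
    have "U i +>\<^bsub>Pj\<^esub> (a \<otimes>\<^bsub>A\<^esub> x) = coeff_fibre i (S.act y f)" if x: "x \<in> coeff_fibre i f" for x
    proof -
      obtain h where h: "x = elem h" "\<forall>l<i. h l = f (0, l)" using x by (auto simp: coeff_fibre_def)
      have "\<forall>l<i. shift_coeffs y h l = S.act y f (0, l)"
      proof (intro allI impI)
        fix l assume l: "l < i"
        have "S.act y f (0, l) = (\<Sum>u\<le>l. y ((j + u) mod n) (l - u) * f (0, u))"
          by (rule block_action[OF _ _ fs]) (use i l in auto)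
        then show "shift_coeffs y h l = S.act y f (0, l)"
          using h(2) l by (auto simp: shift_coeffs_def intro!: sum.cong)
      qed
      then show ?thesis unfolding h(1) y(2) elem_mult[OF y(1)] by (rule U_coset[OF i])
    qed
    moreover have "coeff_fibre i f \<noteq> {}" using fib_mem[of "\<lambda>l. f (0, l)" f] by auto
    ultimately have "(\<Union>x\<in>coeff_fibre i f. U i +>\<^bsub>Pj\<^esub> (a \<otimes>\<^bsub>A\<^esub> x)) = coeff_fibre i (S.act y f)" by simp
    then show "coeff_fibre i (a \<odot>\<^bsub>S.M\<^esub> f) = a \<odot>\<^bsub>?Q\<^esub> coeff_fibre i f"
      using y unfolding Q quotient_module_def by (simp add: S.M_smult)
  qed
  then show ?thesis unfolding block_module_def by (rule module_isomorphicI)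
qed

end

section \<open>Isomorphism classes\<close>

context graded_space
begin

lemma ex_umodule_copy: "\<exists>L :: 'k umodule. fg_module A L \<and> module_isomorphic A M L"
proof -
  obtain e where e: "bij_betw e {..<card I} I"
    using fin by (metis ex_bij_betw_nat_finite atLeast0LessThan)
  define h where "h f = (\<lambda>m. if m < card I then f (e m) else 0)" for f :: "'i \<Rightarrow> 'k"
  have "inj_on h (carrier M)"
  proof (rule inj_onI)
    fix f f' assume f: "f \<in> carrier M" "f' \<in> carrier M" and eq: "h f = h f'"
    have "f p = f' p" for p
    proof (cases "p \<in> I")
      case True
      then obtain m where "m < card I" "p = e m" using e by (auto simp: bij_betw_def)
      then show ?thesis using fun_cong[OF eq, of m] by (simp add: h_def)
    next
      case False
      then have "f p = 0" "f' p = 0" using f by (auto simp: supported_def)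
      then show ?thesis by simp
    qed
    then show "f = f'" by auto
  qed
  note copy = copy_module[OF M_left_module this]
  have "fg_module A (copy_module h M)"
    by (rule fg_module_iso[OF M_fg copy(1)]) (rule module_isomorphicI[OF copy(2)])
  then show ?thesis using copy(2) module_isomorphicI by blast
qed

lemma iso_class_in: "iso_class n d M \<in> iso_classes n d"
proof -
  obtain L :: "'k umodule" where L: "fg_module A L" "module_isomorphic A M L" using ex_umodule_copy by blast
  have "iso_class n d M = iso_class n d L"
    by (rule iso_class_eqI[OF L(2) module_isomorphic_sym[OF M_left_module L(2)]])
  then show ?thesis using L(1) by (auto simp: iso_classes_def)
qed

lemma iso_class_nonempty: "iso_class n d M \<noteq> {}"
  using ex_umodule_copy by (auto simp: iso_class_def)

end

lemma direct_sum_relation: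
  fixes I J :: "'i set" and N :: "('i \<Rightarrow> 'k::field) \<Rightarrow> 'i \<Rightarrow> 'k"
  assumes 1: "graded_space n d I g N" and 2: "graded_space n d J g N"
    and 3: "graded_space n d (I \<union> J) g N" and disj: "I \<inter> J = {}"
  shows "frag_of (iso_class n d (graded_module n d I g N)) + frag_of (iso_class n d (graded_module n d J g N))
    - frag_of (iso_class n d (graded_module n d (I \<union> J) g N)) \<in> direct_sum_relations n d"
proof -
  interpret I: graded_space n d "TYPE('k)" I g N by fact
  interpret J: graded_space n d "TYPE('k)" J g N by fact
  obtain V :: "'k umodule" where V: "fg_module I.A V" "module_isomorphic I.A I.M V" using I.ex_umodule_copy by blast
  obtain W :: "'k umodule" where W: "fg_module I.A W" "module_isomorphic I.A J.M W" using J.ex_umodule_copy by blast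
  let ?U = "graded_module n d (I \<union> J) g N"
  have V': "left_module I.A V" and W': "left_module I.A W" using V W by (auto simp: fg_module_def)
  have sV: "module_isomorphic I.A V I.M" by (rule module_isomorphic_sym[OF I.M_left_module V(2)])
  have sW: "module_isomorphic I.A W J.M" by (rule module_isomorphic_sym[OF J.M_left_module W(2)])
  have u1: "module_isomorphic I.A ?U (direct_sum_module I.M J.M)" by (rule graded_module_union[OF 1 2 disj])
  have iso: "module_isomorphic I.A ?U (direct_sum_module V W)"
    by (rule module_isomorphic_trans[OF u1 direct_sum_cong[OF V(2) W(2)]])
  have "left_module I.A ?U" by (rule graded_space.M_left_module[OF 3])
  then have "iso_class n d ?U = iso_class n d (direct_sum_module V W)"
    using iso module_isomorphic_sym[OF _ iso] by (intro iso_class_eqI)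
  moreover have "iso_class n d I.M = iso_class n d V" by (rule iso_class_eqI[OF V(2) sV])
  moreover have "iso_class n d J.M = iso_class n d W" by (rule iso_class_eqI[OF W(2) sW])
  ultimately show ?thesis using V(1) W(1) unfolding direct_sum_relations_def by auto
qed

section \<open>Tensor products of isomorphism classes\<close>

lemma frag_extend_add_fun: "frag_extend (\<lambda>x. h x + h' x) f = frag_extend h f + frag_extend h' f"
proof -
  have "Poly_Mapping.keys f \<subseteq> UNIV" by simp
  then show ?thesis
    by (induction f rule: frag_induction) (simp_all add: frag_extend_diff)
qed

lemma frag_extend_diff_fun: "frag_extend (\<lambda>x. h x - h' x) f = frag_extend h f - frag_extend h' f"
  using frag_extend_add_fun[of "\<lambda>x. h x - h' x" h' f] by (simp add: algebra_simps)

text \<open>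
  The condition on \<open>d\<close> under which the truncation ideal is a Hopf ideal.
\<close>

locale hopf_nakayama = nakayama n d Kt for n d and Kt :: "'k::field itself" +
  assumes choose_zero: "\<And>c. 0 < c \<Longrightarrow> c < d \<Longrightarrow> (of_nat (d choose c) :: 'k) = 0"
begin

definition admissible :: "nat set \<Rightarrow> (nat \<Rightarrow> nat) \<Rightarrow> (nat \<Rightarrow> nat) \<Rightarrow> bool" where
  "admissible B j len \<longleftrightarrow> finite B \<and> (\<forall>a\<in>B. j a < n \<and> len a \<le> d)"

definition block_iso_class :: "nat set \<Rightarrow> (nat \<Rightarrow> nat) \<Rightarrow> (nat \<Rightarrow> nat) \<Rightarrow> 'k umodule set" where
  "block_iso_class B j len = iso_class n d (block_module n d B j len :: ('k trunc_elt, nat \<times> nat \<Rightarrow> 'k) module)"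

abbreviation tensor_blocks where
  "tensor_blocks B j len B' j' len' \<equiv> (graded_module n d (blocks B len \<times> blocks B' len')
     (tensor_grade (block_grade j) (block_grade j'))
     (tensor_shift (block_shift len) (block_shift len')) :: ('k trunc_elt, (nat \<times> nat) \<times> nat \<times> nat \<Rightarrow> 'k) module)"

lemma admissible_space: "admissible B j len \<Longrightarrow>
    graded_space n d (blocks B len) (block_grade j) (block_shift len :: (_ \<Rightarrow> 'k) \<Rightarrow> _)"
  by (rule block_graded_space) (auto simp: admissible_def)

lemma admissible_pair: "admissible B j len \<Longrightarrow> admissible B' j' len' \<Longrightarrow>
    graded_pair n d (blocks B len) (block_grade j) (block_shift len :: (_ \<Rightarrow> 'k) \<Rightarrow> _)
      (blocks B' len') (block_grade j') (block_shift len' :: (_ \<Rightarrow> 'k) \<Rightarrow> _)"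
  by (intro graded_pair.intro admissible_space graded_pair_axioms.intro choose_zero nakayama_axioms)

lemma admissible_tensor_space: "admissible B j len \<Longrightarrow> admissible B' j' len' \<Longrightarrow>
    graded_space n d (blocks B len \<times> blocks B' len') (tensor_grade (block_grade j) (block_grade j'))
     (tensor_shift (block_shift len) (block_shift len') :: (_ \<Rightarrow> 'k) \<Rightarrow> _)"
proof -
  assume 1: "admissible B j len" "admissible B' j' len'"
  interpret graded_pair n d Kt "blocks B len" "block_grade j" "block_shift len"
    "blocks B' len'" "block_grade j'" "block_shift len'" by (rule admissible_pair[OF 1])
  show ?thesis by (rule T.graded_space_axioms)
qed

lemma block_left_module: "admissible B j len \<Longrightarrow> left_module A (block_module n d B j len)"
  unfolding block_module_def by (rule graded_space.M_left_module[OF admissible_space])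

lemma block_iso_class_in: "admissible B j len \<Longrightarrow> block_iso_class B j len \<in> iso_classes n d"
  unfolding block_iso_class_def block_module_def by (rule graded_space.iso_class_in[OF admissible_space])

lemma fg_blocks:
  fixes V :: "('k trunc_elt, 'v) module"
  assumes "fg_module A V"
  obtains t j len where "admissible {s..<s + t} j len" "module_isomorphic A (block_module n d {s..<s + t} j len) V"
    "module_isomorphic A V (block_module n d {s..<s + t} j len)" "iso_class n d V = block_iso_class {s..<s + t} j len"
proof -
  obtain t j len where 1: "\<And>a. a \<in> {s..<s + t} \<Longrightarrow> j a < n" "\<And>a. a \<in> {s..<s + t} \<Longrightarrow> len a \<le> d"
    and iso: "module_isomorphic A (block_module n d {s..<s + t} j len) V"
    using fg_module_block_decomposition[OF assms] by metis
  have admissible: "admissible {s..<s + t} j len" using 1 by (auto simp: admissible_def)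
  have iso': "module_isomorphic A V (block_module n d {s..<s + t} j len)"
    by (rule module_isomorphic_sym[OF block_left_module[OF admissible] iso])
  show ?thesis by (rule that[OF admissible iso iso']) (simp add: block_iso_class_def iso_class_eqI[OF iso' iso])
qed

lemma tensor_block_iso:
  fixes V :: "('k trunc_elt, 'v) module" and W :: "('k trunc_elt, 'w) module"
  assumes admissible: "admissible B j len" "admissible B' j' len'"
    and V: "left_module A V" "module_isomorphic A V (block_module n d B j len)"
    and W: "left_module A W" "module_isomorphic A W (block_module n d B' j' len')"
  shows "iso_class n d (tensor_module n d V W) = iso_class n d (tensor_blocks B j len B' j' len')"
proof -
  interpret graded_pair n d Kt "blocks B len" "block_grade j" "block_shift len"
    "blocks B' len'" "block_grade j'" "block_shift len'" by (rule admissible_pair[OF admissible])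
  obtain \<phi> where \<phi>: "module_iso \<phi> A V S.M" using V(2) by (auto simp: module_isomorphic_iff block_module_def)
  obtain \<psi> where \<psi>: "module_iso \<psi> A W S'.M" using W(2) by (auto simp: module_isomorphic_iff block_module_def)
  interpret graded_pair_copy n d Kt "blocks B len" "block_grade j" "block_shift len"
    "blocks B' len'" "block_grade j'" "block_shift len'" V W \<phi> \<psi>
    by unfold_locales (fact V W \<phi> \<psi>)+
  have iso: "module_isomorphic A T.M (tensor_module n d V W)" using fibre_iso by (rule module_isomorphicI)
  show ?thesis by (rule iso_class_eqI[OF module_isomorphic_sym[OF T.M_left_module iso] iso])
qed

lemma class_tensor_blocks:
  assumes admissible: "admissible B j len" "admissible B' j' len'"
  shows "class_tensor n d (block_iso_class B j len) (block_iso_class B' j' len') = iso_class n d (tensor_blocks B j len B' j' len')"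
proof -
  have mem: "left_module A V \<and> module_isomorphic A V (block_module n d B j len)"
    if "V \<in> block_iso_class B j len" "admissible B j len" for V B j len
    using that module_isomorphic_sym[OF block_left_module[OF that(2)]] by (auto simp: block_iso_class_def iso_class_def fg_module_def)
  have "iso_class n d (tensor_module n d V W) = iso_class n d (tensor_blocks B j len B' j' len')"
    if "V \<in> block_iso_class B j len" "W \<in> block_iso_class B' j' len'" for V W
    using mem[OF that(1) admissible(1)] mem[OF that(2) admissible(2)] by (intro tensor_block_iso admissible) auto
  moreover have "block_iso_class B j len \<noteq> {}" "block_iso_class B' j' len' \<noteq> {}"
    using graded_space.iso_class_nonempty[OF admissible_space[OF admissible(1)]] graded_space.iso_class_nonempty[OF admissible_space[OF admissible(2)]]
    by (simp_all add: block_iso_class_def block_module_def)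
  ultimately show ?thesis unfolding class_tensor_def by auto
qed

lemma iso_classes_E:
  assumes "(C :: 'k umodule set) \<in> iso_classes n d"
  obtains t j len where "admissible {s..<s + t} j len" "C = block_iso_class {s..<s + t} j len"
proof -
  obtain V :: "'k umodule" where V: "fg_module A V" "C = iso_class n d V" using assms by (auto simp: iso_classes_def)
  show ?thesis using fg_blocks[OF V(1), of s] V(2) that by metis
qed

lemma class_tensor_in:
  assumes "(C :: 'k umodule set) \<in> iso_classes n d" "D \<in> iso_classes n d"
  shows "class_tensor n d C D \<in> iso_classes n d"
proof -
  obtain t j len where C: "admissible {0..<0 + t} j len" "C = block_iso_class {0..<0 + t} j len" using assms(1) by (rule iso_classes_E)
  obtain t' j' len' where D: "admissible {0..<0 + t'} j' len'" "D = block_iso_class {0..<0 + t'} j' len'" using assms(2) by (rule iso_classes_E)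
  show ?thesis unfolding C(2) D(2) class_tensor_blocks[OF C(1) D(1)]
    by (rule graded_space.iso_class_in[OF admissible_tensor_space[OF C(1) D(1)]])
qed

text \<open>
  Values of \<open>j\<close> and \<open>len\<close> outside the set of blocks affect the operator but not the module.
\<close>

lemma block_iso_class_cong:
  assumes "admissible B j len" "\<And>a. a \<in> B \<Longrightarrow> j a = j' a" "\<And>a. a \<in> B \<Longrightarrow> len a = len' a"
  shows "block_iso_class B j len = block_iso_class B j' len'"
proof -
  have admissible': "admissible B j' len'" using assms by (auto simp: admissible_def)
  have bl: "blocks B len' = blocks B len" using assms(3) by (auto simp: blocks_def)
  show ?thesis unfolding block_iso_class_def block_module_def
  proof (rule graded_module_reindex[OF admissible_space[OF assms(1)] admissible_space[OF admissible'], where \<pi> = "\<lambda>q. q"], unfold bl)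
    show "bij_betw (\<lambda>q. q) (blocks B len) (blocks B len)" by (rule bij_betw_id[unfolded id_def])
  qed (use assms(2,3) in \<open>auto simp: block_grade_def block_shift_def supported_def blocks_def fun_eq_iff\<close>)
qed

lemma blocks_union: "blocks (B1 \<union> B2) len = blocks B1 len \<union> blocks B2 len"
  by (auto simp: blocks_def)

text \<open>
  The second module is decomposed over blocks disjoint from those of the first.
\<close>

lemma relation_blocks:
  assumes "r \<in> direct_sum_relations n d"
  obtains B1 B2 j len where "admissible B1 j len" "admissible B2 j len" "B1 \<inter> B2 = {}"
    "r = frag_of (block_iso_class B1 j len) + frag_of (block_iso_class B2 j len) - frag_of (block_iso_class (B1 \<union> B2) j len)"
proof -
  obtain V W :: "'k umodule" where V: "fg_module A V" and W: "fg_module A W"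
    and r: "r = frag_of (iso_class n d V) + frag_of (iso_class n d W) - frag_of (iso_class n d (direct_sum_module V W))"
    using assms by (auto simp: direct_sum_relations_def)
  obtain t j len where 1: "admissible {0..<0 + t} j len" "module_isomorphic A (block_module n d {0..<0 + t} j len) V"
     "module_isomorphic A V (block_module n d {0..<0 + t} j len)" "iso_class n d V = block_iso_class {0..<0 + t} j len"
    using fg_blocks[OF V] by metis
  obtain t' j' len' where 2: "admissible {t..<t + t'} j' len'" "module_isomorphic A (block_module n d {t..<t + t'} j' len') W"
     "module_isomorphic A W (block_module n d {t..<t + t'} j' len')" "iso_class n d W = block_iso_class {t..<t + t'} j' len'"
    using fg_blocks[OF W] by metis
  let ?B1 = "{0..<0 + t}" and ?B2 = "{t..<t + t'}"
  define k where "k a = (if a < t then j a else j' a)" for a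
  define l where "l a = (if a < t then len a else len' a)" for a
  have c1: "block_iso_class ?B1 j len = block_iso_class ?B1 k l" by (rule block_iso_class_cong[OF 1(1)]) (auto simp: k_def l_def)
  have c2: "block_iso_class ?B2 j' len' = block_iso_class ?B2 k l" by (rule block_iso_class_cong[OF 2(1)]) (auto simp: k_def l_def)
  have g1: "admissible ?B1 k l" using 1(1) by (auto simp: admissible_def k_def l_def)
  have g2: "admissible ?B2 k l" using 2(1) by (auto simp: admissible_def k_def l_def)
  have disj: "blocks ?B1 l \<inter> blocks ?B2 l = {}" by (auto simp: blocks_def)
  have g12: "admissible (?B1 \<union> ?B2) k l" using g1 g2 by (auto simp: admissible_def)
  have V': "module_isomorphic A (block_module n d ?B1 k l) V"
    using c1 1(4) V module_isomorphic_refl[of A V] by (auto simp: block_iso_class_def iso_class_def set_eq_iff)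
  have W': "module_isomorphic A (block_module n d ?B2 k l) W"
    using c2 2(4) W module_isomorphic_refl[of A W] by (auto simp: block_iso_class_def iso_class_def set_eq_iff)
  have "module_isomorphic A (block_module n d (?B1 \<union> ?B2) k l) (direct_sum_module (block_module n d ?B1 k l) (block_module n d ?B2 k l))"
    unfolding block_module_def blocks_union by (rule graded_module_union[OF admissible_space[OF g1] admissible_space[OF g2] disj])
  then have iso: "module_isomorphic A (block_module n d (?B1 \<union> ?B2) k l) (direct_sum_module V W)"
    by (rule module_isomorphic_trans) (rule direct_sum_cong[OF V' W'])
  have "iso_class n d (direct_sum_module V W) = block_iso_class (?B1 \<union> ?B2) k l"
    unfolding block_iso_class_def by (rule iso_class_eqI[OF module_isomorphic_sym[OF block_left_module[OF g12] iso] iso])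
  then show ?thesis using 1(4) 2(4) c1 c2 by (intro that[OF g1 g2]) (auto simp: r)
qed

section \<open>The representation ring\<close>

abbreviation Fr :: "('k umodule set \<Rightarrow>\<^sub>0 int) ring" where "Fr \<equiv> free_rep_ring n d"
abbreviation Rels :: "('k umodule set \<Rightarrow>\<^sub>0 int) set" where "Rels \<equiv> rep_ideal n d"
abbreviation Rep :: "('k umodule set \<Rightarrow>\<^sub>0 int) set ring" where "Rep \<equiv> rep_ring n d"

definition rep_mult :: "('k umodule set \<Rightarrow>\<^sub>0 int) \<Rightarrow> ('k umodule set \<Rightarrow>\<^sub>0 int) \<Rightarrow> ('k umodule set \<Rightarrow>\<^sub>0 int)" where
  "rep_mult f g = frag_extend (\<lambda>A. frag_extend (\<lambda>B. frag_of (class_tensor n d A B)) g) f"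

lemma Fr_simps [simp]:
  "f \<in> carrier Fr \<longleftrightarrow> Poly_Mapping.keys f \<subseteq> iso_classes n d"
  "f \<otimes>\<^bsub>Fr\<^esub> g = rep_mult f g" "\<zero>\<^bsub>Fr\<^esub> = 0" "f \<oplus>\<^bsub>Fr\<^esub> g = f + g"
  by (simp_all add: free_rep_ring_def rep_mult_def)

lemma Fr_add_monoid: "add_monoid Fr = free_Abelian_group (iso_classes n d)"
  by (simp add: free_rep_ring_def free_Abelian_group_def)

lemma Fr_abelian: "abelian_group Fr"
  by (rule comm_group_abelian_groupI) (simp only: Fr_add_monoid abelian_free_Abelian_group)

sublocale Fr: abelian_group Fr by (rule Fr_abelian)

lemma relations_in: "direct_sum_relations n d \<subseteq> carrier Fr"
proof
  fix r :: "'k umodule set \<Rightarrow>\<^sub>0 int" assume "r \<in> direct_sum_relations n d"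
  then obtain B1 B2 j len where g: "admissible B1 j len" "admissible B2 j len"
    and r: "r = frag_of (block_iso_class B1 j len) + frag_of (block_iso_class B2 j len) - frag_of (block_iso_class (B1 \<union> B2) j len)"
    by (rule relation_blocks)
  have g12: "admissible (B1 \<union> B2) j len" using g by (auto simp: admissible_def)
  have "Poly_Mapping.keys r \<subseteq> {block_iso_class B1 j len, block_iso_class B2 j len, block_iso_class (B1 \<union> B2) j len}"
    unfolding r using keys_diff[of "frag_of (block_iso_class B1 j len) + frag_of (block_iso_class B2 j len)" "frag_of (block_iso_class (B1 \<union> B2) j len)"]
      keys_add[of "frag_of (block_iso_class B1 j len)" "frag_of (block_iso_class B2 j len)"] by (auto simp: keys_frag_of)
  then show "r \<in> carrier Fr" using block_iso_class_in[OF g(1)] block_iso_class_in[OF g(2)] block_iso_class_in[OF g12] by auto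
qed

lemma Rels_subgroup: "subgroup Rels (add_monoid Fr)"
  unfolding rep_ideal_def by (rule Fr.add.generate_is_subgroup) (use relations_in in simp)

sublocale Rels: abelian_subgroup Rels Fr
  by (intro abelian_subgroupI3 additive_subgroup.intro Rels_subgroup Fr_abelian)

lemma Rels_diff: "x \<in> Rels \<Longrightarrow> y \<in> Rels \<Longrightarrow> x - y \<in> Rels"
proof -
  assume x: "x \<in> Rels" and y: "y \<in> Rels"
  have "Poly_Mapping.keys y \<subseteq> iso_classes n d" using Rels.a_Hcarr[OF y] by simp
  then have "\<ominus>\<^bsub>Fr\<^esub> y = - y" unfolding a_inv_def Fr_add_monoid by (rule inv_free_Abelian_group)
  then have "- y \<in> Rels" using Rels.a_inv_closed[OF y] by simp
  then show ?thesis using Rels.a_closed[OF x] by fastforce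
qed

lemma Rels_add: "x \<in> Rels \<Longrightarrow> y \<in> Rels \<Longrightarrow> x + y \<in> Rels"
  using Rels.a_closed[of x y] by simp

lemma Rels_zero: "0 \<in> Rels"
  using Rels.zero_closed by simp

lemma rep_mult_of: "rep_mult (frag_of C) (frag_of D) = frag_of (class_tensor n d C D)"
  by (simp add: rep_mult_def)

lemma rep_mult_add_left: "rep_mult (f + f') g = rep_mult f g + rep_mult f' g"
  by (simp add: rep_mult_def frag_extend_add)

lemma rep_mult_diff_left: "rep_mult (f - f') g = rep_mult f g - rep_mult f' g"
  by (simp add: rep_mult_def frag_extend_diff)

lemma rep_mult_add_right: "rep_mult f (g + g') = rep_mult f g + rep_mult f g'"
  by (simp add: rep_mult_def frag_extend_add frag_extend_add_fun)

lemma rep_mult_diff_right: "rep_mult f (g - g') = rep_mult f g - rep_mult f g'"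
  by (simp add: rep_mult_def frag_extend_diff frag_extend_diff_fun)

lemma rep_mult_zero: "rep_mult 0 g = 0" "rep_mult f 0 = 0"
  using rep_mult_diff_left[of 0 0 g] rep_mult_diff_right[of f 0 0] by simp_all

lemma rep_mult_closed: "f \<in> carrier Fr \<Longrightarrow> g \<in> carrier Fr \<Longrightarrow> rep_mult f g \<in> carrier Fr"
proof -
  assume f: "f \<in> carrier Fr" and g: "g \<in> carrier Fr"
  have "Poly_Mapping.keys (rep_mult f g) \<subseteq> (\<Union>C\<in>Poly_Mapping.keys f. Poly_Mapping.keys (frag_extend (\<lambda>B. frag_of (class_tensor n d C B)) g))"
    unfolding rep_mult_def by (rule keys_frag_extend)
  also have "\<dots> \<subseteq> (\<Union>C\<in>Poly_Mapping.keys f. \<Union>D\<in>Poly_Mapping.keys g. {class_tensor n d C D})"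
    using keys_frag_extend by (fastforce simp: keys_frag_of)
  also have "\<dots> \<subseteq> iso_classes n d" using f g class_tensor_in by auto
  finally show ?thesis by simp
qed

lemma Rels_induct [consumes 1, case_names zero diff rel]:
  assumes "r \<in> Rels" and "Q 0" "\<And>x y. Q x \<Longrightarrow> Q y \<Longrightarrow> Q (x - y)" "\<And>h. h \<in> direct_sum_relations n d \<Longrightarrow> Q h"
  shows "Q r"
proof -
  have neg: "Q (- x)" if "Q x" for x using assms(3)[OF assms(2) that] by simp
  have add: "Q (x + y)" if "Q x" "Q y" for x y using assms(3)[OF that(1) neg[OF that(2)]] by simp
  show ?thesis using assms(1) unfolding rep_ideal_def
  proof (induction rule: generate.induct)
    case (inv h)
    then have "Poly_Mapping.keys h \<subseteq> iso_classes n d" using subsetD[OF relations_in, of h] by simp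
    then have "inv\<^bsub>add_monoid Fr\<^esub> h = - h" unfolding Fr_add_monoid by (rule inv_free_Abelian_group)
    then show ?case using neg[OF assms(4)[OF inv]] by simp
  next
    case (eng h1 h2) then show ?case using add by simp
  qed (use assms in auto)
qed

text \<open>
  The index set of a tensor product with a union of blocks is the union of the index sets of the two
  tensor products, so a relation times a class is again a relation.
\<close>

lemma Rels_rep_mult:
  assumes r: "r \<in> Rels" and f: "f \<in> carrier Fr"
  shows "rep_mult r f \<in> Rels" and "rep_mult f r \<in> Rels"
proof -
  have on_rel: "rep_mult h (frag_of D) \<in> Rels \<and> rep_mult (frag_of D) h \<in> Rels"
    if h: "h \<in> direct_sum_relations n d" and D: "D \<in> iso_classes n d" for h D
  proof -
    obtain B1 B2 j len where g: "admissible B1 j len" "admissible B2 j len" and disj: "B1 \<inter> B2 = {}"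
      and heq: "h = frag_of (block_iso_class B1 j len) + frag_of (block_iso_class B2 j len) - frag_of (block_iso_class (B1 \<union> B2) j len)"
      using h by (rule relation_blocks)
    obtain t' j' len' where D: "admissible {0..<0 + t'} j' len'" "D = block_iso_class {0..<0 + t'} j' len'" using D by (rule iso_classes_E)
    have g12: "admissible (B1 \<union> B2) j len" using g by (auto simp: admissible_def)
    have dj: "blocks B1 len \<inter> blocks B2 len = {}" using disj by (auto simp: blocks_def)
    have "rep_mult h (frag_of D) \<in> direct_sum_relations n d"
      unfolding heq rep_mult_add_left rep_mult_diff_left rep_mult_of D(2)
        class_tensor_blocks[OF g(1) D(1)] class_tensor_blocks[OF g(2) D(1)] class_tensor_blocks[OF g12 D(1)] blocks_union Sigma_Un_distrib1
      by (rule direct_sum_relation[OF admissible_tensor_space[OF g(1) D(1)] admissible_tensor_space[OF g(2) D(1)]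
          admissible_tensor_space[OF g12 D(1), unfolded blocks_union Sigma_Un_distrib1]]) (use dj in auto)
    moreover have "rep_mult (frag_of D) h \<in> direct_sum_relations n d"
      unfolding heq rep_mult_add_right rep_mult_diff_right rep_mult_of D(2)
        class_tensor_blocks[OF D(1) g(1)] class_tensor_blocks[OF D(1) g(2)] class_tensor_blocks[OF D(1) g12] blocks_union Sigma_Un_distrib2
      by (rule direct_sum_relation[OF admissible_tensor_space[OF D(1) g(1)] admissible_tensor_space[OF D(1) g(2)]
          admissible_tensor_space[OF D(1) g12, unfolded blocks_union Sigma_Un_distrib2]]) (use dj in auto)
    ultimately show ?thesis unfolding rep_ideal_def by (auto intro: generate.incl)
  qed
  have one: "rep_mult r (frag_of D) \<in> Rels \<and> rep_mult (frag_of D) r \<in> Rels" if "D \<in> iso_classes n d" for D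
    using r
  proof (induction rule: Rels_induct)
    case (rel h) then show ?case using on_rel[OF rel that] by blast
  qed (auto simp: rep_mult_zero Rels_zero rep_mult_diff_left rep_mult_diff_right Rels_diff)
  have "Poly_Mapping.keys f \<subseteq> iso_classes n d" using f by simp
  then have "rep_mult r f \<in> Rels \<and> rep_mult f r \<in> Rels"
    by (induction f rule: free_Abelian_group_induct[consumes 1])
      (auto simp: rep_mult_zero Rels_zero rep_mult_diff_left rep_mult_diff_right Rels_diff one)
  then show "rep_mult r f \<in> Rels" and "rep_mult f r \<in> Rels" by auto
qed

abbreviation residue :: "('k umodule set \<Rightarrow>\<^sub>0 int) \<Rightarrow> ('k umodule set \<Rightarrow>\<^sub>0 int) set" where
  "residue f \<equiv> Rels +>\<^bsub>Fr\<^esub> f"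

lemma mem_residue_iff: "f \<in> carrier Fr \<Longrightarrow> f' \<in> residue f \<longleftrightarrow> f' - f \<in> Rels"
  by (auto simp: a_r_coset_def r_coset_def) (metis diff_add_cancel)

lemma residue_eqI: "f \<in> carrier Fr \<Longrightarrow> f' \<in> carrier Fr \<Longrightarrow> f' - f \<in> Rels \<Longrightarrow> residue f' = residue f"
  using Fr.a_repr_independence[OF _ _ Rels_subgroup, of f' f] mem_residue_iff[of f f'] by simp

lemma rep_ring_carrier: "carrier Rep = residue ` carrier Fr"
  unfolding rep_ring_def FactRing_def A_RCOSETS_def' by auto

lemma rep_ring_add: "f \<in> carrier Fr \<Longrightarrow> f' \<in> carrier Fr \<Longrightarrow> residue f \<oplus>\<^bsub>Rep\<^esub> residue f' = residue (f + f')"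
  unfolding rep_ring_def FactRing_def using Rels.a_rcos_sum[of f f'] by simp

text \<open>
  The product of two cosets is defined as a union over all representatives; by \<open>Rels_rep_mult\<close> they all
  give the same coset.
\<close>

lemma rep_ring_mult:
  assumes f: "f \<in> carrier Fr" "f' \<in> carrier Fr"
  shows "residue f \<otimes>\<^bsub>Rep\<^esub> residue f' = residue (rep_mult f f')"
proof -
  have "residue (rep_mult u v) = residue (rep_mult f f')" if u: "u \<in> residue f" "v \<in> residue f'" for u v
  proof -
    have ui: "u - f \<in> Rels" "v - f' \<in> Rels" using u f by (simp_all only: mem_residue_iff)
    have uc: "u \<in> carrier Fr" "v \<in> carrier Fr"
      using Fr.a_r_coset_subset_G[OF Rels.a_subset f(1)] Fr.a_r_coset_subset_G[OF Rels.a_subset f(2)] u by blast+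
    have "rep_mult u v - rep_mult f f' = rep_mult (u - f) v + rep_mult f (v - f')"
      by (simp add: rep_mult_diff_left rep_mult_diff_right)
    also have "\<dots> \<in> Rels" using ui uc f by (intro Rels_add Rels_rep_mult)
    finally show ?thesis using f uc by (intro residue_eqI rep_mult_closed)
  qed
  moreover have "f \<in> residue f" "f' \<in> residue f'" using f by (simp_all only: mem_residue_iff) (simp_all add: Rels_zero)
  ultimately have "(\<Union>u\<in>residue f. \<Union>v\<in>residue f'. residue (rep_mult u v)) = residue (rep_mult f f')" by blast
  then show ?thesis by (simp add: rep_ring_def FactRing_def rcoset_mult_def)
qed

lemma rep_ring_abelian: "abelian_group Rep"
proof -
  have "add_monoid Rep = Fr A_Mod Rels"
    by (simp add: rep_ring_def FactRing_def A_FactGroup_def FactGroup_def A_RCOSETS_def set_add_def)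
  then show ?thesis using Rels.a_factorgroup_is_comm_group by (intro comm_group_abelian_groupI) simp
qed

sublocale Rep: abelian_group Rep by (rule rep_ring_abelian)

lemma rep_ring_mult_closed:
  "x \<in> carrier Rep \<Longrightarrow> y \<in> carrier Rep \<Longrightarrow> x \<otimes>\<^bsub>Rep\<^esub> y \<in> carrier Rep"
  unfolding rep_ring_carrier by (auto simp only: rep_ring_mult rep_mult_closed intro!: imageI)

end

section \<open>Binomial coefficients in characteristic \<open>p\<close>\<close>

text \<open>
  Otherwise \<open>p\<^sup>l\<close> is coprime to the binomial coefficient and divides
  \<open>c (p\<^sup>l choose c) = p\<^sup>l (p\<^sup>l - 1 choose c - 1)\<close>, hence \<open>c\<close>.
\<close>

lemma prime_power_choose_zero:
  assumes "Factorial_Ring.prime p" "CHAR('k::field) = p" "0 < c" "c < p ^ l"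
  shows "(of_nat (p ^ l choose c) :: 'k) = 0"
proof (rule ccontr)
  assume "\<not> ?thesis"
  then have "\<not> p dvd (p ^ l choose c)" using assms(2) by (simp add: of_nat_eq_0_iff_char_dvd)
  then have "coprime (p ^ l) (p ^ l choose c)" using assms(1) by (simp add: prime_imp_coprime)
  moreover have "p ^ l dvd c * (p ^ l choose c)" using times_binomial_minus1_eq[OF assms(3), of "p ^ l"] by simp
  ultimately have "p ^ l dvd c" by (simp add: coprime_dvd_mult_left_iff)
  then show False using assms(3,4) by (auto dest: dvd_imp_le)
qed

text \<open>
  By Vandermonde's identity and \<open>prime_power_choose_zero\<close>, adding \<open>p\<^sup>l\<close> to the upper entry adds \<open>1\<close>.
\<close>

lemma choose_prime_power:
  assumes p: "Factorial_Ring.prime p" "CHAR('k::field) = p" and t: "t < p ^ l"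
  shows "(of_nat ((s * p ^ l + t) choose p ^ l) :: 'k) = of_nat s"
proof (induction s)
  case 0 then show ?case using t by (simp add: binomial_eq_0)
next
  case (Suc s)
  let ?q = "p ^ l" and ?a = "s * p ^ l + t"
  have q: "0 < ?q" by (rule le_less_trans[OF _ t]) simp
  have "(of_nat ((?q + ?a) choose ?q) :: 'k) = (\<Sum>k\<le>?q. of_nat (?q choose k) * of_nat (?a choose (?q - k)))"
    by (simp flip: vandermonde)
  also have "\<dots> = (\<Sum>k\<in>{0, ?q}. of_nat (?q choose k) * of_nat (?a choose (?q - k)))"
  proof (rule sum.mono_neutral_right)
    show "\<forall>k\<in>{..?q} - {0, ?q}. of_nat (?q choose k) * of_nat (?a choose (?q - k)) = (0::'k)"
      using prime_power_choose_zero[OF p, of _ l] by auto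
  qed auto
  also have "\<dots> = of_nat (?a choose ?q) + 1" using q by simp
  finally have "(of_nat ((?q + ?a) choose ?q) :: 'k) = of_nat (Suc s)" unfolding Suc.IH by simp
  moreover have "Suc s * ?q + t = ?q + ?a" by simp
  ultimately show ?case by (simp only:)
qed

section \<open>Classes of block modules\<close>

context hopf_nakayama
begin

definition block_class :: "nat set \<Rightarrow> (nat \<Rightarrow> nat) \<Rightarrow> (nat \<Rightarrow> nat) \<Rightarrow> ('k umodule set \<Rightarrow>\<^sub>0 int) set" where
  "block_class B j len = residue (frag_of (block_iso_class B j len))"

abbreviation nak_class :: "nat \<Rightarrow> nat \<Rightarrow> ('k umodule set \<Rightarrow>\<^sub>0 int) set" where
  "nak_class i j \<equiv> block_class {0} (\<lambda>_. j) (\<lambda>_. i)"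

lemma frag_block_closed: "admissible B j len \<Longrightarrow> frag_of (block_iso_class B j len) \<in> carrier Fr"
  by (simp add: keys_frag_of block_iso_class_in)

lemma block_class_closed: "admissible B j len \<Longrightarrow> block_class B j len \<in> carrier Rep"
  unfolding rep_ring_carrier block_class_def by (intro imageI frag_block_closed)

lemma block_class_union:
  assumes "admissible (B1 \<union> B2) j len" "blocks B1 len \<inter> blocks B2 len = {}"
  shows "block_class (B1 \<union> B2) j len = block_class B1 j len \<oplus>\<^bsub>Rep\<^esub> block_class B2 j len"
proof -
  have g: "admissible B1 j len" "admissible B2 j len" using assms(1) by (auto simp: admissible_def)
  have "frag_of (block_iso_class B1 j len) + frag_of (block_iso_class B2 j len) - frag_of (block_iso_class (B1 \<union> B2) j len) \<in> direct_sum_relations n d"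
    unfolding block_iso_class_def block_module_def blocks_union
    by (rule direct_sum_relation[OF admissible_space[OF g(1)] admissible_space[OF g(2)]
        admissible_space[OF assms(1), unfolded blocks_union] assms(2)])
  then have "frag_of (block_iso_class B1 j len) + frag_of (block_iso_class B2 j len) - frag_of (block_iso_class (B1 \<union> B2) j len) \<in> Rels"
    unfolding rep_ideal_def by (rule generate.incl)
  then have "residue (frag_of (block_iso_class B1 j len) + frag_of (block_iso_class B2 j len)) = residue (frag_of (block_iso_class (B1 \<union> B2) j len))"
    using frag_block_closed[OF g(1)] frag_block_closed[OF g(2)] Fr.a_closed
    by (intro residue_eqI frag_block_closed[OF assms(1)]) auto
  then show ?thesis unfolding block_class_def using frag_block_closed[OF g(1)] frag_block_closed[OF g(2)] by (simp only: rep_ring_add)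
qed

text \<open>
  The zero module is the direct sum of two copies of itself.
\<close>

lemma block_class_null:
  assumes "admissible B j len" "blocks B len = {}"
  shows "block_class B j len = \<zero>\<^bsub>Rep\<^esub>"
  using block_class_union[of B B j len] assms block_class_closed[OF assms(1)] Rep.add.l_cancel_one' by simp

lemma block_class_single:
  assumes g: "admissible {a} j len"
  shows "block_class {a} j len = nak_class (len a) (j a)"
proof -
  have g': "admissible {0} (\<lambda>_. j a) (\<lambda>_. len a)" using g by (auto simp: admissible_def)
  have "block_iso_class {a} j len = block_iso_class {0} (\<lambda>_. j a) (\<lambda>_. len a)"
    unfolding block_iso_class_def block_module_def
  proof (rule graded_module_reindex[OF admissible_space[OF g] admissible_space[OF g'], where \<pi> = "\<lambda>(_, k). (a, k)"])
    show "bij_betw (\<lambda>(_, k). (a, k)) (blocks {0} (\<lambda>_. len a)) (blocks {a} len)"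
      by (auto simp: bij_betw_def inj_on_def blocks_def image_iff)
  qed (auto simp: block_grade_def block_shift_def blocks_def fun_eq_iff)
  then show ?thesis by (simp add: block_class_def)
qed

lemma rep_class_nak:
  assumes "i \<le> d" "j < n"
  shows "rep_class n d (nak_module n d i j :: ('k trunc_elt, 'k trunc_elt set) module) = nak_class i j"
proof -
  interpret nakayama_vertex n d Kt j by unfold_locales (rule assms(2))
  have iso: "module_isomorphic A (block_module n d {0} (\<lambda>_. j) (\<lambda>_. i)) (nak_module n d i j)"
    by (rule nak_module_iso[OF assms(1)])
  have g: "admissible {0} (\<lambda>_. j) (\<lambda>_. i)" using assms by (auto simp: admissible_def)
  have "iso_class n d (nak_module n d i j) = block_iso_class {0} (\<lambda>_. j) (\<lambda>_. i)"
    unfolding block_iso_class_def by (rule iso_class_eqI[OF module_isomorphic_sym[OF block_left_module[OF g] iso] iso])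
  then show ?thesis by (simp add: rep_class_def block_class_def)
qed

lemma rep_ring_one: "\<one>\<^bsub>Rep\<^esub> = nak_class 1 0"
proof -
  have "\<one>\<^bsub>Rep\<^esub> = rep_class n d (nak_module n d 1 0 :: ('k trunc_elt, 'k trunc_elt set) module)"
    by (simp add: rep_ring_def FactRing_def rep_class_def free_rep_ring_def)
  then show ?thesis using d_pos n_pos by (subst (asm) rep_class_nak) auto
qed

lemma block_class_mult:
  assumes "admissible B j len" "admissible B' j' len'"
  shows "block_class B j len \<otimes>\<^bsub>Rep\<^esub> block_class B' j' len' = residue (frag_of (iso_class n d (tensor_blocks B j len B' j' len')))"
  unfolding block_class_def rep_ring_mult[OF frag_block_closed[OF assms(1)] frag_block_closed[OF assms(2)]] rep_mult_of class_tensor_blocks[OF assms] ..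

text \<open>
  The operator on the one-dimensional factor is zero, so the tensor product is the other factor with
  its grades raised by one.
\<close>

lemma nak_class_shift:
  assumes i: "i \<le> d" and j: "j < n" and n: "1 < n"
  shows "nak_class 1 1 \<otimes>\<^bsub>Rep\<^esub> nak_class i j = nak_class i ((j + 1) mod n)"
proof -
  have g: "admissible {0} (\<lambda>_. 1) (\<lambda>_. 1)" "admissible {0} (\<lambda>_. j) (\<lambda>_. i)" "admissible {0} (\<lambda>_. (j + 1) mod n) (\<lambda>_. i)"
    using i j n d_pos by (auto simp: admissible_def)
  have "iso_class n d (tensor_blocks {0} (\<lambda>_. 1) (\<lambda>_. 1) {0} (\<lambda>_. j) (\<lambda>_. i)) = block_iso_class {0} (\<lambda>_. (j + 1) mod n) (\<lambda>_. i)"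
    unfolding block_iso_class_def block_module_def
  proof (rule graded_module_reindex[OF admissible_tensor_space[OF g(1,2)] admissible_space[OF g(3)], where \<pi> = "\<lambda>q. ((0, 0), q)"])
    show "bij_betw (\<lambda>q. ((0, 0), q)) (blocks {0} (\<lambda>_. i)) (blocks {0} (\<lambda>_. 1) \<times> blocks {0} (\<lambda>_. i))"
      by (auto simp: bij_betw_def inj_on_def blocks_def image_iff)
    show "tensor_grade (block_grade (\<lambda>_. 1)) (block_grade (\<lambda>_. j)) ((0, 0), q) mod n
        = block_grade (\<lambda>_. (j + 1) mod n) q mod n" for q
      by (cases q) (simp add: tensor_grade_def block_grade_def mod_simps)
  qed (auto simp: tensor_shift_def block_shift_def blocks_def supported_def fun_eq_iff)
  then show ?thesis unfolding block_class_mult[OF g(1,2)] by (simp add: block_class_def)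
qed

section \<open>The longest summand of a tensor product\<close>

lemma all_arrows_closed: "(\<lambda>i l'. if i < n \<and> l' = l then 1 else 0) \<in> carrier P"
  by (rule path_carrierI[where b="Suc l"]) (auto split: if_splits)

text \<open>
  The sum of all paths of length \<open>l\<close> acts as \<open>N\<^sup>l\<close>. Powers of \<open>N\<close> are therefore preserved by
  isomorphisms.
\<close>

lemma (in graded_space) act_all_arrows:
  assumes "l < d"
  shows "act (\<lambda>i l'. if i < n \<and> l' = l then 1 else 0) f = (N ^^ l) f"
proof
  fix p
  have "act (\<lambda>i l'. if i < n \<and> l' = l then 1 else 0) f p = (\<Sum>k<d. if k = l then (N ^^ l) f p else 0)"
    unfolding graded_action_def using n_pos by (intro sum.cong) auto
  then show "act (\<lambda>i l'. if i < n \<and> l' = l then 1 else 0) f p = (N ^^ l) f p" using assms by simp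
qed

text \<open>
  The number of summands of length \<open>q + r\<close> is the rank of \<open>N\<close> to the power \<open>q + r - 1\<close>, and longer
  summands exist only if a higher power is nonzero. For degree reasons this power maps every basis
  vector except the lowest one to \<open>0\<close>, and the lowest one to a multiple of the highest one.
\<close>

lemma tensor_longest_block:
  assumes q: "1 \<le> q" "1 \<le> r" "q + r \<le> d" and nz: "(of_nat (q + r - 1 choose q) :: 'k) \<noteq> 0"
  obtains t j len a0 where "admissible {0..<t} j len" "nak_class (q + 1) 0 \<otimes>\<^bsub>Rep\<^esub> nak_class r 0 = block_class {0..<t} j len"
    "a0 < t" "len a0 = q + r" "\<And>a. a < t \<Longrightarrow> a \<noteq> a0 \<Longrightarrow> len a < q + r"
proof -
  let ?B1 = "blocks {0} (\<lambda>_. q + 1)" and ?B2 = "blocks {0} (\<lambda>_. r)"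
  let ?N = "block_shift (\<lambda>_. q + 1) :: (nat \<times> nat \<Rightarrow> 'k) \<Rightarrow> _" and ?N' = "block_shift (\<lambda>_. r) :: (nat \<times> nat \<Rightarrow> 'k) \<Rightarrow> _"
  have g: "admissible {0} (\<lambda>_. 0) (\<lambda>_. q + 1)" "admissible {0} (\<lambda>_. 0) (\<lambda>_. r)" using q n_pos by (auto simp: admissible_def)
  interpret graded_pair n d Kt ?B1 "block_grade (\<lambda>_. 0)" ?N ?B2 "block_grade (\<lambda>_. 0)" ?N'
    by (rule admissible_pair[OF g])
  obtain t j len where admissible: "admissible {0..<0 + t} j len" and iso: "module_isomorphic A (block_module n d {0..<0 + t} j len) T.M"
    and cl: "iso_class n d T.M = block_iso_class {0..<0 + t} j len"
    using fg_blocks[OF T.M_fg, of 0] by metis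
  interpret Bl: graded_space n d Kt "blocks {0..<0 + t} len" "block_grade j" "block_shift len :: (_ \<Rightarrow> 'k) \<Rightarrow> _"
    by (rule admissible_space[OF admissible])
  obtain f where f: "module_iso f A Bl.M T.M" using iso by (auto simp: module_isomorphic_iff block_module_def)
  let ?I = "blocks {0..<0 + t} len" and ?NB = "block_shift len :: (nat \<times> nat \<Rightarrow> 'k) \<Rightarrow> _"
  have f_inj: "u = v" if "u \<in> supported ?I" "v \<in> supported ?I" "f u = f v" for u v
    using module_isoD(1)[OF f] that unfolding bij_betw_def Bl.M_simps(1) by (auto dest: inj_onD)
  have f_sup: "f u \<in> supported (?B1 \<times> ?B2)" if "u \<in> supported ?I" for u
    using module_isoD(2)[OF f, of u] that by (simp only: Bl.M_simps T.M_simps)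
  have f_act: "f (Bl.act x u) = T.act x (f u)" if "x \<in> carrier P" "u \<in> supported ?I" for x u
    using module_isoD(4)[OF f, of "tc x" u] that by (simp only: Bl.M_smult T.M_smult tc_closed Bl.M_simps(1))
  have f_pow: "f ((?NB ^^ l) u) = (NT ^^ l) (f u)" if "l < d" "u \<in> supported ?I" for l u
    using f_act[OF all_arrows_closed that(2), of l] by (simp only: Bl.act_all_arrows[OF that(1)] T.act_all_arrows[OF that(1)])
  have f_scale: "f (\<lambda>p. c * u p) = (\<lambda>p. c * f u p)" if "u \<in> supported ?I" for c u
  proof -
    have "f (Bl.act (path_scale c (path_one n)) u) = T.act (path_scale c (path_one n)) (f u)"
      by (intro f_act path_scale_in_carrier path_one_closed that)
    then show ?thesis by (simp only: Bl.act_scalar T.act_scalar)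
  qed
  have f_zero: "f (\<lambda>p. 0) = (\<lambda>p. 0)" using f_scale[OF supported_zero, of 0] by simp
  let ?m = "q + r"
  define top :: "(nat \<times> nat) \<times> nat \<times> nat" where "top = ((0, q), (0, r - 1))"
  define bot :: "(nat \<times> nat) \<times> nat \<times> nat" where "bot = ((0, 0), (0, 0))"
  have shift_delta: "(?N ^^ a) (delta (0, k)) (b, x) = (if b = 0 \<and> x = a + k \<and> x \<le> q then 1 else 0)" if "k \<le> q" for a k b x
  proof -
    have dl: "delta (0, k) \<in> supported ?B1" by (rule S.delta_supported) (use that in \<open>auto simp: blocks_def\<close>)
    show ?thesis unfolding block_shift_pow_supported[OF dl] using that by (auto simp: delta_def)
  qed
  have shift_delta': "(?N' ^^ a) (delta (0, k)) (b, x) = (if b = 0 \<and> x = a + k \<and> x < r then 1 else 0)" if "k < r" for a k b x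
  proof -
    have dl: "delta (0, k) \<in> supported ?B2" by (rule S'.delta_supported) (use that in \<open>auto simp: blocks_def\<close>)
    show ?thesis unfolding block_shift_pow_supported[OF dl] using that by (auto simp: delta_def)
  qed
  have pow_top: "(NT ^^ (?m - 1)) G = (\<lambda>p. G bot * of_nat (?m - 1 choose q) * delta top p)"
    and pow_zero: "(NT ^^ ?m) G = (\<lambda>p. 0)" if G: "G \<in> supported (?B1 \<times> ?B2)" for G
  proof -
    have "(NT ^^ (?m - 1)) G = (\<lambda>p. G bot * of_nat (?m - 1 choose q) * delta top p)"
      using T0.fin G
    proof (induction rule: supported_induct)
      case zero show ?case unfolding T0.Npow_zero by simp
    next
      case (step h c pq)
      obtain k k' where pq: "pq = ((0, k), (0, k'))" "k \<le> q" "k' < r" using step.hyps(2) by (auto simp: blocks_def)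
      have "(NT ^^ (?m - 1)) (delta pq) (p, s) = delta pq bot * of_nat (?m - 1 choose q) * delta top (p, s)" for p s
      proof -
        obtain b x where p: "p = (b, x)" by (cases p)
        obtain b' y where s: "s = (b', y)" by (cases s)
        have "(NT ^^ (?m - 1)) (delta pq) (p, s) = (\<Sum>a\<le>?m - 1. if a = q then
            (if k = 0 \<and> k' = 0 \<and> b = 0 \<and> b' = 0 \<and> x = q \<and> y = r - 1
             then of_nat (?m - 1 choose q) else 0) else 0)"
          unfolding pq(1) delta_ptensor[of "(0, k)" "(0, k')"] NT_pow_ptensor
        proof (rule sum.cong[OF refl])
          have indicator: "(if Q then 1 else 0) * (if R then 1 else 0) = (if Q \<and> R then 1 else (0 :: 'k))" for Q R by simp
          fix a assume "a \<in> {..?m - 1}"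
          \<comment> \<open>Both factors survive only if \<open>a\<close> is at most \<open>q - k\<close> and \<open>q + r - 1 - a\<close> is at most \<open>r - 1 - k'\<close>.\<close>
          then have arith: "(b = 0 \<and> x = a + k \<and> x \<le> q) \<and> (b' = 0 \<and> y = (?m - 1 - a) + k' \<and> y < r) \<longleftrightarrow>
              a = q \<and> k = 0 \<and> k' = 0 \<and> b = 0 \<and> b' = 0 \<and> x = q \<and> y = r - 1"
            using q by auto
          have "ptensor ((?N ^^ a) (delta (0, k))) ((?N' ^^ (?m - 1 - a)) (delta (0, k'))) (p, s)
            = (if (b = 0 \<and> x = a + k \<and> x \<le> q) \<and> (b' = 0 \<and> y = (?m - 1 - a) + k' \<and> y < r) then 1 else 0)"
            unfolding ptensor_def p s prod.case shift_delta[OF pq(2)] shift_delta'[OF pq(3)] by (rule indicator)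
          then show "of_nat (?m - 1 choose a) * ptensor ((?N ^^ a) (delta (0, k))) ((?N' ^^ (?m - 1 - a)) (delta (0, k'))) (p, s)
            = (if a = q then (if k = 0 \<and> k' = 0 \<and> b = 0 \<and> b' = 0 \<and> x = q \<and> y = r - 1 then of_nat (?m - 1 choose q) else 0) else 0)"
            unfolding arith by simp
        qed
        also have "\<dots> = (if k = 0 \<and> k' = 0 \<and> b = 0 \<and> b' = 0 \<and> x = q \<and> y = r - 1 then of_nat (?m - 1 choose q) else 0)"
          using q by simp
        finally show ?thesis by (auto simp: pq(1) p s delta_def bot_def top_def)
      qed
      then have e: "(NT ^^ (?m - 1)) (delta pq) = (\<lambda>p. delta pq bot * of_nat (?m - 1 choose q) * delta top p)" by auto
      show ?case unfolding T0.Npow_add T0.Npow_scale e step.IH by (simp add: algebra_simps)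
    qed
    then show pt: "(NT ^^ (?m - 1)) G = (\<lambda>p. G bot * of_nat (?m - 1 choose q) * delta top p)" .
    have "NT (delta top) = (\<lambda>p. 0)"
    proof
      fix pq :: "(nat \<times> nat) \<times> nat \<times> nat" obtain b x b' y where pq: "pq = ((b, x), (b', y))" by (metis surj_pair)
      have "?N (delta (0, q)) (b, x) = 0" using shift_delta[of q 1 b x] by (auto split: if_splits)
      moreover have "?N' (delta (0, r - 1)) (b', y) = 0"
        using shift_delta'[of "r - 1" 1 b' y] q by (auto split: if_splits)
      ultimately show "NT (delta top) pq = 0"
        unfolding top_def delta_ptensor[of "(0, q)" "(0, r - 1)"] NT_ptensor by (simp add: ptensor_def pq)
    qed
    moreover have "(NT ^^ ?m) G = NT ((NT ^^ (?m - 1)) G)" using q by (cases "q + r") simp_all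
    ultimately show "(NT ^^ ?m) G = (\<lambda>p. 0)" unfolding pt T0.N_scale by simp
  qed
  have B_delta: "(?NB ^^ l) (delta (a, 0)) (b, x) = (if b = a \<and> x = l then 1 else 0)" if "a < t" "l < len a" for a l b x
  proof -
    have dl: "delta (a, 0) \<in> supported ?I" by (rule Bl.delta_supported) (use that in \<open>auto simp: blocks_def\<close>)
    show ?thesis unfolding block_shift_pow_supported[OF dl] using that by (auto simp: delta_def)
  qed
  have dsup: "delta (a, 0) \<in> supported ?I" if "a < t" "0 < len a" for a
    by (rule Bl.delta_supported) (use that in \<open>auto simp: blocks_def\<close>)
  \<comment> \<open>A longer block would carry a nonzero power \<open>q + r\<close> of the operator.\<close>
  have len_le: "len a \<le> ?m" if a: "a < t" for a
  proof (rule ccontr)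
    assume "\<not> len a \<le> ?m"
    moreover have "len a \<le> d" using admissible a by (simp add: admissible_def)
    ultimately have l: "?m < len a" "?m < d" by linarith+
    have "f ((?NB ^^ ?m) (delta (a, 0))) = f (\<lambda>p. 0)"
      using l a by (simp only: f_pow[OF l(2) dsup] pow_zero[OF f_sup[OF dsup]] f_zero)
    then have "(?NB ^^ ?m) (delta (a, 0)) = (\<lambda>p. 0)"
      using dsup[OF a] l by (intro f_inj Bl.Npow_supported supported_zero) auto
    from fun_cong[OF this, of "(a, ?m)"] show False using B_delta[OF a l(1)] by simp
  qed
  have m1: "?m - 1 < d" using q by simp
  obtain u where u: "u \<in> supported ?I" "f u = delta bot"
  proof -
    have "delta bot \<in> carrier T.M"
      unfolding T.M_simps(1) by (rule T.delta_supported) (use q in \<open>auto simp: bot_def blocks_def\<close>)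
    then have "delta bot \<in> f ` carrier Bl.M" using module_isoD(1)[OF f] by (simp only: bij_betw_def)
    then show ?thesis using that unfolding Bl.M_simps(1) by (metis imageE)
  qed
  have "(?NB ^^ (?m - 1)) u \<noteq> (\<lambda>p. 0)"
  proof
    assume "(?NB ^^ (?m - 1)) u = (\<lambda>p. 0)"
    then have "(NT ^^ (?m - 1)) (delta bot) = (\<lambda>p. 0)" using f_pow[OF m1 u(1)] by (simp only: u(2) f_zero)
    moreover have "(delta bot :: _ \<Rightarrow> 'k) \<in> supported (?B1 \<times> ?B2)" using f_sup[OF u(1)] by (simp only: u(2))
    ultimately have "(\<lambda>p. delta bot bot * of_nat (?m - 1 choose q) * delta top p) = (\<lambda>p. 0::'k)" by (simp only: pow_top)
    from fun_cong[OF this, of top] show False using nz by (simp add: delta_def)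
  qed
  \<comment> \<open>The power \<open>q + r - 1\<close> is nonzero, so some block has at least this length plus one.\<close>
  then obtain a0 x where "(?NB ^^ (?m - 1)) u (a0, x) \<noteq> 0" by fastforce
  then have a0': "?m - 1 \<le> x" "x < len a0" "u (a0, x - (?m - 1)) \<noteq> 0"
    by (auto simp: block_shift_pow_supported[OF u(1)] split: if_splits)
  then have "a0 < t" using u(1) by (auto simp: supported_def blocks_def)
  then have a0: "a0 < t" "len a0 = ?m" using len_le[of a0] a0' by auto
  \<comment> \<open>Two blocks of length \<open>q + r\<close> would give linearly independent vectors in the image of the power
    \<open>q + r - 1\<close>, which is spanned by the highest basis vector.\<close>
  have uniq: "len a < ?m" if a: "a < t" "a \<noteq> a0" for a
  proof (rule ccontr)
    assume "\<not> len a < ?m"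
    then have la: "len a = ?m" using len_le[OF a(1)] by simp
    have pos: "?m - 1 < len a" "?m - 1 < len a0" "0 < len a" "0 < len a0" using q la a0 by auto
    define w where "w = (?NB ^^ (?m - 1)) (delta (a, 0))"
    define w0 where "w0 = (?NB ^^ (?m - 1)) (delta (a0, 0))"
    have ws: "w \<in> supported ?I" "w0 \<in> supported ?I"
      unfolding w_def w0_def
      by (rule Bl.Npow_supported[OF dsup[OF a(1) pos(3)]], rule Bl.Npow_supported[OF dsup[OF a0(1) pos(4)]])
    obtain c where c: "f w = (\<lambda>p. c * delta top p)"
      unfolding w_def f_pow[OF m1 dsup[OF a(1) pos(3)]] pow_top[OF f_sup[OF dsup[OF a(1) pos(3)]]] by blast
    obtain c0 where c0: "f w0 = (\<lambda>p. c0 * delta top p)"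
      unfolding w0_def f_pow[OF m1 dsup[OF a0(1) pos(4)]] pow_top[OF f_sup[OF dsup[OF a0(1) pos(4)]]] by blast
    have "f (\<lambda>p. c0 * w p) = f (\<lambda>p. c * w0 p)"
      unfolding f_scale[OF ws(1)] f_scale[OF ws(2)] c c0 by (simp add: mult_ac)
    then have "(\<lambda>p. c0 * w p) = (\<lambda>p. c * w0 p)"
      using ws by (intro f_inj) (auto simp: supported_def)
    from fun_cong[OF this, of "(a, ?m - 1)"] have "c0 = 0"
      using B_delta[OF a(1) pos(1), of a "?m - 1"] B_delta[OF a0(1) pos(2), of a "?m - 1"] a(2)
      by (simp add: w_def w0_def)
    then have "f w0 = f (\<lambda>p. 0)" using c0 f_zero by simp
    then have "w0 = (\<lambda>p. 0)" by (intro f_inj ws supported_zero)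
    from fun_cong[OF this, of "(a0, ?m - 1)"] show False
      using B_delta[OF a0(1) pos(2), of a0 "?m - 1"] by (simp add: w0_def)
  qed
  have "nak_class (q + 1) 0 \<otimes>\<^bsub>Rep\<^esub> nak_class r 0 = block_class {0..<t} j len"
    unfolding block_class_mult[OF g] unfolding cl block_class_def by simp
  then show ?thesis using admissible a0 uniq by (intro that[of t j len a0]) auto
qed

section \<open>Generators\<close>

lemma generate_ring_closed:
  assumes "G \<subseteq> carrier Rep"
  shows "generate_ring Rep G \<subseteq> carrier Rep"
proof
  fix x assume "x \<in> generate_ring Rep G"
  then show "x \<in> carrier Rep"
  proof (induction rule: generate_ring.induct)
    case one
    show ?case unfolding rep_ring_one using d_pos n_pos by (intro block_class_closed) (auto simp: admissible_def)
  next
    case (incl h) then show ?case using assms by auto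
  next
    case (a_inv h) show ?case using a_inv.IH by (rule Rep.a_inv_closed)
  next
    case (eng_add h1 h2) then show ?case by (intro Rep.a_closed)
  next
    case (eng_mult h1 h2) then show ?case by (intro rep_ring_mult_closed)
  qed
qed

lemma block_class_in_generate_ring:
  assumes G: "G \<subseteq> carrier Rep" and g: "admissible B j len"
    and s: "\<And>a. a \<in> B \<Longrightarrow> 0 < len a \<Longrightarrow> nak_class (len a) (j a) \<in> generate_ring Rep G"
  shows "block_class B j len \<in> generate_ring Rep G"
proof -
  have "finite B" using g by (simp add: admissible_def)
  have zero: "\<zero>\<^bsub>Rep\<^esub> \<in> generate_ring Rep G"
  proof -
    have o: "\<one>\<^bsub>Rep\<^esub> \<in> generate_ring Rep G" by (rule generate_ring.one)
    then have "\<one>\<^bsub>Rep\<^esub> \<oplus>\<^bsub>Rep\<^esub> \<ominus>\<^bsub>Rep\<^esub> \<one>\<^bsub>Rep\<^esub> \<in> generate_ring Rep G"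
      by (intro generate_ring.eng_add generate_ring.a_inv)
    moreover have "\<one>\<^bsub>Rep\<^esub> \<in> carrier Rep" using o generate_ring_closed[OF G] by auto
    ultimately show ?thesis by (simp add: Rep.r_neg)
  qed
  from \<open>finite B\<close> g s show ?thesis
  proof (induction B rule: finite_induct)
    case empty
    then show ?case using block_class_null[of "{}" j len] zero by (simp add: blocks_def)
  next
    case (insert a B)
    have ga: "admissible {a} j len" and gB: "admissible B j len" using insert.prems(1) by (auto simp: admissible_def)
    have "block_class (insert a B) j len = block_class {a} j len \<oplus>\<^bsub>Rep\<^esub> block_class B j len"
      using block_class_union[of "{a}" B j len] insert by (auto simp: blocks_def)
    moreover have "block_class {a} j len \<in> generate_ring Rep G"
    proof (cases "len a = 0")
      case True
      then show ?thesis using block_class_null[OF ga] zero by (simp add: blocks_def)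
    next
      case False
      then show ?thesis using insert.prems(2)[of a] block_class_single[OF ga] by simp
    qed
    ultimately show ?case using insert gB by (simp add: generate_ring.eng_add)
  qed
qed

lemma generate_ring_eq_carrier:
  assumes G: "G \<subseteq> carrier Rep"
    and s: "\<And>i j. 1 \<le> i \<Longrightarrow> i \<le> d \<Longrightarrow> j < n \<Longrightarrow> nak_class i j \<in> generate_ring Rep G"
  shows "generate_ring Rep G = carrier Rep"
proof
  show "generate_ring Rep G \<subseteq> carrier Rep" by (rule generate_ring_closed[OF G])
  have "residue f \<in> generate_ring Rep G" if "Poly_Mapping.keys f \<subseteq> iso_classes n d" for f
    using that
  proof (induction f rule: free_Abelian_group_induct[consumes 1])
    case 1
    have "residue 0 = Rels" using Fr.a_coset_add_zero[OF Rels.a_subset] by simp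
    moreover have "\<zero>\<^bsub>Rep\<^esub> = Rels" by (simp add: rep_ring_def FactRing_def)
    moreover have "\<zero>\<^bsub>Rep\<^esub> \<in> generate_ring Rep G"
      using block_class_in_generate_ring[OF G, of "{}" id id] block_class_null[of "{}" id id] by (simp add: admissible_def blocks_def)
    ultimately show ?case by simp
  next
    case (2 x y)
    have xy: "x - y \<in> carrier Fr" "y \<in> carrier Fr" using 2 keys_diff[of x y] by auto
    have c: "residue y \<in> carrier Rep" "residue (x - y) \<in> carrier Rep" using xy by (auto simp only: rep_ring_carrier)
    have "residue (x - y) \<oplus>\<^bsub>Rep\<^esub> residue y = residue x" unfolding rep_ring_add[OF xy] by simp
    then have "residue (x - y) = residue x \<oplus>\<^bsub>Rep\<^esub> \<ominus>\<^bsub>Rep\<^esub> residue y" using c by (metis Rep.add.inv_solve_right Rep.a_closed)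
    then show ?case using 2 by (simp add: generate_ring.eng_add generate_ring.a_inv)
  next
    case (3 C)
    obtain t j len where C: "admissible {0..<0 + t} j len" "C = block_iso_class {0..<0 + t} j len" using 3 by (rule iso_classes_E)
    have "block_class {0..<0 + t} j len \<in> generate_ring Rep G"
      using C(1) by (intro block_class_in_generate_ring[OF G C(1)] s) (auto simp: admissible_def)
    then show ?case by (simp add: block_class_def C(2))
  qed
  then show "carrier Rep \<subseteq> generate_ring Rep G" unfolding rep_ring_carrier by auto
qed

text \<open>
  Multiplication by the class of \<open>M(1, 1)\<close> runs through all vertices.
\<close>

lemma nak_class_all_vertices:
  assumes n: "1 < n" and i: "i \<le> d" "j0 < n" and 1: "nak_class 1 1 \<in> generate_ring Rep G" "nak_class i j0 \<in> generate_ring Rep G" and j: "j < n"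
  shows "nak_class i j \<in> generate_ring Rep G"
proof -
  have "nak_class i ((j0 + k) mod n) \<in> generate_ring Rep G" for k
  proof (induction k)
    case 0 then show ?case using 1 i by simp
  next
    case (Suc k)
    have "nak_class 1 1 \<otimes>\<^bsub>Rep\<^esub> nak_class i ((j0 + k) mod n) \<in> generate_ring Rep G" using 1 Suc by (intro generate_ring.eng_mult)
    also have "nak_class 1 1 \<otimes>\<^bsub>Rep\<^esub> nak_class i ((j0 + k) mod n) = nak_class i (((j0 + k) mod n + 1) mod n)"
      using n_pos by (intro nak_class_shift[OF i(1) _ n]) simp
    finally show ?case by (simp add: mod_simps)
  qed
  from this[of "n - j0 + j"] show ?thesis using i j by simp
qed

end

theorem theorem6p3:
  fixes p m n d :: nat
  assumes "Factorial_Ring.prime p" and "CHAR('k::alg_closed_field) = p"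
    and "1 \<le> m" and "d = p ^ m" and "d \<le> n"
  shows "generate_ring (rep_ring n d)
           ({rep_class n d (nak_module n d 1 1 :: ('k trunc_elt, 'k trunc_elt set) module),
             rep_class n d (nak_module n d 2 0)} \<union>
            {rep_class n d (nak_module n d (p ^ l + 1) 0) | l. 1 \<le> l \<and> l \<le> m - 1})
         = carrier (rep_ring n d)"
proof -
  have p2: "2 \<le> p" using assms(1) by (rule prime_ge_2_nat)
  have d2: "2 \<le> d"
    using p2 assms(3) unfolding assms(4) by (metis le_trans self_le_power one_le_numeral order_trans zero_less_one less_le_trans zero_less_numeral)
  interpret hopf_nakayama n d "TYPE('k)"
  proof unfold_locales
    show "0 < d" "d \<le> n" using d2 assms(5) by auto
    show "(of_nat (d choose c) :: 'k) = 0" if "0 < c" "c < d" for c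
      using prime_power_choose_zero[OF assms(1,2) that(1)] that(2) by (simp add: assms(4))
  qed
  have n1: "1 < n" using d2 assms(5) by simp
  have pl: "p ^ l + 1 \<le> d" if "l \<le> m - 1" for l
  proof -
    have "p ^ l < p ^ m" using that assms(3) p2 by (intro power_strict_increasing) auto
    then show ?thesis by (simp add: assms(4))
  qed
  let ?G = "{rep_class n d (nak_module n d 1 1 :: ('k trunc_elt, 'k trunc_elt set) module),
             rep_class n d (nak_module n d 2 0)} \<union>
            {rep_class n d (nak_module n d (p ^ l + 1) 0) | l. 1 \<le> l \<and> l \<le> m - 1}"
  have c11: "rep_class n d (nak_module n d 1 1 :: ('k trunc_elt, 'k trunc_elt set) module) = nak_class 1 1"
    by (rule rep_class_nak) (use d2 n1 in auto)
  have c20: "rep_class n d (nak_module n d 2 0 :: ('k trunc_elt, 'k trunc_elt set) module) = nak_class 2 0"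
    by (rule rep_class_nak) (use d2 n1 in auto)
  have cl: "rep_class n d (nak_module n d (p ^ l + 1) 0 :: ('k trunc_elt, 'k trunc_elt set) module) = nak_class (p ^ l + 1) 0"
    if "l \<le> m - 1" for l
    by (rule rep_class_nak) (use pl[OF that] n1 in auto)
  have nakc: "nak_class i j \<in> carrier Rep" if "i \<le> d" "j < n" for i j
    using that by (intro block_class_closed) (auto simp: admissible_def)
  have G: "?G \<subseteq> carrier Rep"
    using c11 c20 cl pl d2 n1 by (auto intro!: nakc)
  have s11: "nak_class 1 1 \<in> generate_ring Rep ?G"
    unfolding c11[symmetric] by (rule generate_ring.incl) blast
  have spl: "nak_class (p ^ l + 1) 0 \<in> generate_ring Rep ?G" if "l \<le> m - 1" for l
  proof (cases "l = 0")
    case True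
    have "nak_class 2 0 \<in> generate_ring Rep ?G" unfolding c20[symmetric] by (rule generate_ring.incl) blast
    moreover have "p ^ l + 1 = 2" by (simp add: True)
    ultimately show ?thesis by (simp only:)
  next
    case False
    then have "1 \<le> l" by simp
    then show ?thesis unfolding cl[OF that, symmetric] using that by (intro generate_ring.incl) blast
  qed
  have "\<forall>j<n. nak_class i j \<in> generate_ring Rep ?G" if "1 \<le> i" "i \<le> d" for i
    using that
  proof (induction i rule: less_induct)
    case (less i)
    have "\<exists>j0<n. nak_class i j0 \<in> generate_ring Rep ?G"
    proof (cases "i = 1")
      case True
      then show ?thesis using generate_ring.one[of Rep ?G] n_pos unfolding rep_ring_one by blast
    next
      case False
      then have i2: "2 \<le> i" using less by simp
      \<comment> \<open>Let \<open>q = p\<^sup>l\<close> be the largest power of \<open>p\<close> below \<open>i\<close>. The class of \<open>M(q + 1, 0)\<close> is a generator, and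
        \<open>i - q\<close> is smaller than \<open>i\<close>, so the product with the class of \<open>M(i - q, 0)\<close> is known by induction.\<close>
      have "\<exists>l. p ^ l \<le> i - 1 \<and> i - 1 < p ^ (l + 1)" using p2 i2 by (intro ex_power_ivl1) auto
      then obtain l where l: "p ^ l \<le> i - 1" "i - 1 < p ^ (l + 1)" by blast
      have "p ^ l < p ^ m" using l i2 less.prems assms(4) by simp
      then have lm: "l \<le> m - 1" using p2 by (simp add: power_strict_increasing_iff)
      define r where "r = i - p ^ l"
      have q1: "1 \<le> p ^ l" using p2 by simp
      have r: "1 \<le> r" "p ^ l + r = i" using l i2 by (auto simp: r_def)
      show ?thesis
      proof (cases "r = 1")
        case True
        then have "p ^ l + 1 = i" using r by simp
        then have "nak_class i 0 \<in> generate_ring Rep ?G" using spl[OF lm] by (simp only:)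
        then show ?thesis using n_pos by blast
      next
        case False
        have nz: "(of_nat (p ^ l + r - 1 choose p ^ l) :: 'k) \<noteq> 0"
        proof -
          define s where "s = (i - 1) div p ^ l"
          have "i - 1 = s * p ^ l + (i - 1) mod p ^ l" unfolding s_def by (rule div_mult_mod_eq[symmetric])
          moreover have "(i - 1) mod p ^ l < p ^ l" using p2 by (intro mod_less_divisor) simp
          ultimately have "(of_nat ((i - 1) choose p ^ l) :: 'k) = of_nat s"
            using choose_prime_power[OF assms(1,2), of "(i - 1) mod p ^ l" l s] by simp
          moreover have "0 < s" "s < p"
            using l q1 p2 by (auto simp: s_def div_greater_zero_iff less_mult_imp_div_less mult.commute)
          then have "\<not> p dvd s" by (auto dest: dvd_imp_le)
          ultimately show ?thesis using assms(2) r by (simp add: of_nat_eq_0_iff_char_dvd)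
        qed
        \<comment> \<open>Subtracting the shorter summands, which are known by induction, leaves the class of the summand
          of length \<open>i\<close>.\<close>
        obtain t j len a0 where admissible: "admissible {0..<t} j len"
          and prod: "nak_class (p ^ l + 1) 0 \<otimes>\<^bsub>Rep\<^esub> nak_class r 0 = block_class {0..<t} j len"
          and a0: "a0 < t" "len a0 = p ^ l + r" and short: "\<And>a. a < t \<Longrightarrow> a \<noteq> a0 \<Longrightarrow> len a < p ^ l + r"
          using tensor_longest_block[OF q1 r(1) _ nz] r(2) less.prems by metis
        let ?C = "{0..<t} - {a0}"
        have gC: "admissible ?C j len" and ga: "admissible {a0} j len" using admissible a0(1) by (auto simp: admissible_def)
        have split: "block_class {0..<t} j len = block_class {a0} j len \<oplus>\<^bsub>Rep\<^esub> block_class ?C j len"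
          using block_class_union[of "{a0}" ?C j len] admissible a0 by (auto simp: blocks_def insert_absorb)
        have rs: "nak_class r 0 \<in> generate_ring Rep ?G"
          using less.IH[of r] r q1 less.prems n_pos by auto
        have P: "block_class {0..<t} j len \<in> generate_ring Rep ?G"
          unfolding prod[symmetric] by (rule generate_ring.eng_mult[OF spl[OF lm] rs])
        have C: "block_class ?C j len \<in> generate_ring Rep ?G"
        proof (rule block_class_in_generate_ring[OF G gC])
          fix a assume a: "a \<in> ?C" "0 < len a"
          then show "nak_class (len a) (j a) \<in> generate_ring Rep ?G"
            using short[of a] r less.prems admissible by (intro less.IH[rule_format]) (auto simp: admissible_def)
        qed
        have "block_class {a0} j len = block_class {0..<t} j len \<oplus>\<^bsub>Rep\<^esub> \<ominus>\<^bsub>Rep\<^esub> block_class ?C j len"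
          unfolding split using block_class_closed[OF ga] block_class_closed[OF gC] by (simp add: Rep.a_assoc Rep.r_neg)
        then have "block_class {a0} j len \<in> generate_ring Rep ?G"
          using P C by (simp only:) (intro generate_ring.eng_add generate_ring.a_inv)
        then have "nak_class i (j a0) \<in> generate_ring Rep ?G" using block_class_single[OF ga] a0 r by simp
        moreover have "j a0 < n" using ga by (simp add: admissible_def)
        ultimately show ?thesis by blast
      qed
    qed
    then obtain j0 where "j0 < n" "nak_class i j0 \<in> generate_ring Rep ?G" by blast
    then show ?case using nak_class_all_vertices[OF n1 less.prems(2) _ s11] by blast
  qed
  then show ?thesis by (intro generate_ring_eq_carrier[OF G]) auto
qed

end
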